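(* Let $\Omega\subset\mathbb R^2$ be a bounded open set and $\|\cdot\|$ a strictly convex norm on $\mathbb R^2$ that is $C^1$ on $\mathbb R^2\setminus\{0\}$. Let $m:\Omega\to\mathbb R^2$ be such that $m=\lim_n m_n$ in $L^2(\Omega)$ where $\{m_n\}\subset W^{1,2}(\Omega;\mathbb R^2)$ satisfy $\nabla\cdot m_n=0$ and $\lim_n I_{\epsilon_n}(m_n)=0$ (for some positive numbers $\epsilon_n$). Then $m$ is continuous outside a locally finite set of singular points in $\Omega$. For every singular point $x_0$ there exists $\beta\in\{-1,1\}$ such that, in any convex neighborhood $\mathcal U\subset\Omega$ of $x_0$, $m(x)=\beta V_{\mathsf B}(i(x-x_0))$ for (a.e.) $x\in\mathcal U$.
   Context: $I_\epsilon(m)=\int_\Omega(\epsilon|\nabla m|^2+\epsilon^{-1}(1-\|m\|^2)^2)\,dx$. $\mathbb R^2$ is identified with $\mathbb C$ and $i$ denotes counterclockwise rotation by $\pi/2$. $\|\cdot\|_*$ is the dual norm of $\|\cdot\|$, and the vortex associated to $\|\cdot\|$ is $V_{\mathsf B}=\nabla\|\cdot\|_*$ (defined on $\mathbb R^2\setminus\{0\}$). *)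

theory Defs
  imports "HOL-Analysis.Analysis"
begin

text \<open>R^2 is identified with the complex plane; all functions of x live on type complex.\<close>

coinductive smooth2 :: "(complex \<Rightarrow> real) \<Rightarrow> bool" where
  "(\<forall>x. f differentiable (at x)) \<Longrightarrow>
   smooth2 (\<lambda>x. frechet_derivative f (at x) 1) \<Longrightarrow>
   smooth2 (\<lambda>x. frechet_derivative f (at x) \<i>) \<Longrightarrow> smooth2 f"

definition test_fun :: "complex set \<Rightarrow> (complex \<Rightarrow> real) \<Rightarrow> bool" where
  "test_fun \<Omega> \<phi> \<longleftrightarrow> smooth2 \<phi> \<and> compact (closure {x. \<phi> x \<noteq> 0})
      \<and> closure {x. \<phi> x \<noteq> 0} \<subseteq> \<Omega>"

definition grad2 :: "(complex \<Rightarrow> real) \<Rightarrow> complex \<Rightarrow> complex" where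
  "grad2 \<phi> x = Complex (frechet_derivative \<phi> (at x) 1) (frechet_derivative \<phi> (at x) \<i>)"

definition L2_on :: "complex set \<Rightarrow> (complex \<Rightarrow> complex) \<Rightarrow> bool" where
  "L2_on \<Omega> f \<longleftrightarrow> set_borel_measurable lebesgue \<Omega> f
      \<and> set_integrable lebesgue \<Omega> (\<lambda>x. (norm (f x))\<^sup>2)"

definition weak_deriv :: "complex set \<Rightarrow> (complex \<Rightarrow> complex) \<Rightarrow> complex \<Rightarrow> (complex \<Rightarrow> complex) \<Rightarrow> bool" where
  "weak_deriv \<Omega> m e g \<longleftrightarrow> (\<forall>\<phi>. test_fun \<Omega> \<phi> \<longrightarrow>
      (\<integral>x\<in>\<Omega>. frechet_derivative \<phi> (at x) e *\<^sub>R m x \<partial>lebesgue)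
        = - (\<integral>x\<in>\<Omega>. \<phi> x *\<^sub>R g x \<partial>lebesgue))"

definition W12 :: "complex set \<Rightarrow> (complex \<Rightarrow> complex) \<Rightarrow> (complex \<Rightarrow> complex) \<Rightarrow> (complex \<Rightarrow> complex) \<Rightarrow> bool" where
  "W12 \<Omega> m D1 D2 \<longleftrightarrow> L2_on \<Omega> m \<and> L2_on \<Omega> D1 \<and> L2_on \<Omega> D2
      \<and> weak_deriv \<Omega> m 1 D1 \<and> weak_deriv \<Omega> m \<i> D2"

definition div_free :: "complex set \<Rightarrow> (complex \<Rightarrow> complex) \<Rightarrow> bool" where
  "div_free \<Omega> m \<longleftrightarrow> (\<forall>\<phi>. test_fun \<Omega> \<phi> \<longrightarrow>
      (\<integral>x\<in>\<Omega>. m x \<bullet> grad2 \<phi> x \<partial>lebesgue) = 0)"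

definition I_eps :: "(complex \<Rightarrow> real) \<Rightarrow> complex set \<Rightarrow> real \<Rightarrow> (complex \<Rightarrow> complex)
    \<Rightarrow> (complex \<Rightarrow> complex) \<Rightarrow> (complex \<Rightarrow> complex) \<Rightarrow> ennreal" where
  "I_eps N \<Omega> \<epsilon> m D1 D2 = (\<integral>\<^sup>+x\<in>\<Omega>. ennreal (\<epsilon> * ((norm (D1 x))\<^sup>2 + (norm (D2 x))\<^sup>2)
        + (1 - (N (m x))\<^sup>2)\<^sup>2 / \<epsilon>) \<partial>lebesgue)"

definition is_norm2 :: "(complex \<Rightarrow> real) \<Rightarrow> bool" where
  "is_norm2 N \<longleftrightarrow> (\<forall>x. N x = 0 \<longleftrightarrow> x = 0) \<and> (\<forall>c x. N (c *\<^sub>R x) = \<bar>c\<bar> * N x)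
      \<and> (\<forall>x y. N (x + y) \<le> N x + N y)"

definition strictly_convex_norm :: "(complex \<Rightarrow> real) \<Rightarrow> bool" where
  "strictly_convex_norm N \<longleftrightarrow> (\<forall>x y. N x = 1 \<longrightarrow> N y = 1 \<longrightarrow> x \<noteq> y \<longrightarrow> N ((1/2) *\<^sub>R (x + y)) < 1)"

definition C1_off_origin :: "(complex \<Rightarrow> real) \<Rightarrow> bool" where
  "C1_off_origin N \<longleftrightarrow> (\<exists>G. continuous_on (- {0}) G
      \<and> (\<forall>x. x \<noteq> 0 \<longrightarrow> (N has_derivative (\<lambda>h. G x \<bullet> h)) (at x)))"

definition dual_norm :: "(complex \<Rightarrow> real) \<Rightarrow> complex \<Rightarrow> real" where
  "dual_norm N y = Sup {x \<bullet> y | x. N x \<le> 1}"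

text \<open>The vortex V_B = gradient of the dual norm (on R^2 minus 0).\<close>
definition vortex :: "(complex \<Rightarrow> real) \<Rightarrow> complex \<Rightarrow> complex" where
  "vortex N x = (THE v. (dual_norm N has_derivative (\<lambda>h. v \<bullet> h)) (at x))"

definition locally_finite_in :: "complex set \<Rightarrow> complex set \<Rightarrow> bool" where
  "locally_finite_in S \<Omega> \<longleftrightarrow> (\<forall>x\<in>\<Omega>. \<exists>U. open U \<and> x \<in> U \<and> finite (S \<inter> U))"

end

theory Submission
  imports Defs
begin

text \<open>By the arithmetic-geometric mean inequality the energy bounds \<open>\<integral> \<bar>\<nabla>m\<^sub>n\<bar> \<bar>1 - N(m\<^sub>n)\<bar>\<close>, so in the limit
  all entropy productions vanish. Applied to entropies that concentrate at \<open>\<plusminus>z\<close>, where \<open>N z = 1\<close>, this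
  says that the sign of \<open>(\<i> z) \<bullet> m\<close> is constant along lines of direction \<open>\<i> \<nabla>N(z)\<close>. Hence for essential
  cluster values \<open>a\<close> of \<open>m\<close> at \<open>q\<close> and \<open>b\<close> at \<open>q'\<close>, the line spanned by the vortex value \<open>V(\<i>(q' - q))\<close> never
  separates \<open>a\<close> from \<open>b\<close> strictly. If \<open>m\<close> has two different cluster values \<open>a\<close>, \<open>b\<close> at \<open>q\<close>, then at every
  \<open>w\<close> for which \<open>V(\<i>(w - q))\<close> separates \<open>a\<close> and \<open>b\<close> the only values left are \<open>\<plusminus>V(\<i>(w - q))\<close>; comparing such
  points \<open>w\<close> with each other fixes the sign, letting \<open>w\<close> tend to \<open>q\<close> produces antipodal pairs of cluster
  values at \<open>q\<close>, and these force \<open>m\<close> to be a vortex around \<open>q\<close>. Where the cluster value is unique, \<open>m\<close> is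
  continuous because the cluster set has a closed graph.\<close>

section \<open>The vortex map of a planar norm\<close>

text \<open>The limit has no regularity to start from, so the geometry is phrased through weak sign
  inequalities between essential cluster values, which survive limits. A value \<open>a\<close> at
  \<open>q\<close> is only approached on sets of positive measure near \<open>q\<close>; a
  translation by exactly \<open>q' - q\<close> may miss it, so the kinetic identity is used for a
  slightly different translation \<open>h\<close>. Continuity of \<open>V\<close>, which comes from
  strict convexity, absorbs the change. Differentiability of \<open>N\<close> makes \<open>V\<close>
  injective on directions, and both together make it orientation preserving, which decides every
  comparison of signs. The direction \<open>\<i> * G z\<close> of the lines is the tangent of the
  unit circle at \<open>z\<close>: an entropy whose tangential component is a step of width \<delta>
  in \<open>cross z v\<close> needs on the circle only a small component along \<open>z\<close>,
  which disappears as \<delta> tends to 0. The step has the value 1/2 at 0, so the limit is the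
  three-valued sign. The bound by the arithmetic-geometric mean holds for all positive \<epsilon>,
  but deducing that the limit has norm 1 takes a bounded subsequence of the \<epsilon>; the
  remaining case is treated separately.\<close>

definition cross :: "complex \<Rightarrow> complex \<Rightarrow> real" where
  "cross x y = Re x * Im y - Im x * Re y"

lemma cross_eq_inner: "cross x y = (\<i> * x) \<bullet> y"
  by (simp add: cross_def inner_complex_def)

lemma cross_simps [simp]:
  "cross x x = 0" "cross 0 x = 0" "cross x 0 = 0"
  "cross (- x) y = - cross x y" "cross x (- y) = - cross x y"
  "cross (\<i> * x) (\<i> * y) = cross x y"
  "cross (c *\<^sub>R x) y = c * cross x y" "cross x (c *\<^sub>R y) = c * cross x y"
  by (auto simp: cross_def algebra_simps)

lemma cross_skew: "cross x y = - cross y x"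
  by (simp add: cross_def)

lemma cross_linear:
  "cross (x + y) w = cross x w + cross y w" "cross w (x + y) = cross w x + cross w y"
  "cross (x - y) w = cross x w - cross y w" "cross w (x - y) = cross w x - cross w y"
  by (auto simp: cross_def algebra_simps)

text \<open>Cauchy-Binet in dimension two. With maximizers for the first and functionals for the
  second pair it turns inequalities between pairings into the sign of a product of two cross
  products.\<close>

lemma cross_det:
  "(z1 \<bullet> w1) * (z2 \<bullet> w2) - (z1 \<bullet> w2) * (z2 \<bullet> w1) = cross z1 z2 * cross w1 w2"
  by (simp add: cross_def inner_complex_def algebra_simps)

lemma tendsto_cross [tendsto_intros]:
  "(f \<longlongrightarrow> a) F \<Longrightarrow> (g \<longlongrightarrow> b) F \<Longrightarrow> ((\<lambda>x. cross (f x) (g x)) \<longlongrightarrow> cross a b) F"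
  unfolding cross_def by (intro tendsto_intros)

lemma cross_i_self: "cross x (\<i> * x) = (norm x)\<^sup>2"
  unfolding cmod_power2 by (simp add: cross_def power2_eq_square)

lemma cross_eq_0_imp_scale:
  assumes "cross x y = 0" "x \<noteq> 0"
  shows "\<exists>c. y = c *\<^sub>R x"
proof -
  have "((Re x)\<^sup>2 + (Im x)\<^sup>2) * Re y = (x \<bullet> y) * Re x"
    "((Re x)\<^sup>2 + (Im x)\<^sup>2) * Im y = (x \<bullet> y) * Im x"
    using assms(1) unfolding cross_def inner_complex_def power2_eq_square by algebra+
  moreover have "(Re x)\<^sup>2 + (Im x)\<^sup>2 \<noteq> 0" using assms(2) by (simp add: complex_eq_iff)
  ultimately have "y = ((x \<bullet> y) / ((Re x)\<^sup>2 + (Im x)\<^sup>2)) *\<^sub>R x"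
    by (simp add: complex_eq_iff field_simps)
  then show ?thesis by blast
qed

section \<open>Norms on the plane, their unit balls and the maximizers of linear functionals\<close>

locale plane_norm =
  fixes N :: "complex \<Rightarrow> real"
  assumes norm2: "is_norm2 N"
begin

lemma N_eq_0 [simp]: "N x = 0 \<longleftrightarrow> x = 0"
  and N_scale [simp]: "N (c *\<^sub>R x) = \<bar>c\<bar> * N x"
  and N_triangle: "N (x + y) \<le> N x + N y"
  using norm2 by (auto simp: is_norm2_def)

lemma N_zero [simp]: "N 0 = 0"
  using norm2 by (simp add: is_norm2_def)

lemma N_minus [simp]: "N (- x) = N x"
  using N_scale[of "-1" x] by simp

lemma N_nonneg [simp]: "0 \<le> N x"
  using N_triangle[of x "- x"] by simp

lemma N_pos: "x \<noteq> 0 \<Longrightarrow> 0 < N x"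
  using N_nonneg[of x] N_eq_0[of x] by linarith

lemma N_diff_le: "\<bar>N x - N y\<bar> \<le> N (x - y)"
  using N_triangle[of "x - y" y] N_triangle[of "y - x" x] N_minus[of "x - y"] by (simp del: N_minus)

text \<open>Lipschitz constant of \<open>N\<close> with respect to the Euclidean norm, read off from
  the two coordinate vectors.\<close>

definition NL where "NL = N 1 + N \<i>"

lemma NL_pos: "0 < NL"
  unfolding NL_def by (simp add: N_pos add_pos_pos)

lemma N_le_norm: "N x \<le> NL * norm x"
proof -
  have "x = Re x *\<^sub>R 1 + Im x *\<^sub>R \<i>" by (simp add: complex_eq_iff)
  then have "N x \<le> \<bar>Re x\<bar> * N 1 + \<bar>Im x\<bar> * N \<i>"
    using N_triangle[of "Re x *\<^sub>R 1" "Im x *\<^sub>R \<i>"] by simp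
  also have "\<dots> \<le> norm x * N 1 + norm x * N \<i>"
    by (intro add_mono mult_right_mono abs_Re_le_cmod abs_Im_le_cmod) auto
  finally show ?thesis by (simp add: NL_def algebra_simps)
qed

lemma N_lipschitz: "\<bar>N x - N y\<bar> \<le> NL * norm (x - y)"
  using N_diff_le N_le_norm order_trans by blast

lemma continuous_N: "continuous_on S N"
proof -
  have "NL-lipschitz_on S N"
    using N_lipschitz NL_pos by (auto simp: lipschitz_on_def dist_norm less_imp_le)
  then show ?thesis by (rule lipschitz_on_continuous_on)
qed

lemma continuous_on_N [continuous_intros]:
  "continuous_on S f \<Longrightarrow> continuous_on S (\<lambda>x. N (f x))"
  using continuous_on_compose2[OF continuous_N[of UNIV]] by auto

lemma tendsto_N [tendsto_intros]: "(f \<longlongrightarrow> a) F \<Longrightarrow> ((\<lambda>x. N (f x)) \<longlongrightarrow> N a) F"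
  by (rule continuous_on_tendsto_compose[OF continuous_N[of UNIV]]) auto

lemma borel_measurable_N [measurable]: "N \<in> borel_measurable borel"
  by (intro borel_measurable_continuous_onI continuous_N)

lemma N_lower_bound: "\<exists>c>0. \<forall>x. c * norm x \<le> N x"
proof -
  have "\<exists>x\<in>sphere (0::complex) 1. \<forall>y\<in>sphere 0 1. N x \<le> N y"
    by (intro continuous_attains_inf continuous_N) auto
  then obtain x where x: "norm x = 1" "\<And>y. norm y = 1 \<Longrightarrow> N x \<le> N y" by auto
  have "N x * norm y \<le> N y" for y
  proof (cases "y = 0")
    case False
    have "N x \<le> N ((1 / norm y) *\<^sub>R y)" using False by (intro x(2)) simp
    then show ?thesis using False by (simp add: field_simps)
  qed simp
  moreover have "0 < N x" using x(1) by (intro N_pos) auto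
  ultimately show ?thesis by blast
qed

lemma compact_N_ball: "compact {x. N x \<le> 1}"
proof -
  obtain c where c: "c > 0" "\<And>x. c * norm x \<le> N x" using N_lower_bound by blast
  have "norm x \<le> 1 / c" if "N x \<le> 1" for x
    using c(2)[of x] that c(1) by (simp add: field_simps)
  then have "bounded {x. N x \<le> 1}" by (auto simp: bounded_iff)
  moreover have "closed {x. N x \<le> 1}"
    by (intro closed_Collect_le continuous_intros)
  ultimately show ?thesis using compact_eq_bounded_closed by blast
qed

lemma compact_N_sphere: "compact {x. N x = 1}"
proof -
  have "closed {x. N x = 1}" by (intro closed_Collect_eq continuous_intros)
  moreover have "{x. N x = 1} = {x. N x \<le> 1} \<inter> {x. N x = 1}" by auto
  ultimately show ?thesis by (metis compact_Int_closed compact_N_ball)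
qed

text \<open>Such \<open>v\<close> are the points at which the supremum in
  \<open>dual_norm N w\<close> is attained, that is the subgradients of the dual norm at
  \<open>w\<close>.\<close>

definition is_max :: "complex \<Rightarrow> complex \<Rightarrow> bool" where
  "is_max w v \<longleftrightarrow> N v \<le> 1 \<and> (\<forall>u. N u \<le> 1 \<longrightarrow> u \<bullet> w \<le> v \<bullet> w)"

lemma ex_is_max: "\<exists>v. is_max w v"
proof -
  have "\<exists>v\<in>{x. N x \<le> 1}. \<forall>u\<in>{x. N x \<le> 1}. u \<bullet> w \<le> v \<bullet> w"
    by (intro continuous_attains_sup compact_N_ball continuous_intros) (auto intro!: exI[of _ 0])
  then show ?thesis by (auto simp: is_max_def)
qed

text \<open>An arbitrary choice of maximizer, so it exists for every norm and also at 0, where only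
  \<open>N (V 0) \<le> 1\<close> is known. For \<open>w \<noteq> 0\<close> and a strictly convex
  norm it becomes unique and equal to \<open>vortex N w\<close>.\<close>

definition V :: "complex \<Rightarrow> complex" where "V w = (SOME v. is_max w v)"

lemma is_max_V: "is_max w (V w)"
  unfolding V_def by (rule someI_ex[OF ex_is_max])

lemma N_V_le: "N (V w) \<le> 1" and V_max: "N u \<le> 1 \<Longrightarrow> u \<bullet> w \<le> V w \<bullet> w"
  using is_max_V[of w] by (auto simp: is_max_def)

lemma inner_le_dual: "v \<bullet> w \<le> N v * (V w \<bullet> w)"
proof (cases "v = 0")
  case False
  then have "((1 / N v) *\<^sub>R v) \<bullet> w \<le> V w \<bullet> w" using N_pos[of v] by (intro V_max) simp
  then show ?thesis using N_pos[OF False] by (simp add: field_simps)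
qed simp

lemma dual_pos:
  assumes "w \<noteq> 0"
  shows "0 < V w \<bullet> w"
proof -
  have "0 < N w * (V w \<bullet> w)" using inner_le_dual[of w w] assms inner_gt_zero_iff[of w] by linarith
  then show ?thesis using N_pos[OF assms] by (simp add: zero_less_mult_iff)
qed

lemma N_is_max:
  assumes "is_max w v" "w \<noteq> 0"
  shows "N v = 1"
proof -
  have "V w \<bullet> w \<le> N v * (V w \<bullet> w)"
    using assms(1) N_V_le[of w] inner_le_dual[of v w] unfolding is_max_def by fastforce
  then have "1 \<le> N v" using dual_pos[OF assms(2)] by simp
  then show ?thesis using assms(1) by (simp add: is_max_def)
qed

lemma N_V [simp]: "w \<noteq> 0 \<Longrightarrow> N (V w) = 1"
  using N_is_max is_max_V by blast

lemma dual_norm_eq: "dual_norm N w = V w \<bullet> w"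
  unfolding dual_norm_def by (rule cSup_eq_maximum) (use V_max N_V_le in blast)+

end

section \<open>Strict convexity and smoothness: \<open>V\<close> as a homeomorphism of
  directions\<close>

locale smooth_convex_norm = plane_norm +
  assumes strict: "strictly_convex_norm N" and C1: "C1_off_origin N"
begin

text \<open>The midpoint of two maximizers would attain the dual norm while lying strictly inside
  the unit ball.\<close>

lemma is_max_unique:
  assumes "w \<noteq> 0" "is_max w v1" "is_max w v2"
  shows "v1 = v2"
proof (rule ccontr)
  assume ne: "v1 \<noteq> v2"
  let ?u = "(1/2) *\<^sub>R (v1 + v2)"
  have "N v1 = 1" "N v2 = 1" using assms N_is_max by blast+
  then have lt: "N ?u < 1" using strict ne unfolding strictly_convex_norm_def by blast
  have "v1 \<bullet> w = V w \<bullet> w" "v2 \<bullet> w = V w \<bullet> w"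
    using assms(2,3) is_max_V[of w] unfolding is_max_def by (auto intro: antisym)
  then have "?u \<bullet> w = V w \<bullet> w" by (simp add: inner_left_distrib)
  then have "V w \<bullet> w \<le> N ?u * (V w \<bullet> w)" using inner_le_dual[of ?u w] by simp
  then show False using lt dual_pos[OF assms(1)] by simp
qed

lemma V_eqI: "w \<noteq> 0 \<Longrightarrow> is_max w v \<Longrightarrow> V w = v"
  using is_max_unique is_max_V by blast

lemma V_scale: "w \<noteq> 0 \<Longrightarrow> t > 0 \<Longrightarrow> V (t *\<^sub>R w) = V w"
  by (rule V_eqI) (use V_max[of _ w] N_V_le[of w] in \<open>auto simp: is_max_def\<close>)

lemma V_minus: "w \<noteq> 0 \<Longrightarrow> V (- w) = - V w"
proof (rule V_eqI)
  have "- u \<bullet> w \<le> V w \<bullet> w" if "N u \<le> 1" for u using V_max[of "-u" w] that by simp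
  then show "is_max (- w) (- V w)" using N_V_le[of w] by (auto simp: is_max_def)
qed simp

text \<open>Being a maximizer is a closed condition on the pair of \<open>w\<close> and
  \<open>V w\<close>, so the graph is closed; the values stay in the compact unit ball.\<close>

lemma continuous_V: "continuous_on (- {0}) V"
proof -
  let ?T = "{x. N x \<le> 1}"
  have "(\<lambda>x. (x, V x)) ` (- {0}) = ((- {0}) \<times> ?T) \<inter> (\<Inter>u\<in>?T. {p. u \<bullet> fst p \<le> snd p \<bullet> fst p})"
    (is "?L = ?R")
  proof
    show "?L \<subseteq> ?R" using V_max N_V_le by auto
    show "?R \<subseteq> ?L"
    proof
      fix p assume "p \<in> ?R"
      then have "fst p \<noteq> 0" "is_max (fst p) (snd p)" by (auto simp: is_max_def)
      then show "p \<in> ?L" using V_eqI by (intro image_eqI[of _ _ "fst p"] prod_eqI) auto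
    qed
  qed
  moreover have "closed (\<Inter>u\<in>?T. {p. u \<bullet> fst p \<le> snd p \<bullet> fst p})"
    by (intro closed_INT ballI closed_Collect_le continuous_intros)
  ultimately have "closedin (top_of_set ((- {0}) \<times> ?T)) ((\<lambda>x. (x, V x)) ` (- {0}))"
    by (auto simp: closedin_closed)
  then show ?thesis
    using continuous_closed_graph_eq[OF compact_N_ball, of V "- {0}"] N_V_le by auto
qed

lemma tendsto_V: "(f \<longlongrightarrow> a) F \<Longrightarrow> a \<noteq> 0 \<Longrightarrow> ((\<lambda>x. V (f x)) \<longlongrightarrow> V a) F"
  by (rule isCont_tendsto_compose[of a V])
    (use continuous_V continuous_on_eq_continuous_at[of "- {0}" V] in auto)

definition G :: "complex \<Rightarrow> complex" where
  "G = (SOME G. continuous_on (- {0}) G \<and> (\<forall>x. x \<noteq> 0 \<longrightarrow> (N has_derivative (\<lambda>h. G x \<bullet> h)) (at x)))"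

lemma N_has_derivative: "x \<noteq> 0 \<Longrightarrow> (N has_derivative (\<lambda>h. G x \<bullet> h)) (at x)"
  using someI_ex[OF C1[unfolded C1_off_origin_def], folded G_def] by blast

text \<open>First-order condition: by the duality inequality the function
  \<open>N v * (V w \<bullet> w) - v \<bullet> w\<close> of \<open>v\<close> is minimal at
  \<open>V w\<close>, so its gradient vanishes there. Hence \<open>w\<close> can be recovered from
  \<open>V w\<close> up to a positive factor.\<close>

lemma G_V:
  assumes "w \<noteq> 0"
  shows "(V w \<bullet> w) *\<^sub>R G (V w) = w"
proof -
  let ?z = "V w" let ?D = "V w \<bullet> w"
  have z: "?z \<noteq> 0" using N_V[OF assms] by (metis N_eq_0 zero_neq_one)
  define g where "g = (\<lambda>v. N v * ?D - v \<bullet> w)"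
  have "(g has_derivative (\<lambda>h. (G ?z \<bullet> h) * ?D - h \<bullet> w)) (at ?z)"
    unfolding g_def by (auto intro!: derivative_eq_intros N_has_derivative z)
  moreover have "g ?z \<le> g v" for v
    using inner_le_dual[of v w] N_V[OF assms] by (simp add: g_def)
  ultimately have "(\<lambda>h. (G ?z \<bullet> h) * ?D - h \<bullet> w) = (\<lambda>h. 0)"
    using differential_zero_maxmin[of ?z UNIV g] by blast
  then have "(?D *\<^sub>R G ?z - w) \<bullet> h = 0" for h
    by (metis (no_types, opaque_lifting) inner_commute inner_diff_left inner_scaleR_left mult.commute)
  then show ?thesis using inner_eq_zero_iff by (metis eq_iff_diff_eq_0)
qed

text \<open>Here differentiability of \<open>N\<close> enters: at a corner of the unit circle one
  point would be the maximizer for a whole cone of directions.\<close>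

lemma V_eq_imp_cross:
  assumes "w1 \<noteq> 0" "w2 \<noteq> 0" "V w1 = V w2"
  shows "cross w1 w2 = 0"
  using G_V[OF assms(1)] G_V[OF assms(2)] assms(3) by (metis cross_simps(1,7,8) mult_zero_right)

text \<open>Of two independent functionals each is strictly larger at its own maximizer than it is
  in modulus at the other one. The determinant of the four pairings is therefore positive, and by
  \<open>cross_det\<close> it is the product in the conclusion. So \<open>V\<close> preserves
  orientation.\<close>

lemma cross_V_sign:
  assumes "cross w1 w2 \<noteq> 0"
  shows "0 < cross (V w1) (V w2) * cross w1 w2"
proof -
  have w: "w1 \<noteq> 0" "w2 \<noteq> 0" using assms by auto
  have ne: "V w1 \<noteq> V w2" "V w1 \<noteq> - V w2"
    using V_eq_imp_cross[OF w] V_eq_imp_cross[of w1 "- w2"] V_minus[OF w(2)] w assms by auto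
  have lt: "\<bar>v \<bullet> w\<bar> < V w \<bullet> w" if "w \<noteq> 0" "N v = 1" "V w \<noteq> v" "V w \<noteq> - v" for v w
  proof -
    have "v \<bullet> w \<noteq> V w \<bullet> w" using that V_eqI[of w v] V_max[of _ w] by (auto simp: is_max_def)
    moreover have "- v \<bullet> w \<noteq> V w \<bullet> w" using that V_eqI[of w "- v"] V_max[of _ w] by (auto simp: is_max_def)
    ultimately show ?thesis using V_max[of v w] V_max[of "- v" w] that by auto
  qed
  have a: "\<bar>V w2 \<bullet> w1\<bar> < V w1 \<bullet> w1" using ne w by (intro lt) auto
  have b: "\<bar>V w1 \<bullet> w2\<bar> < V w2 \<bullet> w2" using ne w by (intro lt) (auto simp: minus_equation_iff)
  have "\<bar>(V w1 \<bullet> w2) * (V w2 \<bullet> w1)\<bar> < (V w1 \<bullet> w1) * (V w2 \<bullet> w2)"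
    unfolding abs_mult mult.commute[of "\<bar>V w1 \<bullet> w2\<bar>"] using a b by (intro mult_strict_mono') auto
  then show ?thesis using cross_det[of "V w1" w1 "V w2" w2] by linarith
qed

text \<open>Converse of \<open>G_V\<close> on the unit circle. Differentiating \<open>N\<close>
  along the ray through \<open>z\<close> gives Euler's identity \<open>G z \<bullet> z = 1\<close>.
  If some \<open>u\<close> in the ball beat \<open>z\<close>, a short step from \<open>z\<close>
  towards \<open>u\<close> would increase \<open>N\<close> beyond 1, against convexity of the
  ball.\<close>

lemma V_G:
  assumes "N z = 1"
  shows "G z \<bullet> z = 1" "G z \<noteq> 0" "V (G z) = z"
proof -
  have z: "z \<noteq> 0" using assms by (metis N_eq_0 zero_neq_one)
  have dir: "((\<lambda>t. N (z + t *\<^sub>R h)) has_real_derivative G z \<bullet> h) (at 0)" for h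
  proof -
    have "(N has_derivative (\<lambda>h. G z \<bullet> h)) (at (z + 0 *\<^sub>R h))"
      using N_has_derivative[OF z] by simp
    moreover have "((\<lambda>t. z + t *\<^sub>R h) has_derivative (\<lambda>t. t *\<^sub>R h)) (at 0)"
      by (auto intro!: derivative_eq_intros)
    ultimately have "((\<lambda>t. N (z + t *\<^sub>R h)) has_derivative (\<lambda>t. G z \<bullet> (t *\<^sub>R h))) (at 0)"
      using has_derivative_compose[of "\<lambda>t. z + t *\<^sub>R h" "\<lambda>t. t *\<^sub>R h" 0 UNIV N "\<lambda>h. G z \<bullet> h"] by simp
    then show ?thesis by (simp add: has_field_derivative_def mult.commute[of "G z \<bullet> h"] mult_commute_abs)
  qed
  have "((\<lambda>t. \<bar>1 + t\<bar>) has_real_derivative G z \<bullet> z) (at 0)"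
  proof -
    have "N (z + t *\<^sub>R z) = \<bar>1 + t\<bar>" for t
      using N_scale[of "1 + t" z] assms by (simp add: scaleR_left_distrib)
    then show ?thesis using dir[of z] by simp
  qed
  moreover have "((\<lambda>t. \<bar>1 + t\<bar>) has_real_derivative 1) (at 0)"
  proof (rule DERIV_cong_ev[THEN iffD1])
    show "((\<lambda>t. 1 + t) has_real_derivative 1) (at (0::real))" by (auto intro!: derivative_eq_intros)
    show "\<forall>\<^sub>F t in nhds (0::real). 1 + t = \<bar>1 + t\<bar>"
      using eventually_nhds_in_open[of "{-1<..}" "0::real"] by (auto elim!: eventually_mono)
  qed auto
  ultimately show 1: "G z \<bullet> z = 1" using DERIV_unique by blast
  then show "G z \<noteq> 0" by auto
  moreover have "is_max (G z) z"
    unfolding is_max_def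
  proof (intro conjI allI impI)
    fix u assume u: "N u \<le> 1"
    show "u \<bullet> G z \<le> z \<bullet> G z"
    proof (rule ccontr)
      assume "\<not> ?thesis"
      then have "0 < G z \<bullet> (u - z)"
        using inner_commute[of u "G z"] inner_commute[of z "G z"] unfolding inner_diff_right by linarith
      from DERIV_pos_inc_right[OF dir this] obtain d where
        d: "d > 0" "\<And>h. 0 < h \<Longrightarrow> h < d \<Longrightarrow> N z < N (z + h *\<^sub>R (u - z))" by auto
      define h where "h = min (d / 2) 1"
      have h: "0 < h" "h < d" "h \<le> 1" using d(1) by (auto simp: h_def)
      have "z + h *\<^sub>R (u - z) = (1 - h) *\<^sub>R z + h *\<^sub>R u" by (simp add: algebra_simps)
      then have "N (z + h *\<^sub>R (u - z)) \<le> (1 - h) * 1 + h * N u"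
        using N_triangle[of "(1 - h) *\<^sub>R z" "h *\<^sub>R u"] h assms by simp
      also have "\<dots> \<le> (1 - h) * 1 + h * 1" using u h by (intro add_left_mono mult_left_mono) auto
      also have "\<dots> = 1" by simp
      finally show False using d(2)[OF h(1,2)] assms by simp
    qed
  qed (use assms in simp)
  ultimately show "V (G z) = z" by (intro V_eqI)
qed

text \<open>Envelope argument: comparing the maximizers for \<open>y\<close> and \<open>w\<close> at
  both points squeezes the first-order remainder of the dual norm between 0 and
  \<open>(V y - V w) \<bullet> (y - w)\<close>, which is small against \<open>norm (y - w)\<close>
  by continuity of \<open>V\<close>.\<close>

lemma vortex_eq_V:
  assumes "w \<noteq> 0"
  shows "vortex N w = V w"
proof -
  have D: "(dual_norm N has_derivative (\<lambda>h. V w \<bullet> h)) (at w)"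
    unfolding has_derivative_at_alt
  proof (intro conjI allI impI bounded_linear_inner_right)
    fix e :: real assume e: "e > 0"
    have "isCont V w" using tendsto_V[OF tendsto_ident_at assms] by (simp add: isCont_def)
    then obtain d where d: "d > 0" "\<And>y. dist y w < d \<Longrightarrow> dist (V y) (V w) < e"
      using e unfolding continuous_at_eps_delta by blast
    have "norm (dual_norm N y - dual_norm N w - V w \<bullet> (y - w)) \<le> e * norm (y - w)"
      if y: "norm (y - w) < d" for y
    proof -
      have "dual_norm N y - dual_norm N w - V w \<bullet> (y - w) = V y \<bullet> y - V w \<bullet> y"
        by (simp add: dual_norm_eq inner_diff_right)
      moreover have "0 \<le> V y \<bullet> y - V w \<bullet> y" using V_max[of "V w" y] N_V_le by simp
      moreover have "V y \<bullet> w \<le> V w \<bullet> w" using V_max[of "V y" w] N_V_le by simp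
      then have "V y \<bullet> y - V w \<bullet> y \<le> (V y - V w) \<bullet> (y - w)"
        by (simp add: inner_diff_right inner_diff_left)
      moreover have "(V y - V w) \<bullet> (y - w) \<le> norm (V y - V w) * norm (y - w)"
        by (rule norm_cauchy_schwarz)
      moreover have "norm (V y - V w) * norm (y - w) \<le> e * norm (y - w)"
        using d(2)[of y] y by (intro mult_right_mono) (auto simp: dist_norm)
      ultimately show ?thesis by simp
    qed
    then show "\<exists>d>0. \<forall>y. norm (y - w) < d \<longrightarrow>
        norm (dual_norm N y - dual_norm N w - V w \<bullet> (y - w)) \<le> e * norm (y - w)"
      using d(1) by blast
  qed
  show ?thesis unfolding vortex_def
  proof (rule the_equality, rule D)
    fix v assume "(dual_norm N has_derivative (\<lambda>h. v \<bullet> h)) (at w)"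
    from has_derivative_unique[OF this D] have "v \<bullet> h = V w \<bullet> h" for h by metis
    then show "v = V w" by (metis vector_eq_rdot inner_commute)
  qed
qed

end

section \<open>Multivalued direction fields\<close>

text \<open>\<open>C q\<close> plays the role of the set of values of the limit field at \<open>q\<close>. The last assumption is
  what the vanishing of all entropy productions leaves over: seen from the line through \<open>q\<close> and
  \<open>q'\<close>, whose characteristic value is \<open>\<plusminus>V (\<i> * (q' - q))\<close>, values at the two points do not lie strictly
  on opposite sides.\<close>

locale direction_field = smooth_convex_norm +
  fixes \<Omega> :: "complex set" and C :: "complex \<Rightarrow> complex set"
  assumes C_sphere: "q \<in> \<Omega> \<Longrightarrow> a \<in> C q \<Longrightarrow> N a = 1"
    and C_nonempty: "q \<in> \<Omega> \<Longrightarrow> C q \<noteq> {}"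
    and C_closed: "q \<in> \<Omega> \<Longrightarrow> x \<longlonglongrightarrow> q \<Longrightarrow> (\<And>n::nat. a \<in> C (x n)) \<Longrightarrow> a \<in> C q"
    and C_same_side: "q \<noteq> q' \<Longrightarrow> closed_segment q q' \<subseteq> \<Omega> \<Longrightarrow> a \<in> C q \<Longrightarrow> b \<in> C q' \<Longrightarrow>
      0 \<le> cross (V (\<i> * (q' - q))) a * cross (V (\<i> * (q' - q))) b"
begin

lemma N_eq_scale:
  assumes "cross z c = 0" "N z = 1" "N c = 1"
  shows "c = z \<or> c = - z"
proof -
  have "z \<noteq> 0" using assms(2) by auto
  then obtain k where k: "c = k *\<^sub>R z" using cross_eq_0_imp_scale assms(1) by blast
  then have "\<bar>k\<bar> = 1" using assms by simp
  then have "k = 1 \<or> k = -1" by linarith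
  then show ?thesis using k by auto
qed

text \<open>A value \<open>c\<close> strictly on one side of the line spanned by
  \<open>V (\<i> * (w - q))\<close> would conflict with the one of \<open>a\<close>,
  \<open>b\<close> on the other side. So \<open>c\<close> lies on the line, and the unit circle
  leaves two antipodal points.\<close>

lemma separated_imp_vortex_value:
  assumes D: "convex D" "D \<subseteq> \<Omega>" "q \<in> D" "w \<in> D" "q \<noteq> w"
    and ab: "a \<in> C q" "b \<in> C q"
    and sep: "cross (V (\<i> * (w - q))) a * cross (V (\<i> * (w - q))) b < 0"
    and c: "c \<in> C w"
  obtains \<sigma> :: real where "\<sigma> \<in> {-1, 1}" "c = \<sigma> *\<^sub>R V (\<i> * (w - q))"
proof -
  define z where "z = V (\<i> * (w - q))"
  have seg: "closed_segment q w \<subseteq> \<Omega>" using D by (meson closed_segment_subset subset_trans)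
  have "0 \<le> cross z a * cross z c" "0 \<le> cross z b * cross z c"
    using C_same_side[OF D(5) seg ab(1) c] C_same_side[OF D(5) seg ab(2) c] by (simp_all add: z_def)
  then have "0 \<le> (cross z a * cross z b) * (cross z c)\<^sup>2"
    using mult_nonneg_nonneg[of "cross z a * cross z c" "cross z b * cross z c"]
    by (simp add: power2_eq_square algebra_simps)
  then have "(cross z c)\<^sup>2 \<le> 0" using sep unfolding z_def[symmetric]
    by (metis not_less zero_le_mult_iff)
  then have "cross z c = 0" by simp
  moreover have "N z = 1" using D(5) by (simp add: z_def)
  moreover have "N c = 1" using c D C_sphere by blast
  ultimately have "c = z \<or> c = - z" by (intro N_eq_scale)
  then show ?thesis using that[of 1] that[of "-1"] by (auto simp: z_def)
qed

text \<open>\<open>w - q\<close> and \<open>w' - q\<close> have the same cross product with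
  \<open>w' - w\<close>, so by \<open>cross_V_sign\<close> both vortex values lie on the same side
  of the line that belongs to the segment from \<open>w\<close> to \<open>w'\<close>. With opposite
  signs they would be separated.\<close>

lemma vortex_sign_eq:
  assumes D: "convex D" "D \<subseteq> \<Omega>" "w \<in> D" "w' \<in> D"
    and cr: "cross (w - q) (w' - q) \<noteq> 0"
    and s: "\<sigma> \<in> {-1, 1::real}" "\<sigma>' \<in> {-1, 1::real}"
    and c: "\<sigma> *\<^sub>R V (\<i> * (w - q)) \<in> C w" "\<sigma>' *\<^sub>R V (\<i> * (w' - q)) \<in> C w'"
  shows "\<sigma> = \<sigma>'"
proof -
  define z z1 z2 \<kappa> where "z = V (\<i> * (w' - w))" and "z1 = V (\<i> * (w - q))" and "z2 = V (\<i> * (w' - q))"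
    and "\<kappa> = cross (w' - q) (w - q)"
  have k: "cross (w' - w) (w - q) = \<kappa>" "cross (w' - w) (w' - q) = \<kappa>" "\<kappa> \<noteq> 0"
    using cr cross_skew[of "w - q" "w' - q"] by (auto simp: \<kappa>_def cross_def algebra_simps)
  have "0 < cross z z1 * \<kappa>" "0 < cross z z2 * \<kappa>"
    using cross_V_sign[of "\<i> * (w' - w)" "\<i> * (w - q)"] cross_V_sign[of "\<i> * (w' - w)" "\<i> * (w' - q)"] k
    by (auto simp: z_def z1_def z2_def)
  then have pos: "0 < cross z z1 * cross z z2" by (auto simp: zero_less_mult_iff)
  have "closed_segment w w' \<subseteq> \<Omega>" using D by (meson closed_segment_subset subset_trans)
  moreover have "w \<noteq> w'" using cr by auto
  ultimately have "0 \<le> cross z (\<sigma> *\<^sub>R z1) * cross z (\<sigma>' *\<^sub>R z2)"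
    using C_same_side c unfolding z_def z1_def z2_def by blast
  also have "\<dots> = (\<sigma> * \<sigma>') * (cross z z1 * cross z z2)" by simp
  finally have "0 \<le> \<sigma> * \<sigma>'" using pos by (simp add: zero_le_mult_iff)
  then show ?thesis using s by auto
qed

lemma small_steps:
  assumes "open D" "q \<in> (D :: complex set)"
  obtains t :: real where "t > 0" "\<And>s. \<bar>s\<bar> \<le> t \<Longrightarrow> q + s *\<^sub>R d \<in> D"
proof -
  obtain e where e: "e > 0" "ball q e \<subseteq> D" using assms open_contains_ball by blast
  define t where "t = e / (2 * (norm d + 1))"
  have "t > 0" using e(1) by (simp add: t_def add_nonneg_pos)
  moreover have "q + s *\<^sub>R d \<in> D" if "\<bar>s\<bar> \<le> t" for s
  proof -
    have "norm (s *\<^sub>R d) \<le> t * norm d" using that by (simp add: mult_right_mono)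
    also have "\<dots> < t * (2 * (norm d + 1))"
    proof (rule mult_strict_left_mono)
      show "norm d < 2 * (norm d + 1)" using norm_ge_zero[of d] by argo
    qed fact
    also have "\<dots> = e"
    proof -
      have "2 * (norm d + 1) \<noteq> 0" using norm_ge_zero[of d] by argo
      from nonzero_divide_eq_eq[OF this, of e t] show ?thesis by (metis t_def)
    qed
    finally show ?thesis using e(2) by (auto simp: dist_norm subset_iff)
  qed
  ultimately show ?thesis using that by blast
qed

text \<open>The points \<open>q + t *\<^sub>R d\<close> and \<open>q - t *\<^sub>R d\<close> are
  collinear with \<open>q\<close>, so \<open>vortex_sign_eq\<close> cannot compare them with each
  other; both are compared with a third point in direction \<open>d'\<close>. Equal vortex signs on
  opposite sides of \<open>q\<close> mean antipodal values, and closedness of \<open>C\<close>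
  carries both of them to \<open>q\<close>.\<close>

lemma separating_direction_values:
  assumes D: "convex D" "open D" "D \<subseteq> \<Omega>" "q \<in> D" and ab: "a \<in> C q" "b \<in> C q"
    and d: "cross d d' \<noteq> 0"
    and s: "cross (V (\<i> * d)) a * cross (V (\<i> * d)) b < 0"
           "cross (V (\<i> * d')) a * cross (V (\<i> * d')) b < 0"
  shows "V (\<i> * d) \<in> C q \<and> - V (\<i> * d) \<in> C q"
proof -
  have d0: "d \<noteq> 0" "d' \<noteq> 0" using d by auto
  obtain t1 where t1: "t1 > 0" "\<And>s. \<bar>s\<bar> \<le> t1 \<Longrightarrow> q + s *\<^sub>R d \<in> D" using small_steps D by metis
  obtain t2 where t2: "t2 > 0" "\<And>s. \<bar>s\<bar> \<le> t2 \<Longrightarrow> q + s *\<^sub>R d' \<in> D" using small_steps D by metis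
  have Vt: "V (\<i> * (t *\<^sub>R d)) = V (\<i> * d)" "V (\<i> * (t *\<^sub>R d')) = V (\<i> * d')"
    "V (\<i> * ((- t) *\<^sub>R d)) = - V (\<i> * d)" if "t > 0" for t
    using that d0 V_scale[of "\<i> * d" t] V_scale[of "\<i> * d'" t] V_scale[of "- (\<i> * d)" t] V_minus[of "\<i> * d"]
    by (auto simp: mult_scaleR_right)
  \<comment> \<open>Which of the two points carries \<open>V (\<i> * d)\<close> depends on the
    unknown sign and may vary with \<open>t\<close>; it is enough that one of them does.\<close>
  have step: "(\<exists>x\<in>{q + t *\<^sub>R d, q + (- t) *\<^sub>R d}. V (\<i> * d) \<in> C x) \<and>
       (\<exists>x\<in>{q + t *\<^sub>R d, q + (- t) *\<^sub>R d}. - V (\<i> * d) \<in> C x)"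
    if t: "0 < t" "t \<le> t1" "t \<le> t2" for t
  proof -
    let ?p = "q + t *\<^sub>R d" and ?m = "q + (- t) *\<^sub>R d" and ?r = "q + t *\<^sub>R d'"
    have mem: "?p \<in> D" "?m \<in> D" "?r \<in> D" using t1(2)[of t] t1(2)[of "- t"] t2(2)[of t] t by auto
    obtain cp cm cr where c: "cp \<in> C ?p" "cm \<in> C ?m" "cr \<in> C ?r"
      using mem D(3) C_nonempty by (meson ex_in_conv subsetD)
    obtain s1 where s1: "s1 \<in> {-1, 1}" "cp = s1 *\<^sub>R V (\<i> * d)"
      using separated_imp_vortex_value[OF D(1,3,4) mem(1) _ ab _ c(1)] Vt[OF t(1)] s d0 t(1) by auto
    obtain s2 where s2: "s2 \<in> {-1, 1}" "cm = s2 *\<^sub>R - V (\<i> * d)"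
      using separated_imp_vortex_value[OF D(1,3,4) mem(2) _ ab _ c(2)] Vt[OF t(1)] s d0 t(1)
      by (auto simp: mult.commute)
    obtain s3 where s3: "s3 \<in> {-1, 1}" "cr = s3 *\<^sub>R V (\<i> * d')"
      using separated_imp_vortex_value[OF D(1,3,4) mem(3) _ ab _ c(3)] Vt[OF t(1)] s d0 t(1) by auto
    have "s1 = s3"
      by (rule vortex_sign_eq[OF D(1,3) mem(1,3), of q])
        (use c s1 s3 Vt[OF t(1)] t(1) d in auto)
    moreover have "s2 = s3"
      by (rule vortex_sign_eq[OF D(1,3) mem(2,3), of q])
        (use c s2 s3 Vt[OF t(1)] t(1) d in auto)
    ultimately show ?thesis using c s1 s2 by auto
  qed
  define T where "T n = min t1 t2 * inverse (real (Suc n))" for n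
  have T: "0 < T n" "T n \<le> t1" "T n \<le> t2" for n
  proof -
    have "T n \<le> min t1 t2 * 1"
      unfolding T_def using t1(1) t2(1) by (intro mult_left_mono) (auto simp: inverse_le_1_iff)
    then show "T n \<le> t1" "T n \<le> t2" by auto
    show "0 < T n" using t1(1) t2(1) by (auto simp: T_def)
  qed
  have T0: "T \<longlonglongrightarrow> 0" unfolding T_def
    by (rule tendsto_eq_rhs[OF tendsto_mult[OF tendsto_const LIMSEQ_inverse_real_of_nat]]) simp
  have lim: "e \<in> C q" if e: "\<And>t. 0 < t \<Longrightarrow> t \<le> t1 \<Longrightarrow> t \<le> t2 \<Longrightarrow>
      \<exists>x\<in>{q + t *\<^sub>R d, q + (- t) *\<^sub>R d}. e \<in> C x" for e
  proof -
    have "\<forall>n. \<exists>x. x \<in> {q + T n *\<^sub>R d, q + (- T n) *\<^sub>R d} \<and> e \<in> C x" using e T by blast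
    then obtain x where x: "\<And>n. x n \<in> {q + T n *\<^sub>R d, q + (- T n) *\<^sub>R d}" "\<And>n. e \<in> C (x n)"
      by metis
    have "(\<lambda>n. T n * norm d) \<longlonglongrightarrow> 0" using T0 by (auto intro: tendsto_eq_intros)
    then have "x \<longlonglongrightarrow> q"
    proof (rule metric_tendsto_imp_tendsto, intro always_eventually allI)
      show "dist (x n) q \<le> dist (T n * norm d) 0" for n
        using x(1)[of n] T(1)[of n] by (auto simp: dist_norm)
    qed
    then show ?thesis using C_closed x(2) D by blast
  qed
  show ?thesis using step by (intro conjI lim) blast+
qed

text \<open>The pair \<open>a\<close>, \<open>b\<close> gives information only at those
  \<open>w\<close> where it is separated. It is therefore traded for two antipodal pairs at
  \<open>q\<close>, of which at least one is separated at every other point.\<close>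

theorem multivalued_imp_vortex:
  assumes D: "convex D" "open D" "D \<subseteq> \<Omega>" "q \<in> D" and ab: "a \<in> C q" "b \<in> C q" "a \<noteq> b"
  shows "\<exists>\<beta>\<in>{-1, 1::real}. \<forall>w\<in>D - {q}. C w = {\<beta> *\<^sub>R V (\<i> * (w - q))}"
proof -
  have Nab: "N a = 1" "N b = 1" using ab D C_sphere by blast+
  \<comment> \<open>A line separating \<open>a\<close> and \<open>b\<close>: perpendicular to
    \<open>a\<close> for an antipodal pair, otherwise spanned by \<open>a + b\<close>.\<close>
  have "\<exists>e. e \<noteq> 0 \<and> cross e a * cross e b < 0"
  proof (cases "cross a b = 0")
    case True
    then have "b = - a" using N_eq_scale[OF True Nab] ab(3) by auto
    moreover have "a \<noteq> 0" using Nab by auto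
    moreover have "cross (\<i> * a) a = - (norm a)\<^sup>2" using cross_i_self[of a] cross_skew[of a] by simp
    ultimately show ?thesis by (intro exI[of _ "\<i> * a"]) (auto simp: mult_neg_pos)
  next
    case False
    have "cross (a + b) a * cross (a + b) b = - (cross a b)\<^sup>2"
      using cross_skew[of b a] by (simp add: cross_linear power2_eq_square)
    then show ?thesis using False by (intro exI[of _ "a + b"]) (auto simp del: mult_less_0_iff intro!: notI)
  qed
  then obtain e where e: "e \<noteq> 0" "cross e a * cross e b < 0" by blast
  define z where "z = (1 / N e) *\<^sub>R e"
  have z: "N z = 1" using e N_pos[OF e(1)] by (simp add: z_def)
  have "cross z a * cross z b = (cross e a * cross e b) / (N e)\<^sup>2"
    by (simp add: z_def power2_eq_square)
  then have zs: "cross z a * cross z b < 0"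
    using divide_neg_pos[OF e(2) zero_less_power[OF N_pos[OF e(1)], of 2]] by argo
  \<comment> \<open>Chosen so that \<open>\<i> * d1 = G z\<close>; by \<open>V_G\<close> the vortex
    value in this direction is then \<open>z\<close>.\<close>
  define d1 where "d1 = - \<i> * G z"
  have d1: "d1 \<noteq> 0" "V (\<i> * d1) = z" using V_G[OF z] by (auto simp: d1_def)
  \<comment> \<open>Separation is an open condition, so a slightly turned direction
    \<open>d2\<close> separates as well. Two independent directions are needed as input of
    \<open>separating_direction_values\<close>, and because the antipodal pair of one direction is
    not separated at points of the line which that direction spans.\<close>
  define f where "f d = cross (V (\<i> * d)) a * cross (V (\<i> * d)) b" for d
  have "((\<lambda>s::real. f (d1 + s *\<^sub>R (\<i> * d1))) \<longlongrightarrow> f d1) (at_right 0)"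
    unfolding f_def using d1(1)
    by (intro tendsto_mult tendsto_cross tendsto_V tendsto_const) (auto intro!: tendsto_eq_intros)
  moreover have "f d1 < 0" using d1 zs by (simp add: f_def)
  ultimately have "eventually (\<lambda>s::real. f (d1 + s *\<^sub>R (\<i> * d1)) < 0) (at_right 0)"
    by (rule order_tendstoD)
  then have "eventually (\<lambda>s::real. f (d1 + s *\<^sub>R (\<i> * d1)) < 0 \<and> 0 < s) (at_right 0)"
    by (rule eventually_conj) (simp add: eventually_at_right_less)
  then obtain s where s: "f (d1 + s *\<^sub>R (\<i> * d1)) < 0" "0 < s"
    using eventually_happens'[of "at_right (0::real)"] by force
  define d2 where "d2 = d1 + s *\<^sub>R (\<i> * d1)"
  have cr: "cross d1 d2 \<noteq> 0" "cross d2 d1 \<noteq> 0"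
    using s(2) d1(1) cross_skew[of d2 d1] by (auto simp: d2_def cross_linear cross_i_self)
  have d2: "d2 \<noteq> 0" using cr by auto
  have vals: "V (\<i> * d) \<in> C q" "- V (\<i> * d) \<in> C q" if "d \<in> {d1, d2}" for d
    using separating_direction_values[OF D ab(1,2) cr(1)] separating_direction_values[OF D ab(1,2) cr(2)]
      that \<open>f d1 < 0\<close> s(1) unfolding f_def d2_def[symmetric] by auto
  have indep: "cross (w - q) d1 \<noteq> 0 \<or> cross (w - q) d2 \<noteq> 0" if "w \<noteq> q" for w
  proof (rule ccontr)
    assume *: "\<not> ?thesis"
    then have "cross d1 (w - q) = 0" using cross_skew[of d1] by simp
    then obtain k where "w - q = k *\<^sub>R d1" using cross_eq_0_imp_scale d1(1) by blast
    then show False using * that cr by auto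
  qed
  \<comment> \<open>The antipodal pair of a direction not parallel to \<open>w - q\<close> is
    separated by \<open>V (\<i> * (w - q))\<close>, because \<open>V\<close> preserves
    orientation.\<close>
  have good: "\<exists>\<sigma>\<in>{-1, 1::real}. c = \<sigma> *\<^sub>R V (\<i> * (w - q))" if w: "w \<in> D" "w \<noteq> q" "c \<in> C w" for w c
  proof -
    obtain d where d: "d \<in> {d1, d2}" "cross (w - q) d \<noteq> 0" using indep[OF w(2)] by blast
    have "cross (V (\<i> * (w - q))) (V (\<i> * d)) \<noteq> 0"
      using cross_V_sign[of "\<i> * (w - q)" "\<i> * d"] d by auto
    then have "cross (V (\<i> * (w - q))) (V (\<i> * d)) * cross (V (\<i> * (w - q))) (- V (\<i> * d)) < 0"
      using not_real_square_gt_zero by (metis cross_simps(5) mult_minus_right neg_less_0_iff_less)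
    then show ?thesis
      using separated_imp_vortex_value[OF D(1,3,4) w(1) _ vals(1,2)[OF d(1)] _ w(3)] w(2) by metis
  qed
  obtain t1 where t1: "t1 > 0" "\<And>s. \<bar>s\<bar> \<le> t1 \<Longrightarrow> q + s *\<^sub>R d1 \<in> D" using small_steps D by metis
  obtain t2 where t2: "t2 > 0" "\<And>s. \<bar>s\<bar> \<le> t2 \<Longrightarrow> q + s *\<^sub>R d2 \<in> D" using small_steps D by metis
  define w1 w2 where "w1 = q + t1 *\<^sub>R d1" and "w2 = q + t2 *\<^sub>R d2"
  have w: "w1 \<in> D" "w2 \<in> D" "w1 \<noteq> q" "w2 \<noteq> q"
    using t1 t2 d1 d2 by (auto simp: w1_def w2_def)
  obtain c1 c2 where c: "c1 \<in> C w1" "c2 \<in> C w2" using w D(3) C_nonempty by (meson ex_in_conv subsetD)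
  obtain \<beta> where \<beta>: "\<beta> \<in> {-1, 1::real}" "c1 = \<beta> *\<^sub>R V (\<i> * (w1 - q))" using good w c by metis
  obtain \<beta>' where \<beta>': "\<beta>' \<in> {-1, 1::real}" "c2 = \<beta>' *\<^sub>R V (\<i> * (w2 - q))" using good w c by metis
  have cw: "cross (w1 - q) (w2 - q) \<noteq> 0" using cr t1 t2 by (simp add: w1_def w2_def)
  have "\<beta> = \<beta>'"
    using vortex_sign_eq[OF D(1,3) w(1,2) cw \<beta>(1) \<beta>'(1)] c \<beta> \<beta>' by simp
  \<comment> \<open>\<open>x - q\<close> is independent of \<open>w1 - q\<close> or of
    \<open>w2 - q\<close>, so \<open>x\<close> inherits the sign which these two points
    share.\<close>
  have "c = \<beta> *\<^sub>R V (\<i> * (x - q))" if x: "x \<in> D - {q}" "c \<in> C x" for x c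
  proof -
    obtain \<sigma> where \<sigma>: "\<sigma> \<in> {-1, 1::real}" "c = \<sigma> *\<^sub>R V (\<i> * (x - q))" using good x by blast
    have "cross (x - q) (w1 - q) \<noteq> 0 \<or> cross (x - q) (w2 - q) \<noteq> 0"
      using indep[of x] x t1(1) t2(1) by (auto simp: w1_def w2_def)
    then have "\<sigma> = \<beta>"
      using vortex_sign_eq[OF D(1,3) _ w(1) _ \<sigma>(1) \<beta>(1), of x q]
        vortex_sign_eq[OF D(1,3) _ w(2) _ \<sigma>(1) \<beta>'(1), of x q] x \<sigma> c \<beta> \<beta>' \<open>\<beta> = \<beta>'\<close> by auto
    then show ?thesis using \<sigma> by simp
  qed
  moreover have "C x \<noteq> {}" if "x \<in> D - {q}" for x using that D C_nonempty by blast
  ultimately have "\<forall>x\<in>D - {q}. C x = {\<beta> *\<^sub>R V (\<i> * (x - q))}" by blast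
  then show ?thesis using \<beta>(1) by blast
qed

end

section \<open>Mollifiers\<close>

text \<open>The products p(1/t) exp(-1/t), extended by 0, form a class closed under differentiation,
  as a coinductive notion of smoothness requires.\<close>

definition flat :: "real poly \<Rightarrow> real \<Rightarrow> real" where
  "flat p t = (if t > 0 then poly p (1 / t) * exp (- (1 / t)) else 0)"

lemma poly_exp_tendsto_0: "((\<lambda>u. poly p u * exp (- u)) \<longlongrightarrow> (0::real)) at_top"
proof -
  have "((\<lambda>u. \<Sum>i\<le>degree p. coeff p i * (u ^ i / exp u)) \<longlongrightarrow> (\<Sum>i\<le>degree p. coeff p i * 0)) at_top"
    by (intro tendsto_intros tendsto_power_div_exp_0)
  then show ?thesis
    by (simp add: poly_altdef sum_distrib_right exp_minus divide_inverse mult.assoc)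
qed

text \<open>With u = 1/t the derivative is -u^2 d/du, applied to p(u) exp(-u); this explains the
  polynomial. At 0 the right difference quotient is of the same form with \<open>pCons 0 p\<close>,
  and it tends to 0.\<close>

lemma flat_has_derivative:
  "(flat p has_real_derivative flat ([:0, 0, 1:] * (p - pderiv p)) t) (at t)" (is "(_ has_real_derivative flat ?q t) _")
proof -
  consider "t > 0" | "t < 0" | "t = 0" by linarith
  then show ?thesis
  proof cases
    case 1
    have "((\<lambda>t. poly p (1 / t) * exp (- (1 / t))) has_real_derivative flat ?q t) (at t)"
      using 1 by (auto intro!: derivative_eq_intros simp: flat_def field_simps power2_eq_square)
    then show ?thesis
      by (rule has_field_derivative_transform_within_open[of _ _ _ "{0<..}"]) (use 1 in \<open>auto simp: flat_def\<close>)
  next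
    case 2
    have "((\<lambda>t. 0) has_real_derivative flat ?q t) (at t)" using 2 by (simp add: flat_def)
    then show ?thesis
      by (rule has_field_derivative_transform_within_open[of _ _ _ "{..<0}"]) (use 2 in \<open>auto simp: flat_def\<close>)
  next
    case 3
    have "((\<lambda>h. poly (pCons 0 p) (1 / h) * exp (- (1 / h))) \<longlongrightarrow> 0) (at_right (0::real))"
      by (rule filterlim_compose[OF poly_exp_tendsto_0])
        (simp add: filterlim_inverse_at_top_right flip: inverse_eq_divide)
    then have R: "((\<lambda>h. flat p h / h) \<longlongrightarrow> 0) (at_right 0)"
      by (rule Lim_transform_eventually) (auto simp: eventually_at_filter flat_def)
    have L: "((\<lambda>h. flat p h / h) \<longlongrightarrow> 0) (at_left 0)"
      by (rule Lim_transform_eventually[OF tendsto_const]) (auto simp: eventually_at_filter flat_def)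
    show ?thesis
      unfolding DERIV_def using filterlim_split_at[OF L R] 3 by (simp add: flat_def)
  qed
qed

lemma flat_uminus: "flat (- p) t = - flat p t"
  by (simp add: flat_def)

text \<open>Sums of products of four \<open>flat\<close> factors, supported in the square of
  half-width \<open>k\<close> around \<open>c\<close>. The product rule stays inside this class,
  with minus signs moved into the polynomials.\<close>

inductive bumpy :: "real \<Rightarrow> complex \<Rightarrow> (complex \<Rightarrow> real) \<Rightarrow> bool" for k c where
  base: "bumpy k c (\<lambda>x. flat p1 (k + Re (x - c)) * flat p2 (k - Re (x - c)) *
                        (flat p3 (k + Im (x - c)) * flat p4 (k - Im (x - c))))"
| add: "bumpy k c f \<Longrightarrow> bumpy k c g \<Longrightarrow> bumpy k c (\<lambda>x. f x + g x)"

lemma bumpy_has_derivative: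
  assumes "bumpy k c f"
  shows "\<exists>f1 f2. bumpy k c f1 \<and> bumpy k c f2 \<and>
    (\<forall>x. (f has_derivative (\<lambda>h. Re h * f1 x + Im h * f2 x)) (at x))"
  using assms
proof induction
  case (base p1 p2 p3 p4)
  define q where "q p = [:0, 0, 1:] * (p - pderiv p)" for p :: "real poly"
  have D: "(flat p has_derivative (\<lambda>h. flat (q p) t * h)) (at t)" for p t
    using flat_has_derivative[of p t] by (simp add: q_def has_field_derivative_def)
  let ?B = "\<lambda>p1 p2 p3 p4 x. flat p1 (k + Re (x - c)) * flat p2 (k - Re (x - c)) *
                        (flat p3 (k + Im (x - c)) * flat p4 (k - Im (x - c)))"
  let ?f1 = "\<lambda>x. ?B (q p1) p2 p3 p4 x + ?B p1 (- q p2) p3 p4 x"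
  let ?f2 = "\<lambda>x. ?B p1 p2 (q p3) p4 x + ?B p1 p2 p3 (- q p4) x"
  have "(?B p1 p2 p3 p4 has_derivative (\<lambda>h. Re h * ?f1 x + Im h * ?f2 x)) (at x)" for x
  proof -
    have a: "((\<lambda>x. flat p (k + Re (x - c))) has_derivative (\<lambda>h. flat (q p) (k + Re (x - c)) * Re h)) (at x)" for p
      by (rule has_derivative_compose[OF _ D, of "\<lambda>x. k + Re (x - c)"]) (auto intro!: derivative_eq_intros)
    have b: "((\<lambda>x. flat p (k - Re (x - c))) has_derivative (\<lambda>h. flat (q p) (k - Re (x - c)) * - Re h)) (at x)" for p
      by (rule has_derivative_compose[OF _ D, of "\<lambda>x. k - Re (x - c)"]) (auto intro!: derivative_eq_intros)
    have a': "((\<lambda>x. flat p (k + Im (x - c))) has_derivative (\<lambda>h. flat (q p) (k + Im (x - c)) * Im h)) (at x)" for p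
      by (rule has_derivative_compose[OF _ D, of "\<lambda>x. k + Im (x - c)"]) (auto intro!: derivative_eq_intros)
    have b': "((\<lambda>x. flat p (k - Im (x - c))) has_derivative (\<lambda>h. flat (q p) (k - Im (x - c)) * - Im h)) (at x)" for p
      by (rule has_derivative_compose[OF _ D, of "\<lambda>x. k - Im (x - c)"]) (auto intro!: derivative_eq_intros)
    show ?thesis
      by (rule has_derivative_eq_rhs[OF has_derivative_mult[OF has_derivative_mult[OF a b] has_derivative_mult[OF a' b']]])
        (auto simp: flat_uminus algebra_simps)
  qed
  moreover have "bumpy k c ?f1" "bumpy k c ?f2" by (intro bumpy.intros)+
  ultimately show ?case by blast
next
  case (add f g)
  then obtain f1 f2 g1 g2 where *: "bumpy k c f1" "bumpy k c f2" "bumpy k c g1" "bumpy k c g2"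
    "\<And>x. (f has_derivative (\<lambda>h. Re h * f1 x + Im h * f2 x)) (at x)"
    "\<And>x. (g has_derivative (\<lambda>h. Re h * g1 x + Im h * g2 x)) (at x)" by blast
  have "((\<lambda>x. f x + g x) has_derivative (\<lambda>h. Re h * (f1 x + g1 x) + Im h * (f2 x + g2 x))) (at x)" for x
    by (rule has_derivative_eq_rhs[OF has_derivative_add[OF *(5,6)]]) (auto simp: algebra_simps)
  then show ?case using bumpy.add[OF *(1,3)] bumpy.add[OF *(2,4)] by blast
qed

lemma smooth2_bumpy: "bumpy k c f \<Longrightarrow> smooth2 f"
proof (coinduction arbitrary: f)
  case smooth2
  then obtain f1 f2 where *: "bumpy k c f1" "bumpy k c f2"
    "\<And>x. (f has_derivative (\<lambda>h. Re h * f1 x + Im h * f2 x)) (at x)" using bumpy_has_derivative by blast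
  have "frechet_derivative f (at x) = (\<lambda>h. Re h * f1 x + Im h * f2 x)" for x
    using frechet_derivative_at[OF *(3)] by simp
  then have "(\<lambda>x. frechet_derivative f (at x) 1) = f1" "(\<lambda>x. frechet_derivative f (at x) \<i>) = f2" by auto
  moreover have "f differentiable (at x)" for x using *(3) differentiableI by blast
  ultimately show ?case using * by auto
qed

text \<open>The support is a square; by \<open>norm \<le> \<bar>Re\<bar> + \<bar>Im\<bar>\<close> it
  lies in the disc of radius \<open>2 * k\<close>.\<close>

lemma bumpy_eq_0: "bumpy k c f \<Longrightarrow> norm (x - c) \<ge> 2 * k \<Longrightarrow> k > 0 \<Longrightarrow> f x = 0"
proof (induction rule: bumpy.induct)
  case (base p1 p2 p3 p4)
  have "\<not> (\<bar>Re (x - c)\<bar> < k \<and> \<bar>Im (x - c)\<bar> < k)"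
    using cmod_le[of "x - c"] base by auto
  then show ?case by (auto simp: flat_def)
qed auto

lemma continuous_bumpy: "bumpy k c f \<Longrightarrow> continuous_on S f"
  using bumpy_has_derivative by (meson continuous_at_imp_continuous_on has_derivative_continuous)

lemma bumpy_bounded:
  assumes "bumpy k c f" "k > 0"
  shows "\<exists>B>0. \<forall>x. \<bar>f x\<bar> \<le> B"
proof -
  have "compact (f ` cball c (2 * k))" using continuous_bumpy[OF assms(1)] by (intro compact_continuous_image) auto
  then obtain B where B: "B > 0" "\<And>x. x \<in> cball c (2 * k) \<Longrightarrow> \<bar>f x\<bar> \<le> B"
    using compact_imp_bounded bounded_pos by (metis (no_types, lifting) imageI real_norm_def)
  have "\<bar>f x\<bar> \<le> B" for x
  proof (cases "x \<in> cball c (2 * k)")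
    case False
    then have "f x = 0" using bumpy_eq_0[OF assms(1), of x] assms(2) by (auto simp: dist_norm norm_minus_commute)
    then show ?thesis using B(1) by simp
  qed (use B in auto)
  then show ?thesis using B(1) by blast
qed

lemma bumpy_lipschitz:
  assumes "bumpy k c f" "k > 0"
  shows "\<exists>B>0. \<forall>x y. \<bar>f x - f y\<bar> \<le> B * norm (x - y)"
proof -
  obtain f1 f2 where *: "bumpy k c f1" "bumpy k c f2"
    "\<And>x. (f has_derivative (\<lambda>h. Re h * f1 x + Im h * f2 x)) (at x)" using bumpy_has_derivative assms(1) by blast
  obtain B1 B2 where B: "B1 > 0" "B2 > 0" "\<And>x. \<bar>f1 x\<bar> \<le> B1" "\<And>x. \<bar>f2 x\<bar> \<le> B2"
    using bumpy_bounded *(1,2) assms(2) by metis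
  have "norm (f x - f y) \<le> (B1 + B2) * norm (x - y)" for x y
  proof (rule differentiable_bound[of UNIV])
    show "onorm (\<lambda>h. Re h * f1 x + Im h * f2 x) \<le> B1 + B2" for x
    proof (rule onorm_bound)
      fix h
      have "norm (Re h * f1 x + Im h * f2 x) \<le> \<bar>Re h\<bar> * \<bar>f1 x\<bar> + \<bar>Im h\<bar> * \<bar>f2 x\<bar>"
        by (metis abs_mult abs_triangle_ineq real_norm_def)
      also have "\<dots> \<le> norm h * B1 + norm h * B2"
        by (intro add_mono mult_mono abs_Re_le_cmod abs_Im_le_cmod B) auto
      finally show "norm (Re h * f1 x + Im h * f2 x) \<le> (B1 + B2) * norm h" by (simp add: algebra_simps)
    qed (use B in auto)
  qed (use * in auto)
  then show ?thesis using B by (intro exI[of _ "B1 + B2"]) auto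
qed

text \<open>\<open>smooth\<close> speaks of all translates because \<open>\<rho> (y - x)\<close>
  serves as a test function at every centre \<open>x\<close>. The Lipschitz bounds on the partial
  derivatives give a quadratic Taylor remainder, uniform in the point.\<close>

locale mollifier =
  fixes k B :: real and \<rho> \<rho>1 \<rho>2 :: "complex \<Rightarrow> real"
  assumes k_pos: "k > 0" and B_pos: "B > 0"
    and smooth: "smooth2 (\<lambda>y. \<rho> (y - x))"
    and has_derivative: "(\<rho> has_derivative (\<lambda>h. Re h * \<rho>1 y + Im h * \<rho>2 y)) (at y)"
    and cont: "continuous_on UNIV \<rho>1" "continuous_on UNIV \<rho>2"
    and support: "norm y \<ge> k \<Longrightarrow> \<rho> y = 0" "norm y \<ge> k \<Longrightarrow> \<rho>1 y = 0" "norm y \<ge> k \<Longrightarrow> \<rho>2 y = 0"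
    and nonneg: "0 \<le> \<rho> y" and integral_1: "(\<integral>y. \<rho> y \<partial>lborel) = 1"
    and bound: "\<bar>\<rho> y\<bar> \<le> B" "\<bar>\<rho>1 y\<bar> \<le> B" "\<bar>\<rho>2 y\<bar> \<le> B"
    and lipschitz: "\<bar>\<rho>1 y - \<rho>1 y'\<bar> \<le> B * norm (y - y')" "\<bar>\<rho>2 y - \<rho>2 y'\<bar> \<le> B * norm (y - y')"

lemma integrable_lborel_compact_support:
  fixes f :: "complex \<Rightarrow> 'a::{banach, second_countable_topology}"
  assumes "continuous_on UNIV f" "compact K" "\<And>x. x \<notin> K \<Longrightarrow> f x = 0"
  shows "integrable lborel f"
proof -
  have "integrable lborel (\<lambda>x. indicator K x *\<^sub>R f x)"
    by (rule borel_integrable_compact[OF assms(2) continuous_on_subset[OF assms(1)]]) simp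
  moreover have "(\<lambda>x. indicator K x *\<^sub>R f x) = f" using assms(3) by (auto simp: indicator_def)
  ultimately show ?thesis by simp
qed

lemma ex_mollifier:
  assumes "k > 0"
  shows "\<exists>B \<rho> \<rho>1 \<rho>2. mollifier k B \<rho> \<rho>1 \<rho>2"
proof -
  \<comment> \<open>The constant polynomial \<open>[:a:]\<close> carries the normalizing factor
    inside the class \<open>bumpy\<close>, which has no rule for scaling. Half-width
    \<open>k / 2\<close> puts the support into the disc of radius \<open>k\<close>.\<close>
  define b where "b a c x = flat [:a:] (k / 2 + Re (x - c)) * flat 1 (k / 2 - Re (x - c)) *
                        (flat 1 (k / 2 + Im (x - c)) * flat 1 (k / 2 - Im (x - c)))" for a c x
  have bumpy_b: "bumpy (k / 2) c (b a c)" for a c unfolding b_def by (rule bumpy.base)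
  have b_scale: "b a c x = a * b 1 c x" for a c x
    by (auto simp: b_def flat_def)
  have nn: "0 \<le> b 1 0 x" for x by (auto simp: b_def flat_def)
  have int: "integrable lborel (b 1 0)"
    using continuous_bumpy[OF bumpy_b] bumpy_eq_0[OF bumpy_b] assms
    by (intro integrable_lborel_compact_support[of _ "cball 0 k"]) (auto simp: not_le)
  have "0 < (\<integral>x. b 1 0 x \<partial>lborel)"
  proof (rule ccontr)
    assume "\<not> ?thesis"
    then have "(\<integral>x. b 1 0 x \<partial>lborel) = 0" 
      using Bochner_Integration.integral_nonneg[of lborel "b 1 0"] nn by fastforce
    then have "AE x in lborel. b 1 0 x = 0"
      using integral_nonneg_eq_0_iff_AE[OF int] nn by auto
    moreover have "open {x. b 1 0 x \<noteq> 0}"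
      using continuous_bumpy[OF bumpy_b[of 0 1], of UNIV] by (intro open_Collect_neq continuous_intros) auto
    then have "{x. b 1 0 x \<noteq> 0} \<in> sets borel" by simp
    ultimately have "emeasure lborel {x. b 1 0 x \<noteq> 0} = 0"
      by (subst (asm) AE_iff_measurable) auto
    then have "{x. b 1 0 x \<noteq> 0} = {}"
      using \<open>open {x. b 1 0 x \<noteq> 0}\<close>
      by (metis open_not_negligible negligible_iff_null_sets null_sets_completionI null_setsI
          \<open>{x. b 1 0 x \<noteq> 0} \<in> sets borel\<close> sets_lborel)
    moreover have "b 1 0 0 \<noteq> 0" using assms by (simp add: b_def flat_def)
    ultimately show False by auto
  qed
  define I where "I = (\<integral>x. b 1 0 x \<partial>lborel)"
  have I: "I > 0" unfolding I_def by fact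
  define \<rho> where "\<rho> = b (1 / I) 0"
  have bump: "bumpy (k / 2) 0 \<rho>" unfolding \<rho>_def by (rule bumpy_b)
  obtain \<rho>1 \<rho>2 where r: "bumpy (k / 2) 0 \<rho>1" "bumpy (k / 2) 0 \<rho>2"
    "\<And>x. (\<rho> has_derivative (\<lambda>h. Re h * \<rho>1 x + Im h * \<rho>2 x)) (at x)"
    using bumpy_has_derivative[OF bump] by blast
  have k2: "k / 2 > 0" using assms by simp
  obtain B0 B1 B2 B3 B4 where B: "B0 > 0" "B1 > 0" "B2 > 0" "B3 > 0" "B4 > 0"
      "\<And>x. \<bar>\<rho> x\<bar> \<le> B0" "\<And>x. \<bar>\<rho>1 x\<bar> \<le> B1" "\<And>x. \<bar>\<rho>2 x\<bar> \<le> B2"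
      "\<And>x y. \<bar>\<rho>1 x - \<rho>1 y\<bar> \<le> B3 * norm (x - y)" "\<And>x y. \<bar>\<rho>2 x - \<rho>2 y\<bar> \<le> B4 * norm (x - y)"
    using bumpy_bounded[OF bump k2] bumpy_bounded[OF r(1) k2] bumpy_bounded[OF r(2) k2]
      bumpy_lipschitz[OF r(1) k2] bumpy_lipschitz[OF r(2) k2] by metis
  define B where "B = B0 + B1 + B2 + B3 + B4"
  have leB: "B0 \<le> B" "B1 \<le> B" "B2 \<le> B" "B3 \<le> B" "B4 \<le> B" "B > 0" using B(1-5) by (auto simp: B_def)
  have "mollifier k B \<rho> \<rho>1 \<rho>2"
  proof
    have "(\<lambda>y. \<rho> (y - x)) = b (1 / I) x" for x by (auto simp: \<rho>_def b_def)
    then show "smooth2 (\<lambda>y. \<rho> (y - x))" for x using smooth2_bumpy[OF bumpy_b] by simp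
    show "(\<integral>y. \<rho> y \<partial>lborel) = 1"
      using I unfolding \<rho>_def by (subst b_scale) (simp add: I_def)
    show "0 \<le> \<rho> y" for y unfolding \<rho>_def using nn[of y] I by (subst b_scale) simp
    show "\<bar>\<rho>1 y - \<rho>1 y'\<bar> \<le> B * norm (y - y')" "\<bar>\<rho>2 y - \<rho>2 y'\<bar> \<le> B * norm (y - y')" for y y'
      using B(9,10)[of y y'] leB mult_right_mono[OF leB(4), of "norm (y - y')"]
        mult_right_mono[OF leB(5), of "norm (y - y')"] by auto
    show "\<bar>\<rho> y\<bar> \<le> B" "\<bar>\<rho>1 y\<bar> \<le> B" "\<bar>\<rho>2 y\<bar> \<le> B" for y using B(6-8)[of y] leB by auto
    show "\<rho> y = 0" "\<rho>1 y = 0" "\<rho>2 y = 0" if "norm y \<ge> k" for y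
      using bumpy_eq_0[OF bump, of y] bumpy_eq_0[OF r(1), of y] bumpy_eq_0[OF r(2), of y] that assms by auto
  qed (use assms leB r continuous_bumpy in auto)
  then show ?thesis by blast
qed

section \<open>Mollification in the mean\<close>

lemma integrable_translate:
  fixes f :: "complex \<Rightarrow> 'b::{banach, second_countable_topology}"
  assumes "integrable lborel f"
  shows "integrable lborel (\<lambda>x. f (x + h))" "(\<integral>x. f (x + h) \<partial>lborel) = (\<integral>x. f x \<partial>lborel)"
proof -
  have [measurable]: "f \<in> borel_measurable borel" using assms by auto
  have "integrable (distr lborel borel ((+) h)) f" using assms by (simp add: lborel_distr_plus)
  then show "integrable lborel (\<lambda>x. f (x + h))"
    by (subst (asm) integrable_distr_eq) (auto simp: add.commute)
  have "(\<integral>x. f x \<partial>lborel) = (\<integral>x. f x \<partial>distr lborel borel ((+) h))" by (simp add: lborel_distr_plus)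
  then show "(\<integral>x. f (x + h) \<partial>lborel) = (\<integral>x. f x \<partial>lborel)"
    by (subst (asm) integral_distr) (auto simp: add.commute)
qed

lemma nn_integral_translate:
  fixes f :: "complex \<Rightarrow> ennreal"
  assumes [measurable]: "f \<in> borel_measurable borel"
  shows "(\<integral>\<^sup>+x. f (x + h) \<partial>lborel) = (\<integral>\<^sup>+x. f x \<partial>lborel)"
proof -
  have "(\<integral>\<^sup>+x. f x \<partial>lborel) = (\<integral>\<^sup>+x. f x \<partial>distr lborel borel ((+) h))" by (simp add: lborel_distr_plus)
  then show ?thesis by (subst (asm) nn_integral_distr) (auto simp: add.commute)
qed

lemma compact_open_approx:
  fixes A :: "complex set"
  assumes A: "A \<in> sets borel" "emeasure lborel A < \<infinity>" and e: "e > (0::real)"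
  obtains K U where "compact K" "open U" "K \<subseteq> A" "A \<subseteq> U" "emeasure lborel (U - K) < ennreal e"
proof -
  have A': "A \<in> sets lebesgue" using A(1) by simp
  obtain U where U: "open U" "A \<subseteq> U" "emeasure lebesgue (U - A) < ennreal (e/2)"
    by (rule sets_lebesgue_outer_open[OF A', of "e/2"]) (use e in simp)
  obtain F where F: "closed F" "F \<subseteq> A" "emeasure lebesgue (A - F) < ennreal (e/2)"
    by (rule sets_lebesgue_inner_closed[OF A', of "e/2"]) (use e in simp)
  have [measurable]: "F \<in> sets borel" "U \<in> sets borel" "A \<in> sets borel" using F U A by auto
  have UA: "emeasure lborel (U - A) < ennreal (e/2)" and AF: "emeasure lborel (A - F) < ennreal (e/2)"
    using U F by auto
  let ?D = "\<lambda>n. A - (F \<inter> cball 0 (real n))"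
  have "(\<lambda>n. emeasure lborel (?D n)) \<longlonglongrightarrow> emeasure lborel (\<Inter>n. ?D n)"
  proof (rule Lim_emeasure_decseq)
    show "range ?D \<subseteq> sets lborel" by auto
    show "decseq ?D" by (auto simp: decseq_def)
    show "emeasure lborel (?D n) \<noteq> \<infinity>" for n
      using emeasure_mono[of "?D n" A lborel] A by (auto simp: top_unique)
  qed
  moreover have "(\<Inter>n. ?D n) = A - F"
  proof -
    have "\<exists>n::nat. norm x \<le> n" for x :: complex using real_arch_simple by blast
    then show ?thesis by auto
  qed
  ultimately have "eventually (\<lambda>n. emeasure lborel (?D n) < ennreal (e/2)) sequentially"
    using AF order_tendstoD(2) by metis
  then obtain n where n: "emeasure lborel (?D n) < ennreal (e/2)"
    by (meson eventually_happens' sequentially_bot)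
  define K where "K = F \<inter> cball 0 (real n)"
  have K: "compact K" "K \<subseteq> A" using F by (auto simp: K_def closed_Int_compact)
  have [measurable]: "K \<in> sets borel" by (rule borel_compact[OF K(1)])
  have "emeasure lborel (U - K) \<le> emeasure lborel ((U - A) \<union> (A - K))"
    by (intro emeasure_mono) auto
  also have "\<dots> \<le> emeasure lborel (U - A) + emeasure lborel (A - K)"
    by (intro emeasure_subadditive) auto
  also have "\<dots> < ennreal (e/2) + ennreal (e/2)"
    using UA n by (intro add_strict_mono) (auto simp: K_def)
  also have "\<dots> = ennreal e" using e by (simp flip: ennreal_plus)
  finally show ?thesis using that K U by blast
qed

text \<open>Induction over integrable functions. For an indicator squeezed between a compact
  \<open>K\<close> and an open \<open>U\<close> with small \<open>U - K\<close>, a translation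
  shorter than the distance from \<open>K\<close> to the complement of \<open>U\<close> changes
  values only on \<open>U - K\<close> and its translate.\<close>

lemma L1_translation_continuous:
  fixes f :: "complex \<Rightarrow> 'b::{banach, second_countable_topology}"
  assumes "integrable lborel f" "e > 0"
  shows "\<exists>d>0. \<forall>h. norm h < d \<longrightarrow> (\<integral>x. norm (f (x + h) - f x) \<partial>lborel) < e"
  using assms
proof (induction arbitrary: e rule: integrable_induct)
  case (base A c)
  then have A: "A \<in> sets borel" "emeasure lborel A < \<infinity>" by auto
  define e' where "e' = e / (2 * (norm c + 1))"
  have e': "e' > 0" unfolding e'_def using base(3) by (intro divide_pos_pos) (auto intro: add_nonneg_pos)
  obtain K U where KU: "compact K" "open U" "K \<subseteq> A" "A \<subseteq> U" "emeasure lborel (U - K) < ennreal e'"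
    using compact_open_approx[OF A e'] by blast
  obtain d where d: "d > 0" "(\<Union>x\<in>K. ball x d) \<subseteq> U"
    using compact_subset_open_imp_ball_epsilon_subset[of K U] KU by blast
  have [measurable]: "K \<in> sets borel" "U \<in> sets borel" "A \<in> sets borel"
    using borel_compact[OF KU(1)] borel_open[OF KU(2)] A(1) by simp_all
  have fin: "emeasure lborel (U - K) < \<infinity>" using KU(5) by (metis ennreal_less_top infinity_ennreal_def less_trans)
  have m: "measure lborel (U - K) < e'"
    using KU(5) e' fin by (metis emeasure_eq_ennreal_measure ennreal_less_iff infinity_ennreal_def less_top measure_nonneg)
  have iUK: "integrable lborel (\<lambda>x. indicator (U - K) x :: real)"
    using fin by (intro integrable_real_indicator) auto
  have "(\<integral>x. norm (indicator A (x + h) *\<^sub>R c - indicator A x *\<^sub>R c) \<partial>lborel) < e" if h: "norm h < d" for h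
  proof -
    have "norm (indicator A (x + h) *\<^sub>R c - indicator A x *\<^sub>R c)
        \<le> (indicator (U - K) x + indicator (U - K) (x + h)) * norm c" for x
    proof -
      have "x \<in> K \<Longrightarrow> x + h \<in> U" using d(2) h by (force simp: dist_norm subset_iff)
      moreover have "x \<in> U" if "x + h \<in> K"
      proof -
        have "x \<in> ball (x + h) d" using h by (simp add: dist_norm)
        then show ?thesis using d(2) that by blast
      qed
      ultimately show ?thesis using KU(3,4) by (auto simp: indicator_def split: if_splits)
    qed
    then have "(\<integral>x. norm (indicator A (x + h) *\<^sub>R c - indicator A x *\<^sub>R c) \<partial>lborel)
        \<le> (\<integral>x. (indicator (U - K) x + indicator (U - K) (x + h)) * norm c \<partial>lborel)"
      using integrable_translate(1)[OF iUK, of h] iUK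
      by (intro integral_mono') auto
    also have "\<dots> = 2 * measure lborel (U - K) * norm c"
      using integrable_translate[OF iUK, of h] iUK by simp
    also have "\<dots> \<le> 2 * e' * norm c" using m by (intro mult_right_mono) auto
    also have "\<dots> < 2 * e' * (norm c + 1)" using e' by simp
    also have "\<dots> = e"
    proof -
      have "2 * (norm c + 1) \<noteq> 0" using norm_ge_zero[of c] by argo
      from nonzero_divide_eq_eq[OF this, of e e'] have "e' * (2 * (norm c + 1)) = e" by (metis e'_def)
      then show ?thesis by (simp add: algebra_simps)
    qed
    finally show ?thesis .
  qed
  then show ?case using d(1) by blast
next
  case (add f g)
  obtain d1 where d1: "d1 > 0" "\<And>h. norm h < d1 \<Longrightarrow> (\<integral>x. norm (f (x + h) - f x) \<partial>lborel) < e/2"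
    using add.IH(1)[of "e/2"] add.prems by auto
  obtain d2 where d2: "d2 > 0" "\<And>h. norm h < d2 \<Longrightarrow> (\<integral>x. norm (g (x + h) - g x) \<partial>lborel) < e/2"
    using add.IH(2)[of "e/2"] add.prems by auto
  have "(\<integral>x. norm (f (x + h) + g (x + h) - (f x + g x)) \<partial>lborel) < e" if h: "norm h < min d1 d2" for h
  proof -
    have i: "integrable lborel (\<lambda>x. norm (f (x + h) - f x))" "integrable lborel (\<lambda>x. norm (g (x + h) - g x))"
      using add.hyps by (auto intro!: integrable_translate)
    have "norm (f (x + h) + g (x + h) - (f x + g x)) \<le> norm (f (x + h) - f x) + norm (g (x + h) - g x)" for x
      by (metis add_diff_add norm_triangle_ineq)
    then have "(\<integral>x. norm (f (x + h) + g (x + h) - (f x + g x)) \<partial>lborel)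
      \<le> (\<integral>x. norm (f (x + h) - f x) + norm (g (x + h) - g x) \<partial>lborel)"
      using i by (intro integral_mono') auto
    also have "\<dots> < e" using i d1(2)[of h] d2(2)[of h] h by simp
    finally show ?thesis .
  qed
  then show ?case using d1 d2 by (intro exI[of _ "min d1 d2"]) auto
next
  case (lim f s)
  have "(\<lambda>i. \<integral>x. norm (s i x - f x) \<partial>lborel) \<longlonglongrightarrow> (\<integral>(x::complex). 0 \<partial>lborel)"
  proof (rule integral_dominated_convergence[where w = "\<lambda>x. 3 * norm (f x)"])
    show "AE x in lborel. (\<lambda>i. norm (s i x - f x)) \<longlonglongrightarrow> 0"
      using lim.hyps(2) by (intro AE_I2 tendsto_norm_zero LIM_zero) simp
    show "AE x in lborel. norm (norm (s i x - f x)) \<le> 3 * norm (f x)" for i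
    proof (intro AE_I2)
      fix x show "norm (norm (s i x - f x)) \<le> 3 * norm (f x)"
        using lim.hyps(3)[of x i] norm_triangle_ineq4[of "s i x" "f x"] by simp
    qed
  qed (use lim.hyps in auto)
  then have "eventually (\<lambda>i. (\<integral>x. norm (s i x - f x) \<partial>lborel) < e/3) sequentially"
    using order_tendstoD(2)[of _ 0 sequentially "e/3"] lim.prems by simp
  then obtain i where i: "(\<integral>x. norm (s i x - f x) \<partial>lborel) < e/3"
    by (meson eventually_happens' sequentially_bot)
  obtain d where d: "d > 0" "\<And>h. norm h < d \<Longrightarrow> (\<integral>x. norm (s i (x + h) - s i x) \<partial>lborel) < e/3"
    using lim.IH[of "e/3" i] lim.prems by auto
  have "(\<integral>x. norm (f (x + h) - f x) \<partial>lborel) < e" if h: "norm h < d" for h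
  proof -
    have i0: "integrable lborel (\<lambda>x. norm (s i x - f x))" using lim.hyps by auto
    note ii = i0 integrable_translate[OF i0, of h]
    have i1: "integrable lborel (\<lambda>x. norm (s i (x + h) - s i x))"
      by (intro integrable_norm Bochner_Integration.integrable_diff integrable_translate(1) lim.hyps)
    have "norm (f (x + h) - f x) \<le> norm (s i (x + h) - f (x + h)) + norm (s i (x + h) - s i x) + norm (s i x - f x)" for x
    proof -
      have "f (x + h) - f x = - (s i (x + h) - f (x + h)) + (s i (x + h) - s i x) + (s i x - f x)" by simp
      then show ?thesis by (metis (no_types, lifting) norm_minus_cancel norm_triangle_mono order_refl)
    qed
    then have "(\<integral>x. norm (f (x + h) - f x) \<partial>lborel)
      \<le> (\<integral>x. norm (s i (x + h) - f (x + h)) + norm (s i (x + h) - s i x) + norm (s i x - f x) \<partial>lborel)"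
      using ii i1 by (intro integral_mono') auto
    also have "\<dots> < e" using ii i1 d(2)[OF h] i by simp
    finally show ?thesis .
  qed
  then show ?case using d(1) by blast
qed

text \<open>A correlation rather than a convolution: \<open>g (y - x)\<close> is a function moved to
  the centre \<open>x\<close>, which fits the weak formulation. Differentiation in \<open>x\<close>
  therefore produces a minus sign.\<close>

definition smear :: "(complex \<Rightarrow> real) \<Rightarrow> (complex \<Rightarrow> complex) \<Rightarrow> complex \<Rightarrow> complex" where
  "smear g f x = (\<integral>y. g (y - x) *\<^sub>R f y \<partial>lborel)"

lemma integrable_bounded_scaleR:
  fixes f :: "complex \<Rightarrow> 'b::{banach, second_countable_topology}"
  assumes f: "integrable lborel f" and g: "g \<in> borel_measurable borel" "\<And>x. \<bar>g x\<bar> \<le> (B::real)"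
  shows "integrable lborel (\<lambda>x. g x *\<^sub>R f x)"
proof (rule Bochner_Integration.integrable_bound)
  show "integrable lborel (\<lambda>x. B * norm (f x))" using f by auto
  have "\<bar>g x\<bar> * norm (f x) \<le> \<bar>B\<bar> * norm (f x)" for x
    using g(2)[of x] by (intro mult_right_mono) auto
  then show "AE x in lborel. norm (g x *\<^sub>R f x) \<le> norm (B * norm (f x))"
    by (auto simp: abs_mult)
qed (use f g in auto)

context mollifier
begin

lemma cont0: "continuous_on UNIV \<rho>"
  using has_derivative by (meson continuous_at_imp_continuous_on has_derivative_continuous)

lemma mollifier_measurable [measurable]: "\<rho> \<in> borel_measurable borel" "\<rho>1 \<in> borel_measurable borel" "\<rho>2 \<in> borel_measurable borel"
  using cont0 cont by (auto intro: borel_measurable_continuous_onI)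

lemma rho_shift_has_derivative:
  "((\<lambda>y. \<rho> (y - x)) has_derivative (\<lambda>h. Re h * \<rho>1 (y - x) + Im h * \<rho>2 (y - x))) (at y)"
proof -
  have "((\<lambda>y. y - x) has_derivative (\<lambda>h. h)) (at y)" by (auto intro!: derivative_eq_intros)
  from has_derivative_compose[OF this has_derivative] show ?thesis by simp
qed

lemma rho_integrable: "integrable lborel \<rho>"
  using cont0 support by (intro integrable_lborel_compact_support[of _ "cball 0 k"]) auto

lemma smear_shift:
  assumes "integrable lborel f"
  shows "smear \<rho> f x = (\<integral>w. \<rho> w *\<^sub>R f (x + w) \<partial>lborel)"
proof -
  have "integrable lborel (\<lambda>y. \<rho> (y - x) *\<^sub>R f y)"
    using assms bound by (intro integrable_bounded_scaleR) auto
  from integrable_translate(2)[OF this, of x] show ?thesis by (simp add: smear_def add.commute)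
qed

lemma taylor: "\<bar>\<rho> (y + h) - \<rho> y - (Re h * \<rho>1 y + Im h * \<rho>2 y)\<bar> \<le> 2 * B * (norm h)\<^sup>2"
proof -
  have "norm (\<rho> (y + h) - \<rho> y - (\<lambda>h. Re h * \<rho>1 y + Im h * \<rho>2 y) (y + h - y)) \<le> norm (y + h - y) * (2 * B * norm h)"
  proof (rule differentiable_bound_linearization[of _ _ "cball y (norm h)"])
    show "onorm ((\<lambda>h. Re h * \<rho>1 x + Im h * \<rho>2 x) - (\<lambda>h. Re h * \<rho>1 y + Im h * \<rho>2 y)) \<le> 2 * B * norm h"
      if x: "x \<in> cball y (norm h)" for x
    proof (rule onorm_bound)
      fix v
      have "B * norm (x - y) \<le> B * norm h"
        using x B_pos by (intro mult_left_mono) (auto simp: dist_norm norm_minus_commute)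
      then have l: "\<bar>\<rho>1 x - \<rho>1 y\<bar> \<le> B * norm h" "\<bar>\<rho>2 x - \<rho>2 y\<bar> \<le> B * norm h"
        using lipschitz[of x y] by auto
      have "Re v * \<rho>1 x + Im v * \<rho>2 x - (Re v * \<rho>1 y + Im v * \<rho>2 y) = Re v * (\<rho>1 x - \<rho>1 y) + Im v * (\<rho>2 x - \<rho>2 y)"
        by (simp add: algebra_simps)
      also have "\<bar>\<dots>\<bar> \<le> \<bar>Re v\<bar> * \<bar>\<rho>1 x - \<rho>1 y\<bar> + \<bar>Im v\<bar> * \<bar>\<rho>2 x - \<rho>2 y\<bar>"
        by (metis abs_mult abs_triangle_ineq)
      also have "\<dots> \<le> norm v * (B * norm h) + norm v * (B * norm h)"
        by (intro add_mono mult_mono abs_Re_le_cmod abs_Im_le_cmod l) auto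
      finally show "norm (((\<lambda>h. Re h * \<rho>1 x + Im h * \<rho>2 x) - (\<lambda>h. Re h * \<rho>1 y + Im h * \<rho>2 y)) v) \<le> 2 * B * norm h * norm v"
        by simp
    qed (use B_pos in auto)
    show "(\<rho> has_derivative (\<lambda>h. Re h * \<rho>1 x + Im h * \<rho>2 x)) (at x within cball y (norm h))" for x
      using has_derivative has_derivative_at_withinI by blast
    show "y + t *\<^sub>R (y + h - y) \<in> cball y (norm h)" if "t \<in> {0..1}" for t
      using that by (auto simp: dist_norm mult_left_le_one_le)
  qed auto
  then show ?thesis by (simp add: power2_eq_square algebra_simps)
qed

text \<open>The remainder in \<open>taylor\<close> is a multiple of \<open>(norm h)\<^sup>2\<close>
  uniformly in the point, so it can be integrated against \<open>norm (f y)\<close> for a merely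
  integrable \<open>f\<close>.\<close>

lemma smear_has_derivative:
  assumes f: "integrable lborel f"
  shows "(smear \<rho> f has_derivative (\<lambda>h. Re h *\<^sub>R (- smear \<rho>1 f x) + Im h *\<^sub>R (- smear \<rho>2 f x))) (at x)"
proof -
  define M where "M = 2 * B * (\<integral>y. norm (f y) \<partial>lborel) + 1"
  have M: "M > 0" using B_pos by (auto simp: M_def intro!: add_nonneg_pos mult_nonneg_nonneg)
  have i: "integrable lborel (\<lambda>y. \<rho> (y - x) *\<^sub>R f y)" "integrable lborel (\<lambda>y. \<rho>1 (y - x) *\<^sub>R f y)"
    "integrable lborel (\<lambda>y. \<rho>2 (y - x) *\<^sub>R f y)" for x
    using f bound by (auto intro!: integrable_bounded_scaleR[of _ _ B])
  have quad: "norm (smear \<rho> f (x + h) - smear \<rho> f x - (Re h *\<^sub>R (- smear \<rho>1 f x) + Im h *\<^sub>R (- smear \<rho>2 f x)))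
      \<le> M * (norm h)\<^sup>2" for h
  proof -
    let ?r = "\<lambda>y. \<rho> (y - (x + h)) - \<rho> (y - x) + Re h * \<rho>1 (y - x) + Im h * \<rho>2 (y - x)"
    have eq: "smear \<rho> f (x + h) - smear \<rho> f x - (Re h *\<^sub>R (- smear \<rho>1 f x) + Im h *\<^sub>R (- smear \<rho>2 f x))
       = (\<integral>y. ?r y *\<^sub>R f y \<partial>lborel)"
    proof -
      have eq: "?r y *\<^sub>R f y = (\<rho> (y - (x + h)) *\<^sub>R f y - \<rho> (y - x) *\<^sub>R f y)
          + (Re h *\<^sub>R (\<rho>1 (y - x) *\<^sub>R f y) + Im h *\<^sub>R (\<rho>2 (y - x) *\<^sub>R f y))" for y
        by (simp add: scaleR_left_distrib scaleR_left_diff_distrib)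
      have "(\<integral>y. ?r y *\<^sub>R f y \<partial>lborel) = (smear \<rho> f (x + h) - smear \<rho> f x)
          + (Re h *\<^sub>R smear \<rho>1 f x + Im h *\<^sub>R smear \<rho>2 f x)"
        unfolding smear_def eq using i(1)[of "x + h"] i[of x] by (simp del: scaleR_scaleR)
      then show ?thesis by simp
    qed
    have "norm (\<integral>y. ?r y *\<^sub>R f y \<partial>lborel) \<le> (\<integral>y. norm (?r y *\<^sub>R f y) \<partial>lborel)"
      by (rule integral_norm_bound)
    also have "\<dots> \<le> (\<integral>y. 2 * B * (norm h)\<^sup>2 * norm (f y) \<partial>lborel)"
    proof (rule integral_mono')
      fix y
      have "\<bar>?r y\<bar> \<le> 2 * B * (norm h)\<^sup>2"
        using taylor[of "y - x" "- h"] by (simp add: algebra_simps)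
      then show "norm (?r y *\<^sub>R f y) \<le> 2 * B * (norm h)\<^sup>2 * norm (f y)"
        by (auto intro: mult_right_mono)
    qed (use f B_pos in auto)
    also have "\<dots> \<le> M * (norm h)\<^sup>2" by (simp add: M_def algebra_simps)
    finally show ?thesis unfolding eq .
  qed
  show ?thesis
    unfolding has_derivative_at_alt
  proof (intro conjI allI impI)
    show "bounded_linear (\<lambda>h. Re h *\<^sub>R (- smear \<rho>1 f x) + Im h *\<^sub>R (- smear \<rho>2 f x))"
      by (intro bounded_linear_add bounded_linear_compose[OF bounded_linear_scaleR_left] bounded_linear_Re bounded_linear_Im)
    fix e :: real assume e: "e > 0"
    have "norm (smear \<rho> f y - smear \<rho> f x - (Re (y - x) *\<^sub>R (- smear \<rho>1 f x) + Im (y - x) *\<^sub>R (- smear \<rho>2 f x)))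
        \<le> e * norm (y - x)" if y: "norm (y - x) < e / M" for y
    proof -
      have "M * (norm (y - x))\<^sup>2 \<le> e * norm (y - x)"
        using y M mult_right_mono[of "M * norm (y - x)" e "norm (y - x)"]
        by (simp add: power2_eq_square field_simps)
      then show ?thesis using quad[of "y - x"] by simp
    qed
    then show "\<exists>d>0. \<forall>y. norm (y - x) < d \<longrightarrow> norm (smear \<rho> f y - smear \<rho> f x -
        (Re (y - x) *\<^sub>R (- smear \<rho>1 f x) + Im (y - x) *\<^sub>R (- smear \<rho>2 f x))) \<le> e * norm (y - x)"
      using e M by (intro exI[of _ "e / M"]) auto
  qed
qed

lemma continuous_smear_deriv:
  assumes f: "integrable lborel f" and g: "g \<in> {\<rho>1, \<rho>2}"
  shows "continuous_on UNIV (smear g f)"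
proof -
  have gB: "\<bar>g y\<bar> \<le> B" "\<bar>g y - g y'\<bar> \<le> B * norm (y - y')" "g \<in> borel_measurable borel" for y y'
    using g bound lipschitz by auto
  have i: "integrable lborel (\<lambda>y. g (y - x) *\<^sub>R f y)" for x
    using f gB by (intro integrable_bounded_scaleR[of _ _ B]) auto
  define M where "M = B * (\<integral>y. norm (f y) \<partial>lborel)"
  have M: "M \<ge> 0" using B_pos by (simp add: M_def)
  have "norm (smear g f x - smear g f x') \<le> M * norm (x - x')" for x x'
  proof -
    have eq: "smear g f x - smear g f x' = (\<integral>y. (g (y - x) - g (y - x')) *\<^sub>R f y \<partial>lborel)"
      unfolding smear_def using i by (simp add: scaleR_left_diff_distrib)
    have "norm (\<integral>y. (g (y - x) - g (y - x')) *\<^sub>R f y \<partial>lborel)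
        \<le> (\<integral>y. norm ((g (y - x) - g (y - x')) *\<^sub>R f y) \<partial>lborel)" by (rule integral_norm_bound)
    also have "\<dots> \<le> (\<integral>y. B * norm (x - x') * norm (f y) \<partial>lborel)"
    proof (rule integral_mono')
      show "norm ((g (y - x) - g (y - x')) *\<^sub>R f y) \<le> B * norm (x - x') * norm (f y)" for y
        using gB(2)[of "y - x" "y - x'"] by (auto intro: mult_right_mono simp: norm_minus_commute)
    qed (use f B_pos in auto)
    finally show ?thesis unfolding eq by (simp add: M_def algebra_simps)
  qed
  then have "M-lipschitz_on UNIV (smear g f)" using M by (auto simp: lipschitz_on_def dist_norm)
  then show ?thesis by (rule lipschitz_on_continuous_on)
qed

lemma continuous_smear: "integrable lborel f \<Longrightarrow> continuous_on UNIV (smear \<rho> f)"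
  using smear_has_derivative by (meson continuous_at_imp_continuous_on has_derivative_continuous)

text \<open>Minkowski's inequality through Tonelli: \<open>smear \<rho> f x - f x\<close> averages
  the differences \<open>f (x + w) - f x\<close> over \<open>norm w < k\<close>, and for each such
  \<open>w\<close> their integral in \<open>x\<close> is at most \<open>e\<close>.\<close>

lemma smear_L1:
  assumes f: "integrable lborel f" and e: "\<And>h. norm h < k \<Longrightarrow> (\<integral>x. norm (f (x + h) - f x) \<partial>lborel) \<le> e" "0 \<le> e"
  shows "integrable lborel (\<lambda>x. smear \<rho> f x - f x)" "(\<integral>x. norm (smear \<rho> f x - f x) \<partial>lborel) \<le> e"
proof -
  have [measurable]: "f \<in> borel_measurable borel" using f by auto
  have [measurable]: "smear \<rho> f \<in> borel_measurable borel"
    using continuous_smear[OF f] by (rule borel_measurable_continuous_onI)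
  have "(\<integral>\<^sup>+x. norm (smear \<rho> f x - f x) \<partial>lborel) \<le> (\<integral>\<^sup>+x. (\<integral>\<^sup>+w. \<rho> w * norm (f (x + w) - f x) \<partial>lborel) \<partial>lborel)"
  proof (rule nn_integral_mono)
    fix x
    have i: "integrable lborel (\<lambda>w. \<rho> w *\<^sub>R f (x + w))" "integrable lborel (\<lambda>w. \<rho> w *\<^sub>R f x)"
      using integrable_translate(1)[OF f, of x] bound rho_integrable
      by (auto intro!: integrable_bounded_scaleR[of _ _ B] simp: add.commute)
    have eq: "smear \<rho> f x - f x = (\<integral>w. \<rho> w *\<^sub>R f (x + w) \<partial>lborel) - (\<integral>w. \<rho> w *\<^sub>R f x \<partial>lborel)"
      using smear_shift[OF f] integral_1 rho_integrable by simp
    have eq': "\<dots> = (\<integral>w. \<rho> w *\<^sub>R (f (x + w) - f x) \<partial>lborel)"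
      using i by (simp add: scaleR_right_diff_distrib)
    have "ennreal (norm (\<integral>w. \<rho> w *\<^sub>R (f (x + w) - f x) \<partial>lborel)) \<le> (\<integral>\<^sup>+w. norm (\<rho> w *\<^sub>R (f (x + w) - f x)) \<partial>lborel)"
      using i by (intro integral_norm_bound_ennreal) (simp add: scaleR_right_diff_distrib)
    then show "ennreal (norm (smear \<rho> f x - f x)) \<le> (\<integral>\<^sup>+w. \<rho> w * norm (f (x + w) - f x) \<partial>lborel)"
      unfolding eq eq' using nonneg by simp
  qed
  also have "\<dots> = (\<integral>\<^sup>+w. (\<integral>\<^sup>+x. \<rho> w * norm (f (x + w) - f x) \<partial>lborel) \<partial>lborel)"
    by (rule lborel_pair.Fubini'[symmetric]) measurable
  also have "\<dots> \<le> (\<integral>\<^sup>+w. ennreal (\<rho> w) * ennreal e \<partial>lborel)"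
  proof (rule nn_integral_mono)
    fix w
    show "(\<integral>\<^sup>+x. \<rho> w * norm (f (x + w) - f x) \<partial>lborel) \<le> ennreal (\<rho> w) * ennreal e"
    proof (cases "norm w < k")
      case True
      have "(\<integral>\<^sup>+x. norm (f (x + w) - f x) \<partial>lborel) = ennreal (\<integral>x. norm (f (x + w) - f x) \<partial>lborel)"
        using f by (intro nn_integral_eq_integral) (auto intro!: integrable_translate)
      also have "\<dots> \<le> ennreal e" using e(1)[OF True] by (rule ennreal_leI)
      finally show ?thesis using nonneg[of w]
        by (simp add: ennreal_mult' nn_integral_cmult mult_left_mono)
    next
      case False
      then have "\<rho> w = 0" by (intro support) simp
      then show ?thesis by simp
    qed
  qed
  also have "\<dots> = ennreal e"
    using nonneg rho_integrable integral_1 by (simp add: nn_integral_multc nn_integral_eq_integral)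
  finally have le: "(\<integral>\<^sup>+x. norm (smear \<rho> f x - f x) \<partial>lborel) \<le> ennreal e" .
  show int: "integrable lborel (\<lambda>x. smear \<rho> f x - f x)"
    using le by (intro integrableI_bounded) (auto simp: le_less_trans)
  show "(\<integral>x. norm (smear \<rho> f x - f x) \<partial>lborel) \<le> e"
    using le nn_integral_eq_integral[OF integrable_norm[OF int]] e(2) by (simp add: ennreal_le_iff)
qed

end

section \<open>Transport along a direction\<close>

text \<open>All supports lie in one box, where the Leibniz rule for the gauge integral applies; on
  continuous functions both integrals agree.\<close>

lemma deriv_under_integral:
  fixes g gd :: "real \<Rightarrow> complex \<Rightarrow> real"
  assumes D: "\<And>t x. t \<in> U \<Longrightarrow> ((\<lambda>t. g t x) has_real_derivative gd t x) (at t within U)"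
    and c: "\<And>t. t \<in> U \<Longrightarrow> continuous_on UNIV (g t)" "continuous_on (U \<times> UNIV) (\<lambda>(t, x). gd t x)"
    and supp: "\<And>t x. t \<in> U \<Longrightarrow> norm x > r \<Longrightarrow> g t x = 0" "\<And>t x. t \<in> U \<Longrightarrow> norm x > r \<Longrightarrow> gd t x = 0"
    and U: "t0 \<in> U" "convex U"
  shows "((\<lambda>t. \<integral>x. g t x \<partial>lborel) has_real_derivative (\<integral>x. gd t0 x \<partial>lborel)) (at t0 within U)"
proof -
  obtain a where a: "cball (0::complex) r \<subseteq> cbox (- a) a"
    using bounded_subset_cbox_symmetric[OF bounded_cball] by blast
  have eq: "(\<integral>x. f x \<partial>lborel) = integral (cbox (- a) a) f"
    if f: "continuous_on UNIV f" "\<And>x. norm x > r \<Longrightarrow> f x = 0" for f :: "complex \<Rightarrow> real"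
  proof -
    have "integrable lborel f"
      using f by (intro integrable_lborel_compact_support[of _ "cball 0 r"]) auto
    then have "(\<integral>x. f x \<partial>lborel) = integral UNIV f" by (simp add: integral_lborel)
    moreover have "f = (\<lambda>x. if x \<in> cbox (- a) a then f x else 0)" using a f(2) by (force simp: subset_iff)
    moreover have "integral UNIV (\<lambda>x. if x \<in> cbox (- a) a then f x else 0) = integral (cbox (- a) a) f"
      by (rule integral_restrict_UNIV)
    ultimately show ?thesis by metis
  qed
  have ct: "continuous_on UNIV (gd t0)"
    using continuous_on_compose2[OF c(2), of UNIV "\<lambda>x. (t0, x)"] U
    by (force intro!: continuous_intros)
  have "((\<lambda>t. integral (cbox (- a) a) (g t)) has_real_derivative integral (cbox (- a) a) (gd t0)) (at t0 within U)"
    by (rule leibniz_rule_field_derivative)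
      (use D c U in \<open>auto intro!: integrable_continuous intro: continuous_on_subset\<close>)
  then have "((\<lambda>t. integral (cbox (- a) a) (g t)) has_real_derivative (\<integral>x. gd t0 x \<partial>lborel)) (at t0 within U)"
    using eq[OF ct supp(2)[OF U(1)]] by simp
  then show ?thesis
    by (rule has_field_derivative_transform_within[of _ _ _ _ 1]) (use U eq c supp in auto)
qed

text \<open>Regularity in one direction only: each of the two components of an entropy field is
  differentiated just along its own basis vector.\<close>

definition C1_along :: "complex \<Rightarrow> (complex \<Rightarrow> real) \<Rightarrow> (complex \<Rightarrow> real) \<Rightarrow> bool" where
  "C1_along v f fd \<longleftrightarrow> continuous_on UNIV f \<and> continuous_on UNIV fd \<and>
     (\<forall>x t. ((\<lambda>t. f (x + t *\<^sub>R v)) has_real_derivative fd (x + t *\<^sub>R v)) (at t))"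

lemma C1_alongI:
  assumes "\<And>x. (f has_derivative f' x) (at x)" "\<And>x. fd x = f' x v" "continuous_on UNIV fd"
  shows "C1_along v f fd"
  unfolding C1_along_def
proof (intro conjI allI assms)
  show "continuous_on UNIV f"
    using assms(1) by (meson continuous_at_imp_continuous_on has_derivative_continuous)
  fix x t
  have "bounded_linear (f' y)" for y using assms(1) has_derivative_bounded_linear by blast
  then have lin: "f' y (s *\<^sub>R w) = s *\<^sub>R f' y w" for y s w
    by (simp add: bounded_linear.linear linear_cmul)
  have "((\<lambda>t. f (x + t *\<^sub>R v)) has_derivative (\<lambda>s. f' (x + t *\<^sub>R v) (s *\<^sub>R v))) (at t)"
    by (rule has_derivative_compose[OF _ assms(1), of "\<lambda>t. x + t *\<^sub>R v"]) (auto intro!: derivative_eq_intros)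
  then show "((\<lambda>t. f (x + t *\<^sub>R v)) has_real_derivative fd (x + t *\<^sub>R v)) (at t)"
    unfolding lin assms(2) by (simp add: has_field_derivative_def mult_commute_abs)
qed

lemma C1_alongD:
  assumes "C1_along v f fd"
  shows "continuous_on UNIV f" "continuous_on UNIV fd"
    "((\<lambda>t. f (x + t *\<^sub>R v)) has_real_derivative fd (x + t *\<^sub>R v)) (at t within U)"
    "((\<lambda>t. f (x - t *\<^sub>R v)) has_real_derivative - fd (x - t *\<^sub>R v)) (at t within U)"
proof -
  note D = assms[unfolded C1_along_def, THEN conjunct2, THEN conjunct2, rule_format]
  show "((\<lambda>t. f (x + t *\<^sub>R v)) has_real_derivative fd (x + t *\<^sub>R v)) (at t within U)"
    using D DERIV_subset by blast
  have "((\<lambda>t. f (x + (- t) *\<^sub>R v)) has_real_derivative fd (x + (- t) *\<^sub>R v) * (- 1)) (at t within U)"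
    by (rule DERIV_chain2[where f = "\<lambda>t. f (x + t *\<^sub>R v)"]) (use D[of x "- t"] in \<open>auto intro!: derivative_eq_intros\<close>)
  then show "((\<lambda>t. f (x - t *\<^sub>R v)) has_real_derivative - fd (x - t *\<^sub>R v)) (at t within U)" by simp
qed (use assms in \<open>auto simp: C1_along_def\<close>)

text \<open>Both sides are the derivative at 0 of one function of \<open>t\<close>: the integral of
  \<open>P (x + t *\<^sub>R z) * \<psi> x\<close>, which by translation invariance is also the
  integral of \<open>P x * \<psi> (x - t *\<^sub>R z)\<close>.\<close>

lemma integral_by_parts_along:
  assumes P: "C1_along z P Pd" and \<psi>: "C1_along z \<psi> \<psi>d"
    and supp: "\<And>x. norm x > r \<Longrightarrow> \<psi> x = 0" "\<And>x. norm x > r \<Longrightarrow> \<psi>d x = 0"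
  shows "(\<integral>x. Pd x * \<psi> x \<partial>lborel) = - (\<integral>x. P x * \<psi>d x \<partial>lborel)"
proof -
  note [continuous_intros] = C1_alongD(1,2)[OF P, THEN continuous_on_compose2] C1_alongD(1,2)[OF \<psi>, THEN continuous_on_compose2]
  let ?U = "{-1..1::real}"
  have "((\<lambda>t. \<integral>x. P (x + t *\<^sub>R z) * \<psi> x \<partial>lborel) has_real_derivative (\<integral>x. Pd (x + 0 *\<^sub>R z) * \<psi> x \<partial>lborel)) (at 0 within ?U)"
    by (rule deriv_under_integral[of ?U _ _ r])
      (auto intro!: derivative_eq_intros C1_alongD(3)[OF P] continuous_intros simp: case_prod_unfold supp)
  then have L: "((\<lambda>t. \<integral>x. P (x + t *\<^sub>R z) * \<psi> x \<partial>lborel) has_real_derivative (\<integral>x. Pd x * \<psi> x \<partial>lborel)) (at 0)"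
    by (simp add: at_within_interior[of 0 ?U])
  have large: "norm (x - t *\<^sub>R z) > r" if "t \<in> ?U" "norm x > r + norm z" for t x
  proof -
    have "norm (t *\<^sub>R z) \<le> 1 * norm z" unfolding norm_scaleR using that(1) by (intro mult_right_mono) auto
    then show ?thesis using that(2) norm_triangle_ineq2[of x "t *\<^sub>R z"] by linarith
  qed
  have "((\<lambda>t. \<integral>x. P x * \<psi> (x - t *\<^sub>R z) \<partial>lborel) has_real_derivative (\<integral>x. P x * - \<psi>d (x - 0 *\<^sub>R z) \<partial>lborel)) (at 0 within ?U)"
    by (rule deriv_under_integral[of ?U _ _ "r + norm z"])
      (auto intro!: derivative_eq_intros C1_alongD(4)[OF \<psi>] continuous_intros simp: case_prod_unfold supp large)
  then have R: "((\<lambda>t. \<integral>x. P x * \<psi> (x - t *\<^sub>R z) \<partial>lborel) has_real_derivative - (\<integral>x. P x * \<psi>d x \<partial>lborel)) (at 0)"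
    by (simp add: at_within_interior[of 0 ?U])
  have "(\<integral>x. P x * \<psi> (x - t *\<^sub>R z) \<partial>lborel) = (\<integral>x. P (x + t *\<^sub>R z) * \<psi> x \<partial>lborel)" for t
  proof -
    have "integrable lborel (\<lambda>x. P (x + t *\<^sub>R z) * \<psi> x)"
      using supp by (intro integrable_lborel_compact_support[of _ "cball 0 r"] continuous_intros) auto
    from integrable_translate(2)[OF this, of "- t *\<^sub>R z"] show ?thesis by simp
  qed
  then show ?thesis using DERIV_unique[OF L] R by simp
qed

lemma C1_along_shift: "C1_along v f fd \<Longrightarrow> C1_along v (\<lambda>x. f (x + h)) (\<lambda>x. fd (x + h))"
  unfolding C1_along_def
proof (elim conjE, intro conjI allI)
  fix x t assume *: "\<forall>x t. ((\<lambda>t. f (x + t *\<^sub>R v)) has_real_derivative fd (x + t *\<^sub>R v)) (at t)"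
  have "((\<lambda>t. f ((x + h) + t *\<^sub>R v)) has_real_derivative fd ((x + h) + t *\<^sub>R v)) (at t)" using * by blast
  then show "((\<lambda>t. f (x + t *\<^sub>R v + h)) has_real_derivative fd (x + t *\<^sub>R v + h)) (at t)"
    by (simp add: algebra_simps)
qed (auto intro!: continuous_intros elim: continuous_on_compose2)

text \<open>\<open>F\<close> and \<open>P\<close> are the components along \<open>\<xi>\<close> and
  \<open>z\<close> of a vector field, and \<open>Fd + Pd\<close> is its divergence. The derivative
  of the integral under a shift along \<open>\<xi>\<close> contains \<open>Fd\<close>; up to the
  divergence this is \<open>- Pd\<close>, whose derivative moves to the test function. A small
  divergence and a small \<open>P\<close> thus keep \<open>F\<close> nearly constant along
  \<open>\<xi>\<close>.\<close>

lemma transport_estimate: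
  assumes F: "C1_along \<xi> F Fd" and P: "C1_along z P Pd" and \<psi>: "C1_along z \<psi> \<psi>d"
    and supp: "\<And>x. x \<notin> cball q r \<Longrightarrow> \<psi> x = 0" "\<And>x. x \<notin> cball q r \<Longrightarrow> \<psi>d x = 0"
    and M: "\<And>x. \<bar>\<psi> x\<bar> \<le> M" "\<And>x. \<bar>\<psi>d x\<bar> \<le> M"
    and K: "compact K" "\<And>x t. x \<in> cball q r \<Longrightarrow> 0 \<le> t \<Longrightarrow> t \<le> l \<Longrightarrow> x + t *\<^sub>R \<xi> \<in> K" and l: "l \<ge> 0"
  shows "\<bar>\<integral>x. (F (x + l *\<^sub>R \<xi>) - F x) * \<psi> x \<partial>lborel\<bar>
    \<le> l * M * ((\<integral>x\<in>K. \<bar>Fd x + Pd x\<bar> \<partial>lborel) + (\<integral>x\<in>K. \<bar>P x\<bar> \<partial>lborel))"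
proof -
  note [continuous_intros] = C1_alongD(1,2)[OF F, THEN continuous_on_compose2]
    C1_alongD(1,2)[OF P, THEN continuous_on_compose2] C1_alongD(1,2)[OF \<psi>, THEN continuous_on_compose2]
  let ?U = "{0..l}"
  define R where "R = norm q + r"
  have big: "x \<notin> cball q r" if "norm x > R" for x
    using that norm_triangle_ineq3[of x q] by (auto simp: R_def dist_norm norm_minus_commute)
  define J where "J t = (\<integral>x. F (x + t *\<^sub>R \<xi>) * \<psi> x \<partial>lborel)" for t
  define S where "S = (\<integral>x\<in>K. \<bar>Fd x + Pd x\<bar> \<partial>lborel) + (\<integral>x\<in>K. \<bar>P x\<bar> \<partial>lborel)"
  define W where "W x = indicator K x * (\<bar>Fd x + Pd x\<bar> + \<bar>P x\<bar>)" for x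
  have iK: "integrable lborel (\<lambda>x. indicator K x *\<^sub>R \<bar>Fd x + Pd x\<bar>)" "integrable lborel (\<lambda>x. indicator K x *\<^sub>R \<bar>P x\<bar>)"
    using K(1) by (rule borel_integrable_compact, intro continuous_intros subset_UNIV)+
  have iW: "integrable lborel W" and SW: "S = (\<integral>x. W x \<partial>lborel)"
    using iK Bochner_Integration.integral_add[OF iK] Bochner_Integration.integrable_add[OF iK]
    by (auto simp: W_def[abs_def] S_def set_lebesgue_integral_def distrib_left)
  have M0: "0 \<le> M" using M(1)[of 0] by linarith
  have int0: "integrable lborel f" if "continuous_on UNIV f" "\<And>x. x \<notin> cball q r \<Longrightarrow> f x = 0" for f :: "complex \<Rightarrow> real"
    using that by (intro integrable_lborel_compact_support[of _ "cball q r"]) auto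
  have DJ: "(J has_real_derivative (\<integral>x. Fd (x + t *\<^sub>R \<xi>) * \<psi> x \<partial>lborel)) (at t within ?U)" if "t \<in> ?U" for t
    unfolding J_def
    by (rule deriv_under_integral[of ?U _ _ R])
      (use that in \<open>auto intro!: derivative_eq_intros C1_alongD(3)[OF F] continuous_intros simp: case_prod_unfold supp[OF big]\<close>)
  have bd: "norm (\<integral>x. Fd (x + t *\<^sub>R \<xi>) * \<psi> x \<partial>lborel) \<le> M * S" if t: "t \<in> ?U" for t
  proof -
    let ?h = "t *\<^sub>R \<xi>"
    have ibp: "(\<integral>x. Pd (x + ?h) * \<psi> x \<partial>lborel) = - (\<integral>x. P (x + ?h) * \<psi>d x \<partial>lborel)"
      by (rule integral_by_parts_along[OF C1_along_shift[OF P] \<psi>, of R], (rule supp(1)[OF big] supp(2)[OF big], assumption)+)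
    have i: "integrable lborel (\<lambda>x. Fd (x + ?h) * \<psi> x)" "integrable lborel (\<lambda>x. Pd (x + ?h) * \<psi> x)"
      "integrable lborel (\<lambda>x. P (x + ?h) * \<psi>d x)"
      by (auto intro!: int0 continuous_intros simp: supp)
    have "(\<integral>x. Fd (x + ?h) * \<psi> x \<partial>lborel) = (\<integral>x. (Fd (x + ?h) * \<psi> x + Pd (x + ?h) * \<psi> x) + P (x + ?h) * \<psi>d x \<partial>lborel)"
      using i ibp by simp
    also have "\<dots> = (\<integral>x. (Fd (x + ?h) + Pd (x + ?h)) * \<psi> x + P (x + ?h) * \<psi>d x \<partial>lborel)"
      by (simp add: distrib_right)
    finally have eq: "(\<integral>x. Fd (x + ?h) * \<psi> x \<partial>lborel) = \<dots>" .
    have "norm (\<integral>x. (Fd (x + ?h) + Pd (x + ?h)) * \<psi> x + P (x + ?h) * \<psi>d x \<partial>lborel)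
        \<le> (\<integral>x. norm ((Fd (x + ?h) + Pd (x + ?h)) * \<psi> x + P (x + ?h) * \<psi>d x) \<partial>lborel)"
      by (rule integral_norm_bound)
    also have "\<dots> \<le> (\<integral>x. M * W (x + ?h) \<partial>lborel)"
    proof (rule integral_mono')
      show "integrable lborel (\<lambda>x. M * W (x + ?h))" using integrable_translate(1)[OF iW] by simp
      fix x
      show "norm ((Fd (x + ?h) + Pd (x + ?h)) * \<psi> x + P (x + ?h) * \<psi>d x) \<le> M * W (x + ?h)"
      proof (cases "x \<in> cball q r")
        case True
        then have "x + ?h \<in> K" using K t by auto
        then have "M * W (x + ?h) = \<bar>Fd (x + ?h) + Pd (x + ?h)\<bar> * M + \<bar>P (x + ?h)\<bar> * M"
          by (simp add: W_def algebra_simps)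
        moreover have "\<bar>(Fd (x + ?h) + Pd (x + ?h)) * \<psi> x\<bar> \<le> \<bar>Fd (x + ?h) + Pd (x + ?h)\<bar> * M"
          "\<bar>P (x + ?h) * \<psi>d x\<bar> \<le> \<bar>P (x + ?h)\<bar> * M"
          unfolding abs_mult using M by (auto intro: mult_left_mono)
        ultimately show ?thesis by simp
      next
        case False
        then show ?thesis using supp M0 by (simp add: W_def)
      qed
      show "0 \<le> M * W (x + ?h)" using M0 by (simp add: W_def)
    qed
    also have "\<dots> = M * S" using integrable_translate(2)[OF iW, of ?h] by (simp add: SW)
    finally show ?thesis unfolding eq .
  qed
  have "norm (J l - J 0) \<le> M * S * norm (l - 0)"
    by (rule field_differentiable_bound[of ?U J]) (use DJ bd l in auto)
  moreover have "(\<integral>x. (F (x + l *\<^sub>R \<xi>) - F x) * \<psi> x \<partial>lborel) = J l - J 0"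
  proof -
    have "integrable lborel (\<lambda>x. F (x + l *\<^sub>R \<xi>) * \<psi> x)" "integrable lborel (\<lambda>x. F x * \<psi> x)"
      by (auto intro!: int0 continuous_intros simp: supp)
    then show ?thesis by (simp add: J_def left_diff_distrib)
  qed
  ultimately show ?thesis using l by (simp add: S_def algebra_simps)
qed

section \<open>Entropies\<close>

lemma ex_antiderivative:
  fixes g :: "real \<Rightarrow> real"
  assumes "continuous_on UNIV g"
  shows "\<exists>G. (\<forall>x. (G has_real_derivative g x) (at x)) \<and> G a = b"
proof -
  have "isCont g x" for x using assms by (simp add: continuous_on_eq_continuous_at)
  then obtain F where F: "\<And>x. (F has_vector_derivative g x) (at x)"
    using einterval_antiderivative[of "-\<infinity>" "\<infinity>" g] by auto
  then have "((\<lambda>x. F x - F a + b) has_real_derivative g x) (at x)" for x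
    unfolding has_real_derivative_iff_has_vector_derivative[symmetric]
    by (auto intro!: derivative_eq_intros)
  then show ?thesis by (intro exI[of _ "\<lambda>x. F x - F a + b"]) auto
qed

lemma antiderivative_const:
  fixes G :: "real \<Rightarrow> real"
  assumes "\<And>x. (G has_real_derivative g x) (at x)" "convex S" "\<And>x. x \<in> S \<Longrightarrow> g x = 0" "x \<in> S" "y \<in> S"
  shows "G x = G y"
proof -
  have "(G has_real_derivative 0) (at u within S)" if "u \<in> S" for u
    using assms(1)[of u] assms(3)[OF that] by (metis DERIV_subset subset_UNIV)
  then show ?thesis using has_field_derivative_zero_constant[OF assms(2)] assms(4,5) by metis
qed

lemma antiderivative_bound:
  fixes G :: "real \<Rightarrow> real"
  assumes "\<And>x. (G has_real_derivative g x) (at x)" "\<And>x. a \<le> x \<Longrightarrow> x \<le> b \<Longrightarrow> \<bar>g x\<bar> \<le> B" "a \<le> x" "x \<le> b"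
  shows "\<bar>G x - G a\<bar> \<le> B * (x - a)"
proof -
  have "norm (G x - G a) \<le> B * norm (x - a)"
    by (rule field_differentiable_bound[of "{a..b}" G g])
      (use assms in \<open>auto intro: has_field_derivative_at_within\<close>)
  then show ?thesis using assms(3) by simp
qed

text \<open>Evenness of \<open>h\<close> serves the symmetry between the branches of the unit circle
  at \<open>z\<close> and at \<open>-z\<close>. \<open>H 0 = 1 / 2\<close> makes the rescaled steps
  converge to \<open>(1 + sgn v) / 2\<close> also at \<open>v = 0\<close>.\<close>

locale smooth_step =
  fixes H h h' :: "real \<Rightarrow> real" and Mh :: real
  assumes H_deriv: "(H has_real_derivative h s) (at s)"
    and h_deriv: "(h has_real_derivative h' s) (at s)"
    and h'_cont: "continuous_on UNIV h'"
    and h_even: "h (- s) = h s" and h_nonneg: "0 \<le> h s"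
    and H_left: "s \<le> -1 \<Longrightarrow> H s = 0" and H_right: "s \<ge> 1 \<Longrightarrow> H s = 1" and H_0: "H 0 = 1 / 2"
    and h_outside: "\<bar>s\<bar> \<ge> 1 \<Longrightarrow> h s = 0" "\<bar>s\<bar> \<ge> 1 \<Longrightarrow> h' s = 0"
    and Mh: "Mh > 0" "\<bar>h s\<bar> \<le> Mh" "\<bar>h' s\<bar> \<le> Mh"

lemma bounded_of_compact_support:
  fixes g :: "real \<Rightarrow> real"
  assumes "continuous_on UNIV g" "\<And>s. \<bar>s\<bar> \<ge> r \<Longrightarrow> \<bar>g s\<bar> \<le> c"
  shows "\<exists>M>0. \<forall>s. \<bar>g s\<bar> \<le> M"
proof -
  have "compact (g ` {-r..r})" by (intro compact_continuous_image continuous_on_subset[OF assms(1)]) auto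
  then obtain B where B: "B > 0" "\<And>s. s \<in> {-r..r} \<Longrightarrow> \<bar>g s\<bar> \<le> B"
    using compact_imp_bounded bounded_pos by (metis (no_types, lifting) imageI real_norm_def)
  have "\<bar>g s\<bar> \<le> max B c" for s
  proof (cases "\<bar>s\<bar> \<ge> r")
    case True
    then show ?thesis using assms(2)[of s] by simp
  next
    case False
    then have "s \<in> {-r..r}" by auto
    then show ?thesis using B(2)[of s] by simp
  qed
  then show ?thesis using B(1) by (intro exI[of _ "max B c"]) auto
qed

text \<open>The density is \<open>(1 - s\<^sup>2)\<^sup>2\<close> cut off outside
  \<open>[-1, 1]\<close>, which is just C^1. Its odd antiderivative \<open>A\<close> runs from
  \<open>- A 1\<close> to \<open>A 1\<close>, and the factor \<open>a\<close> rescales this range to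
  length 1.\<close>

lemma ex_smooth_step: "\<exists>H h h' Mh. smooth_step H h h' Mh"
proof -
  define b b' where "b s = (max 0 (1 - s\<^sup>2))\<^sup>2" and "b' s = - 4 * s * max 0 (1 - s\<^sup>2)" for s :: real
  have sq: "((\<lambda>y. (max 0 y)\<^sup>2) has_real_derivative 2 * max 0 y) (at y)" for y :: real
  proof -
    consider "y > 0" | "y < 0" | "y = 0" by linarith
    then show ?thesis
    proof cases
      case 1
      have "((\<lambda>y. y\<^sup>2) has_real_derivative 2 * max 0 y) (at y)" using 1 by (auto intro!: derivative_eq_intros)
      then show ?thesis
        by (rule has_field_derivative_transform_within_open[of _ _ _ "{0<..}"]) (use 1 in auto)
    next
      case 2
      have "((\<lambda>y. 0) has_real_derivative 2 * max 0 y) (at y)" using 2 by simp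
      then show ?thesis
        by (rule has_field_derivative_transform_within_open[of _ _ _ "{..<0}"]) (use 2 in auto)
    next
      case 3
      have le: "norm ((max 0 h)\<^sup>2 / h) \<le> \<bar>h\<bar>" for h :: real
        by (cases "h > 0") (simp_all add: power2_eq_square max_absorb1)
      have lim: "((\<lambda>h::real. \<bar>h\<bar>) \<longlongrightarrow> 0) (at 0)" by (intro tendsto_rabs_zero tendsto_ident_at)
      have "((\<lambda>h. (max 0 h)\<^sup>2 / h) \<longlongrightarrow> 0) (at (0::real))"
        by (rule Lim_null_comparison[OF always_eventually[OF allI[OF le]] lim])
      then show ?thesis using 3 by (simp add: DERIV_def)
    qed
  qed
  have b: "(b has_real_derivative b' s) (at s)" for s
  proof -
    have "((\<lambda>s. (max 0 (1 - s\<^sup>2))\<^sup>2) has_real_derivative 2 * max 0 (1 - s\<^sup>2) * (- 2 * s)) (at s)"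
      by (rule DERIV_chain2[OF sq]) (auto intro!: derivative_eq_intros)
    then show ?thesis by (simp add: b_def[abs_def] b'_def algebra_simps)
  qed
  have contb: "continuous_on UNIV b" "continuous_on UNIV b'"
    unfolding b_def[abs_def] b'_def[abs_def] by (intro continuous_intros)+
  have out: "b s = 0" "b' s = 0" if "\<bar>s\<bar> \<ge> 1" for s
    using power_mono[of 1 "\<bar>s\<bar>" 2] that by (auto simp: b_def b'_def)
  obtain A where A: "\<And>s. (A has_real_derivative b s) (at s)" "A 0 = 0"
    using ex_antiderivative[OF contb(1), of 0 0] by blast
  have sym: "A (- s) = - A s" for s
  proof -
    have "((\<lambda>s. A s + A (- s)) has_real_derivative 0) (at s)" for s
    proof -
      have "((\<lambda>s. A (- s)) has_real_derivative b (- s) * - 1) (at s)"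
        by (rule DERIV_chain2[OF A(1)]) (auto intro!: derivative_eq_intros)
      from DERIV_add[OF A(1)[of s] this] show ?thesis by (simp add: b_def)
    qed
    from antiderivative_const[OF this, of UNIV s 0] show ?thesis using A(2) by simp
  qed
  have "\<exists>c>0. c < 1 \<and> A 1 - A 0 = (1 - 0) * b c"
    using MVT2[of 0 1 A b] A(1) by auto
  then obtain c where c: "0 < c" "c < 1" "A 1 - A 0 = (1 - 0) * b c" by blast
  have "c\<^sup>2 < 1" using c by (simp add: power_less_one_iff)
  then have A1: "A 1 > 0" using c A(2) by (simp add: b_def)
  define a where "a = 1 / (2 * A 1)"
  have a: "a > 0" using A1 by (simp add: a_def)
  have bd: "\<exists>M>0. \<forall>s. \<bar>a * b s\<bar> \<le> M" "\<exists>M>0. \<forall>s. \<bar>a * b' s\<bar> \<le> M"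
    by (rule bounded_of_compact_support[of _ 1 0]; use contb out in \<open>auto intro!: continuous_intros\<close>)+
  obtain M1 M2 where M: "M1 > 0" "M2 > 0" "\<And>s. \<bar>a * b s\<bar> \<le> M1" "\<And>s. \<bar>a * b' s\<bar> \<le> M2"
    using bd by metis
  have right: "A s = A 1" if "s \<ge> 1" for s
    using antiderivative_const[OF A(1), of "{1..}" s 1] that out by auto
  have "smooth_step (\<lambda>s. a * A s + 1 / 2) (\<lambda>s. a * b s) (\<lambda>s. a * b' s) (M1 + M2)"
  proof
    fix s :: real
    show "((\<lambda>s. a * A s + 1 / 2) has_real_derivative a * b s) (at s)"
      by (auto intro!: derivative_eq_intros A(1))
    show "((\<lambda>s. a * b s) has_real_derivative a * b' s) (at s)" by (auto intro!: derivative_eq_intros b)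
    show "a * A s + 1 / 2 = 1" if "s \<ge> 1" using right[OF that] A1 by (simp add: a_def)
    show "a * A s + 1 / 2 = 0" if "s \<le> - 1"
    proof -
      have "A s = - A 1" using right[of "- s"] sym[of s] that by simp
      then show ?thesis using A1 by (simp add: a_def)
    qed
    show "\<bar>a * b s\<bar> \<le> M1 + M2" "\<bar>a * b' s\<bar> \<le> M1 + M2" using M(1,2) M(3,4)[of s] by auto
    show "continuous_on UNIV (\<lambda>s. a * b' s)" by (intro continuous_intros contb)
    show "a * b (- s) = a * b s" "0 \<le> a * b s" using a by (auto simp: b_def)
    show "a * A 0 + 1 / 2 = 1 / 2" using A(2) by simp
    show "a * b s = 0" "a * b' s = 0" if "\<bar>s\<bar> \<ge> 1" using out[OF that] by auto
    show "M1 + M2 > 0" using M by simp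
  qed
  then show ?thesis by blast
qed

context smooth_step
begin

lemma h'_odd: "h' (- s) = - h' s"
proof -
  have "((\<lambda>s. h (- s)) has_real_derivative h' (- s) * - 1) (at s)"
    by (rule DERIV_chain2[OF h_deriv]) (auto intro!: derivative_eq_intros)
  then have "(h has_real_derivative - h' (- s)) (at s)" by (simp add: h_even)
  then show ?thesis using DERIV_unique[OF h_deriv] by fastforce
qed

lemma H_mono: "x \<le> y \<Longrightarrow> H x \<le> H y"
  using DERIV_nonneg_imp_nondecreasing[of x y H] H_deriv h_nonneg by blast

lemma H_range: "0 \<le> H s" "H s \<le> 1"
  using H_mono[of s "max s 1"] H_right[of "max s 1"] H_mono[of "min s (-1)" s] H_left[of "min s (-1)"] by auto

lemma continuous_H: "continuous_on UNIV H" and continuous_h: "continuous_on UNIV h"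
  using H_deriv h_deriv by (meson DERIV_isCont continuous_at_imp_continuous_on)+

end

section \<open>The unit circle as a graph over its tangent\<close>

context plane_norm
begin

text \<open>The distance of \<open>N v\<close> from 1, truncated so that it is a bounded continuous
  weight. Multiplied with a merely integrable gradient it still passes to the limit by dominated
  convergence.\<close>

definition defect :: "complex \<Rightarrow> real" where "defect v = min 1 \<bar>1 - N v\<bar>"

lemma defect_bounds: "0 \<le> defect v" "defect v \<le> 1"
  by (auto simp: defect_def)

lemma continuous_defect: "continuous_on S defect"
  unfolding defect_def[abs_def] by (intro continuous_intros)

lemma N_graph_bounds:
  assumes "N z = 1" "\<bar>s\<bar> * N \<xi> \<le> 1 / 4"
  shows "\<bar>N (s *\<^sub>R \<xi> + t *\<^sub>R z) - \<bar>t\<bar>\<bar> \<le> 1 / 4"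
  using N_diff_le[of "s *\<^sub>R \<xi> + t *\<^sub>R z" "t *\<^sub>R z"] assms by simp

text \<open>Along the ray \<open>g\<close> is convex with \<open>g 0 \<le> 1 / 4\<close>,
  \<open>g f = 1\<close> and \<open>f \<le> 5 / 4\<close>. A convex function that has risen by 3/4
  over a length of at most 5/4 passes the value 1 at least linearly, with the factor 5/3, rounded up
  to 2.\<close>

lemma N_graph:
  assumes z: "N z = 1" and s: "\<bar>s\<bar> * N \<xi> \<le> 1 / 4"
  shows "\<exists>f. 3 / 4 \<le> f \<and> f \<le> 5 / 4 \<and> (\<forall>t\<ge>0. \<bar>t - f\<bar> \<le> 2 * \<bar>1 - N (s *\<^sub>R \<xi> + t *\<^sub>R z)\<bar>)
    \<and> N (s *\<^sub>R \<xi> + f *\<^sub>R z) = 1"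
proof -
  define g where "g t = N (s *\<^sub>R \<xi> + t *\<^sub>R z)" for t
  note gb = N_graph_bounds[OF z s, folded g_def]
  have "continuous_on {0..2} g" unfolding g_def[abs_def] by (intro continuous_intros)
  then obtain f where f: "0 \<le> f" "f \<le> 2" "g f = 1"
  proof -
    have "g 0 \<le> 1" "1 \<le> g 2" using gb[of 0] gb[of 2] unfolding abs_le_iff by linarith+
    then show thesis using that IVT'[of g 0 1 2] \<open>continuous_on {0..2} g\<close> by auto
  qed
  have f34: "3 / 4 \<le> f" "f \<le> 5 / 4" using gb[of f] f unfolding abs_le_iff by auto
  have conv: "g ((1 - l) * 0 + l * t) \<le> (1 - l) * g 0 + l * g t" if "0 \<le> l" "l \<le> 1" for l t
  proof -
    have "s *\<^sub>R \<xi> + ((1 - l) * 0 + l * t) *\<^sub>R z = (1 - l) *\<^sub>R (s *\<^sub>R \<xi> + 0 *\<^sub>R z) + l *\<^sub>R (s *\<^sub>R \<xi> + t *\<^sub>R z)"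
      by (simp add: algebra_simps)
    then show ?thesis
      using N_triangle[of "(1 - l) *\<^sub>R (s *\<^sub>R \<xi> + 0 *\<^sub>R z)" "l *\<^sub>R (s *\<^sub>R \<xi> + t *\<^sub>R z)"] that
      unfolding g_def by (simp add: abs_mult)
  qed
  have g0: "g 0 \<le> 1 / 4" using gb[of 0] by auto
  have "\<bar>t - f\<bar> \<le> 2 * \<bar>1 - g t\<bar>" if t: "t \<ge> 0" for t
  proof (cases "t \<le> f")
    case True
    define l where "l = t / f"
    have l: "0 \<le> l" "l \<le> 1" "l * f = t" using True t f34 by (auto simp: l_def)
    have "g t \<le> (1 - l) * g 0 + l * 1" using conv[OF l(1,2), of f] l(3) f(3) by simp
    also have "\<dots> \<le> (1 - l) * (1 / 4) + l * 1" using g0 l by (intro add_right_mono mult_left_mono) auto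
    finally have "1 - g t \<ge> (1 - l) * (3 / 4)" by argo
    moreover have "f - t = (1 - l) * f" using l(3) by (simp add: algebra_simps)
    moreover have "(1 - l) * f \<le> (1 - l) * (5 / 4)" using l f34 by (intro mult_left_mono) auto
    ultimately have "f - t \<le> 2 * (1 - g t)" using l(2) by argo
    then show ?thesis using True by simp
  next
    case False
    define l where "l = f / t"
    have t0: "t > 0" using False f by auto
    have l: "0 \<le> l" "l \<le> 1" "l * t = f" using False t0 f by (auto simp: l_def)
    have "1 \<le> (1 - l) * g 0 + l * g t" using conv[OF l(1,2), of t] l(3) f(3) by simp
    also have "\<dots> \<le> (1 - l) * (1 / 4) + l * g t" using g0 l by (intro add_right_mono mult_left_mono) auto
    finally have "(1 - l) * (3 / 4) \<le> l * (g t - 1)" by argo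
    then have "t * ((1 - l) * (3 / 4)) \<le> t * (l * (g t - 1))" using t0 by (intro mult_left_mono) auto
    moreover have "t * ((1 - l) * (3 / 4)) = (t - l * t) * (3 / 4)" "t * (l * (g t - 1)) = (l * t) * (g t - 1)"
      by (simp_all add: field_simps)
    ultimately have "(t - f) * (3 / 4) \<le> f * (g t - 1)" using l(3) by simp
    moreover have "0 \<le> g t - 1"
    proof -
      have "0 < l" using f34 t0 by (simp add: l_def)
      moreover have "0 \<le> (1 - l) * (3 / 4)" using l(2) by simp
      then have "0 \<le> l * (g t - 1)" using \<open>(1 - l) * (3 / 4) \<le> l * (g t - 1)\<close> by (rule order_trans)
      ultimately show ?thesis by (simp add: zero_le_mult_iff)
    qed
    moreover have "f * (g t - 1) \<le> (5 / 4) * (g t - 1)" using \<open>0 \<le> g t - 1\<close> f34 by (intro mult_right_mono) auto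
    ultimately have "t - f \<le> 2 * (g t - 1)" by argo
    then show ?thesis using False by simp
  qed
  then show ?thesis using f34 f(3) by (auto simp: g_def)
qed

text \<open>Inserting the point of the circle over \<open>s'\<close> into the estimate at
  \<open>s\<close> gives the Lipschitz constant \<open>2 * N \<xi>\<close>. Beyond
  \<open>\<bar>s\<bar> = d\<close> the function is frozen at its end values, to be continuous on the
  whole line.\<close>

lemma ex_graph:
  assumes z: "N z = 1" and d: "d > 0" "d * N \<xi> \<le> 1 / 4"
  shows "\<exists>f. continuous_on UNIV f \<and> (\<forall>s. 3 / 4 \<le> f s \<and> f s \<le> 5 / 4) \<and>
    (\<forall>s t. \<bar>s\<bar> \<le> d \<longrightarrow> 0 \<le> t \<longrightarrow> \<bar>t - f s\<bar> \<le> 2 * \<bar>1 - N (s *\<^sub>R \<xi> + t *\<^sub>R z)\<bar>)"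
proof -
  have sm: "\<bar>s\<bar> * N \<xi> \<le> 1 / 4" if "\<bar>s\<bar> \<le> d" for s
    using mult_right_mono[OF that, of "N \<xi>"] d(2) by simp
  have "\<exists>f. \<bar>s\<bar> \<le> d \<longrightarrow> 3 / 4 \<le> f \<and> f \<le> 5 / 4 \<and> (\<forall>t\<ge>0. \<bar>t - f\<bar> \<le> 2 * \<bar>1 - N (s *\<^sub>R \<xi> + t *\<^sub>R z)\<bar>)
    \<and> N (s *\<^sub>R \<xi> + f *\<^sub>R z) = 1" for s
    using N_graph[OF z sm] by meson
  then obtain f where f: "\<And>s. \<bar>s\<bar> \<le> d \<Longrightarrow> 3 / 4 \<le> f s" "\<And>s. \<bar>s\<bar> \<le> d \<Longrightarrow> f s \<le> 5 / 4"
     "\<And>s t. \<bar>s\<bar> \<le> d \<Longrightarrow> 0 \<le> t \<Longrightarrow> \<bar>t - f s\<bar> \<le> 2 * \<bar>1 - N (s *\<^sub>R \<xi> + t *\<^sub>R z)\<bar>"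
     "\<And>s. \<bar>s\<bar> \<le> d \<Longrightarrow> N (s *\<^sub>R \<xi> + f s *\<^sub>R z) = 1"
    by metis
  define cl where "cl s = max (- d) (min d s)" for s
  have cl: "\<bar>cl s\<bar> \<le> d" "\<bar>s\<bar> \<le> d \<Longrightarrow> cl s = s" for s using d(1) by (auto simp: cl_def)
  have "\<bar>f s' - f s\<bar> \<le> (2 * N \<xi>) * \<bar>s' - s\<bar>" if "\<bar>s\<bar> \<le> d" "\<bar>s'\<bar> \<le> d" for s s'
  proof -
    have "\<bar>f s' - f s\<bar> \<le> 2 * \<bar>N (s' *\<^sub>R \<xi> + f s' *\<^sub>R z) - N (s *\<^sub>R \<xi> + f s' *\<^sub>R z)\<bar>"
      using f(3)[of s "f s'"] f(1)[of s'] f(4)[of s'] that by simp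
    also have "\<dots> \<le> 2 * N ((s' *\<^sub>R \<xi> + f s' *\<^sub>R z) - (s *\<^sub>R \<xi> + f s' *\<^sub>R z))"
      by (intro mult_left_mono N_diff_le) auto
    also have "(s' *\<^sub>R \<xi> + f s' *\<^sub>R z) - (s *\<^sub>R \<xi> + f s' *\<^sub>R z) = (s' - s) *\<^sub>R \<xi>" by (simp add: algebra_simps)
    also have "2 * N ((s' - s) *\<^sub>R \<xi>) = 2 * N \<xi> * \<bar>s' - s\<bar>" by simp
    finally show ?thesis .
  qed
  then have "(2 * N \<xi>)-lipschitz_on {-d..d} f"
    by (auto simp: lipschitz_on_def dist_real_def abs_le_iff)
  then have "continuous_on {-d..d} f" by (rule lipschitz_on_continuous_on)
  then have "continuous_on UNIV (\<lambda>s. f (cl s))"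
    by (rule continuous_on_compose2) (use d(1) in \<open>auto simp: cl_def[abs_def] intro!: continuous_intros\<close>)
  then show ?thesis using f cl by (intro exI[of _ "\<lambda>s. f (cl s)"]) auto
qed

end

lemma has_derivative_compose_real:
  fixes g :: "real \<Rightarrow> real"
  assumes "(g has_real_derivative g') (at (f x))" "(f has_derivative f') (at x)"
  shows "((\<lambda>x. g (f x)) has_derivative (\<lambda>w. g' * f' w)) (at x)"
  using has_derivative_compose[OF assms(2), of g "(*) g'"] assms(1)
  by (simp add: has_field_derivative_def)

context plane_norm
begin

text \<open>\<open>\<i> * \<nu>\<close> is orthogonal to the gradient \<nu>, so \<open>N\<close>
  does not change to first order in this direction. The rate \<open>w\<close> can be as small as
  desired; this is the source of the smallness of the entropy component along
  \<open>z\<close>.\<close>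

lemma tangent_graph_estimate:
  assumes z: "N z = 1" "(N has_derivative (\<lambda>w. \<nu> \<bullet> w)) (at z)" and w: "w > 0"
  shows "\<exists>d>0. \<forall>s. \<bar>s\<bar> \<le> d \<longrightarrow> 2 * \<bar>1 - N (s *\<^sub>R (\<i> * \<nu>) + z)\<bar> \<le> w * \<bar>s\<bar>"
proof -
  define M where "M = norm \<nu> + 1"
  have M: "M > 0" by (simp add: M_def add_nonneg_pos)
  obtain d where d: "d > 0" "\<And>y. norm (y - z) < d \<Longrightarrow> norm (N y - N z - \<nu> \<bullet> (y - z)) \<le> w / (2 * M) * norm (y - z)"
    using z(2)[unfolded has_derivative_at_alt, THEN conjunct2, rule_format, of "w / (2 * M)"] w M by auto
  have "2 * \<bar>1 - N (s *\<^sub>R (\<i> * \<nu>) + z)\<bar> \<le> w * \<bar>s\<bar>" if s: "\<bar>s\<bar> \<le> d / (2 * M)" for s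
  proof -
    have n: "norm (s *\<^sub>R (\<i> * \<nu>)) \<le> \<bar>s\<bar> * M" by (auto simp: norm_mult M_def intro!: mult_left_mono)
    have "\<bar>s\<bar> * M \<le> d / 2" using s M by (simp add: field_simps)
    then have lt: "norm ((s *\<^sub>R (\<i> * \<nu>) + z) - z) < d" using n d(1) by simp
    have "\<nu> \<bullet> (\<i> * \<nu>) = 0" by (simp add: inner_complex_def)
    then have "\<bar>N (s *\<^sub>R (\<i> * \<nu>) + z) - 1\<bar> \<le> w / (2 * M) * norm (s *\<^sub>R (\<i> * \<nu>))"
      using d(2)[OF lt] z(1) by simp
    also have "\<dots> \<le> w / (2 * M) * (\<bar>s\<bar> * M)" using n w M by (intro mult_left_mono) auto
    also have "\<dots> = w * \<bar>s\<bar> / 2" using M by simp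
    finally show ?thesis by (simp add: abs_minus_commute)
  qed
  then show ?thesis using d(1) M by (intro exI[of _ "d / (2 * M)"]) auto
qed

text \<open>Dual bases: \<open>\<i> * z\<close> annihilates \<open>z\<close>, \<open>\<nu>\<close>
  annihilates \<open>\<i> * \<nu>\<close>, and the other two pairings are 1.\<close>

lemma coordinates:
  assumes "\<nu> \<bullet> z = 1"
  shows "v = ((\<i> * z) \<bullet> v) *\<^sub>R (\<i> * \<nu>) + (\<nu> \<bullet> v) *\<^sub>R z"
proof -
  have "Re \<nu> * Re z + Im \<nu> * Im z = 1" using assms by (simp add: inner_complex_def)
  then have "Re v = (Re \<nu> * Re z + Im \<nu> * Im z) * Re v" "Im v = (Re \<nu> * Re z + Im \<nu> * Im z) * Im v" by auto
  then show ?thesis by (simp add: complex_eq_iff inner_complex_def algebra_simps)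
qed

end

locale norm_step = plane_norm N + smooth_step H h h' Mh
  for N :: "complex \<Rightarrow> real" and H h h' Mh
begin

text \<open>In the coordinates \<open>v = s \<xi> + t z\<close> the entropy is \<open>H(s/\<delta>) \<xi> + P(s,t) z\<close>. Its Jacobian has to be
  a multiple of the identity on the unit circle of \<open>N\<close>, up to a multiple of \<open>\<bar>1 - N\<bar>\<close> off it. Near \<open>z\<close> the
  circle is the graph \<open>t = f(s)\<close>, where \<open>P = h t - K\<close> with \<open>K' = h' f\<close> does this; near \<open>-z\<close> it is
  \<open>t = -f(-s)\<close>, and both choices are glued by \<open>\<theta>\<close> in the region where \<open>N\<close> is away from 1.\<close>

lemma ex_entropy_coords:
  assumes z: "N z = 1" "(N has_derivative (\<lambda>w. \<nu> \<bullet> w)) (at z)" and \<eta>: "\<eta> > 0"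
  defines "\<xi> \<equiv> \<i> * \<nu>"
  shows "\<exists>\<delta> P Ps Pt C. 0 < \<delta> \<and> \<delta> < \<eta> \<and> 0 \<le> C \<and>
    (\<forall>p. ((\<lambda>(s, t). P s t) has_derivative (\<lambda>(a, b). Ps (fst p) (snd p) * a + Pt (fst p) (snd p) * b)) (at p)) \<and>
    continuous_on UNIV (\<lambda>p. Ps (fst p) (snd p)) \<and> continuous_on UNIV (\<lambda>p. Pt (fst p) (snd p)) \<and>
    (\<forall>s t. \<bar>Ps s t\<bar> \<le> C * defect (s *\<^sub>R \<xi> + t *\<^sub>R z)) \<and>
    (\<forall>s t. \<bar>Pt s t - h (s / \<delta>) / \<delta>\<bar> \<le> C * defect (s *\<^sub>R \<xi> + t *\<^sub>R z)) \<and>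
    (\<forall>s t. N (s *\<^sub>R \<xi> + t *\<^sub>R z) = 1 \<longrightarrow> \<bar>P s t\<bar> \<le> \<eta>)"
proof -
  \<comment> \<open>On the circle \<open>P\<close> is made of \<open>hd s * f s - K s\<close>, at
    most \<open>3 * Mh * \<omega>\<close>, and \<open>K \<delta>\<close>, at most
    \<open>2 * Mh * \<omega>\<close>; the 5 makes their sum \<eta>.\<close>
  define \<omega> where "\<omega> = \<eta> / (5 * Mh)"
  have \<omega>: "\<omega> > 0" "5 * Mh * \<omega> = \<eta>" using \<eta> Mh(1) by (auto simp: \<omega>_def)
  define d0 where "d0 = 1 / (4 * (N \<xi> + 1))"
  have d0: "d0 > 0" "d0 * N \<xi> \<le> 1 / 4"
  proof -
    have p: "4 * (N \<xi> + 1) > 0" using N_nonneg[of \<xi>] by argo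
    then show "d0 > 0" unfolding d0_def by (rule divide_pos_pos[OF zero_less_one])
    have "N \<xi> \<le> (1 / 4) * (4 * (N \<xi> + 1))" by argo
    then have "N \<xi> / (4 * (N \<xi> + 1)) \<le> 1 / 4" using p by (simp only: pos_divide_le_eq)
    then show "d0 * N \<xi> \<le> 1 / 4" by (simp add: d0_def)
  qed
  obtain d1 where d1: "d1 > 0" "\<And>s. \<bar>s\<bar> \<le> d1 \<Longrightarrow> 2 * \<bar>1 - N (s *\<^sub>R \<xi> + z)\<bar> \<le> \<omega> * \<bar>s\<bar>"
    using tangent_graph_estimate[OF z \<omega>(1)] unfolding \<xi>_def by blast
  define \<delta> where "\<delta> = min (\<eta> / 2) (min d0 d1)"
  have \<delta>: "0 < \<delta>" "\<delta> < \<eta>" "\<delta> \<le> d0" "\<delta> \<le> d1" using \<eta> d0 d1 by (auto simp: \<delta>_def)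
  have dN: "\<delta> * N \<xi> \<le> 1 / 4" using mult_right_mono[OF \<delta>(3), of "N \<xi>"] d0(2) by simp
  obtain f where f: "continuous_on UNIV f" "\<And>s. 3 / 4 \<le> f s" "\<And>s. f s \<le> 5 / 4"
    "\<And>s t. \<bar>s\<bar> \<le> \<delta> \<Longrightarrow> 0 \<le> t \<Longrightarrow> \<bar>t - f s\<bar> \<le> 2 * \<bar>1 - N (s *\<^sub>R \<xi> + t *\<^sub>R z)\<bar>"
    using ex_graph[OF z(1) \<delta>(1) dN] by blast
  have f1: "\<bar>f s - 1\<bar> \<le> \<omega> * \<delta>" if "\<bar>s\<bar> \<le> \<delta>" for s
  proof -
    have "\<bar>1 - f s\<bar> \<le> 2 * \<bar>1 - N (s *\<^sub>R \<xi> + 1 *\<^sub>R z)\<bar>" using f(4)[OF that, of 1] by simp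
    also have "\<dots> \<le> \<omega> * \<bar>s\<bar>" using d1(2)[of s] that \<delta>(4) by simp
    also have "\<dots> \<le> \<omega> * \<delta>" using that \<omega>(1) by (intro mult_left_mono) auto
    finally show ?thesis by (simp add: abs_minus_commute)
  qed
  \<comment> \<open>\<open>hd\<close> is the derivative of the first component
    \<open>H (s / \<delta>)\<close>, hence the diagonal entry that \<open>Pt\<close> has to
    match.\<close>
  define hd hd' where "hd s = h (s / \<delta>) / \<delta>" and "hd' s = h' (s / \<delta>) / \<delta>\<^sup>2" for s
  have hd: "(hd has_real_derivative hd' s) (at s)" for s
    unfolding hd_def[abs_def] hd'_def using \<delta>(1)
    by (auto intro!: derivative_eq_intros DERIV_chain2[OF h_deriv] simp: power2_eq_square)
  have cont: "continuous_on UNIV hd" "continuous_on UNIV hd'"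
    unfolding hd_def[abs_def] hd'_def[abs_def] using \<delta>(1)
    by (auto intro!: continuous_intros continuous_on_compose2[OF continuous_h] continuous_on_compose2[OF h'_cont])
  have hd_out: "hd s = 0" "hd' s = 0" if "\<bar>s\<bar> \<ge> \<delta>" for s
    using h_outside[of "s / \<delta>"] that \<delta>(1) by (auto simp: hd_def hd'_def)
  have hd_sym: "hd (- s) = hd s" "hd' (- s) = - hd' s" for s
    using h_even[of "s / \<delta>"] h'_odd[of "s / \<delta>"] by (auto simp: hd_def hd'_def)
  have hd_bound: "\<bar>hd s\<bar> \<le> Mh / \<delta>" "\<bar>hd' s\<bar> \<le> Mh / \<delta>\<^sup>2" for s
    using Mh(2,3)[of "s / \<delta>"] \<delta>(1) by (auto simp: hd_def hd'_def abs_mult intro: divide_right_mono)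
  define k where "k s = hd' s * f s" for s
  have k_out: "k s = 0" if "\<bar>s\<bar> \<ge> \<delta>" for s using hd_out[OF that] by (simp add: k_def)
  have k_cont: "continuous_on UNIV k" unfolding k_def[abs_def] by (intro continuous_intros cont f)
  obtain K where K: "\<And>s. (K has_real_derivative k s) (at s)" "K (- \<delta>) = 0"
    using ex_antiderivative[OF k_cont, of "- \<delta>" 0] by blast
  have K_cont: "continuous_on UNIV K" using K(1) by (meson DERIV_isCont continuous_at_imp_continuous_on)
  have K_left: "K s = 0" if "s \<le> - \<delta>" for s
    using antiderivative_const[OF K(1), of "{..- \<delta>}" s "- \<delta>"] k_out that K(2) \<delta>(1) by auto
  have K_right: "K s = K \<delta>" if "s \<ge> \<delta>" for s
    using antiderivative_const[OF K(1), of "{\<delta>..}" s \<delta>] k_out that \<delta>(1) by auto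
  obtain BK where BK: "BK > 0" "\<And>s. \<bar>K s\<bar> \<le> BK"
  proof -
    have "\<exists>M>0. \<forall>s. \<bar>K s\<bar> \<le> M"
    proof (rule bounded_of_compact_support[OF K_cont, of \<delta> "\<bar>K \<delta>\<bar>"])
      fix s assume "\<bar>s\<bar> \<ge> \<delta>"
      then consider "s \<le> - \<delta>" | "s \<ge> \<delta>" by linarith
      then show "\<bar>K s\<bar> \<le> \<bar>K \<delta>\<bar>" using K_left[of s] K_right[of s] by cases auto
    qed
    then show thesis using that by (elim exE conjE) simp
  qed
  \<comment> \<open>\<open>W\<close> would vanish if the circle were the straight line
    \<open>t = 1\<close>. Its derivative is at most \<open>Mh / \<delta>\<^sup>2\<close> times the
    deviation \<open>\<omega> * \<delta>\<close> of the graph, on an interval of length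
    \<open>2 * \<delta>\<close>, so that \<delta> cancels.\<close>
  define W where "W s = hd s - K s" for s
  have W_bound: "\<bar>W s\<bar> \<le> 2 * Mh * \<omega>" if s: "- \<delta> \<le> s" "s \<le> \<delta>" for s
  proof -
    have D: "(W has_real_derivative hd' s * (1 - f s)) (at s)" for s
      unfolding W_def[abs_def] by (auto intro!: derivative_eq_intros hd K simp: k_def algebra_simps)
    have B: "\<bar>hd' s * (1 - f s)\<bar> \<le> Mh / \<delta>\<^sup>2 * (\<omega> * \<delta>)" if "- \<delta> \<le> s" "s \<le> \<delta>" for s
      unfolding abs_mult using hd_bound(2)[of s] f1[of s] that Mh(1)
      by (intro mult_mono) (auto simp: abs_minus_commute)
    have "\<bar>W s - W (- \<delta>)\<bar> \<le> Mh / \<delta>\<^sup>2 * (\<omega> * \<delta>) * (s - - \<delta>)"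
      by (rule antiderivative_bound[OF D B s])
    also have "\<dots> \<le> Mh / \<delta>\<^sup>2 * (\<omega> * \<delta>) * (2 * \<delta>)" using s Mh(1) \<omega>(1) \<delta>(1) by (intro mult_left_mono) auto
    also have "\<dots> = 2 * Mh * \<omega>" using \<delta>(1) by (simp add: power2_eq_square)
    finally show ?thesis using hd_out(1)[of "- \<delta>"] K(2) \<delta>(1) by (simp add: W_def)
  qed
  have Kd: "\<bar>K \<delta>\<bar> \<le> 2 * Mh * \<omega>" using W_bound[of \<delta>] hd_out(1)[of \<delta>] \<delta>(1) by (simp add: W_def)
  have hfK: "\<bar>hd s * f s - K s\<bar> \<le> 3 * Mh * \<omega>" if s: "- \<delta> \<le> s" "s \<le> \<delta>" for s
  proof -
    have "hd s * f s - K s = W s + hd s * (f s - 1)" by (simp add: W_def algebra_simps)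
    moreover have "\<bar>hd s * (f s - 1)\<bar> \<le> Mh / \<delta> * (\<omega> * \<delta>)"
      unfolding abs_mult using hd_bound(1)[of s] f1[of s] s Mh(1) \<delta>(1) by (intro mult_mono) auto
    moreover have "Mh / \<delta> * (\<omega> * \<delta>) = Mh * \<omega>" using \<delta>(1) by simp
    ultimately show ?thesis using W_bound[OF s] by linarith
  qed
  \<comment> \<open>\<open>T\<close> replaces \<open>t\<close>: it is the identity for
    \<open>\<bar>t\<bar> \<le> 3\<close> and constant beyond 4. The derivatives of \<open>P\<close>
    have to be bounded by a multiple of the truncated defect, whereas \<open>t\<close> is
    unbounded.\<close>
  define T' where "T' t = max 0 (min 1 (4 - \<bar>t\<bar>))" for t :: real
  have T'_cont: "continuous_on UNIV T'" unfolding T'_def[abs_def] by (intro continuous_intros)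
  obtain T where T: "\<And>t. (T has_real_derivative T' t) (at t)" "T 0 = 0"
    using ex_antiderivative[OF T'_cont, of 0 0] by blast
  have T_cont: "continuous_on UNIV T" using T(1) by (meson DERIV_isCont continuous_at_imp_continuous_on)
  have T_id: "T t = t" if "\<bar>t\<bar> \<le> 3" for t
  proof -
    have d: "((\<lambda>t. T t - t) has_real_derivative T' t - 1) (at t)" for t
      by (auto intro!: derivative_eq_intros T)
    have o: "T' t - 1 = 0" if "t \<in> {-3..3}" for t using that by (auto simp: T'_def)
    have "T t - t = T 0 - 0"
      by (rule antiderivative_const[where G = "\<lambda>t. T t - t" and S = "{-3..3}", OF d _ o]) (use that in auto)
    then show ?thesis using T(2) by simp
  qed
  have T_bound: "\<bar>T t\<bar> \<le> 4" for t
  proof -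
    have T4: "T t = T 4" if "t \<ge> 4" for t
      using antiderivative_const[OF T(1), of "{4..}" t 4] that by (auto simp: T'_def)
    have T4': "T t = T (- 4)" if "t \<le> - 4" for t
      using antiderivative_const[OF T(1), of "{..- 4}" t "- 4"] that by (auto simp: T'_def)
    have r: "\<bar>T t\<bar> \<le> 4" if "0 \<le> t" "t \<le> 4" for t
      using antiderivative_bound[OF T(1), of 0 4 1 t] that T(2) by (auto simp: T'_def)
    have l: "\<bar>T t\<bar> \<le> 4" if "- 4 \<le> t" "t \<le> 0" for t
    proof -
      have "\<bar>T 0 - T t\<bar> \<le> 1 * (0 - t)"
        by (rule antiderivative_bound[OF T(1)]) (use that in \<open>auto simp: T'_def\<close>)
      then show ?thesis using that T(2) by simp
    qed
    show ?thesis using T4[of t] T4'[of t] r[of t] l[of t] r[of 4] l[of "- 4"] by linarith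
  qed
  \<comment> \<open>The branches are exchanged for \<open>\<bar>t\<bar> \<le> 1 / 2\<close>; over
    \<open>\<bar>s\<bar> < \<delta>\<close> this means \<open>N \<le> 3 / 4\<close>, hence a defect
    of at least 1/4.\<close>
  define \<theta> \<theta>' where "\<theta> t = H (2 * t)" and "\<theta>' t = 2 * h (2 * t)" for t
  have \<theta>: "(\<theta> has_real_derivative \<theta>' t) (at t)" for t
  proof -
    have "((\<lambda>t. H (2 * t)) has_real_derivative h (2 * t) * 2) (at t)"
      by (rule DERIV_chain2[OF H_deriv]) (auto intro!: derivative_eq_intros)
    then show ?thesis by (simp add: \<theta>_def[abs_def] \<theta>'_def mult.commute)
  qed
  have \<theta>_cont: "continuous_on UNIV \<theta>" "continuous_on UNIV \<theta>'"
    unfolding \<theta>_def[abs_def] \<theta>'_def[abs_def]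
    by (auto intro!: continuous_intros continuous_on_compose2[OF continuous_H] continuous_on_compose2[OF continuous_h])
  have \<theta>1: "\<theta> t = 1" if "t \<ge> 1 / 2" for t using H_right[of "2 * t"] that by (simp add: \<theta>_def)
  have \<theta>0: "\<theta> t = 0" if "t \<le> - (1 / 2)" for t using H_left[of "2 * t"] that by (simp add: \<theta>_def)
  have \<theta>_range: "0 \<le> \<theta> t" "\<theta> t \<le> 1" for t using H_range by (auto simp: \<theta>_def)
  have \<theta>'_out: "\<theta>' t = 0" if "\<bar>t\<bar> \<ge> 1 / 2" for t using h_outside(1)[of "2 * t"] that by (simp add: \<theta>'_def)
  have \<theta>'_bound: "\<bar>\<theta>' t\<bar> \<le> 2 * Mh" for t using Mh(2)[of "2 * t"] by (simp add: \<theta>'_def)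
  \<comment> \<open>The constant \<open>K \<delta>\<close> in the lower branch makes both branches
    agree for \<open>\<bar>s\<bar> \<ge> \<delta>\<close>, where one of \<open>K s\<close>,
    \<open>K (- s)\<close> is 0 and the other is \<open>K \<delta>\<close>. So \<theta> contributes
    no derivative there.\<close>
  define P where "P s t = hd s * T t - \<theta> t * K s - (1 - \<theta> t) * (K \<delta> - K (- s))" for s t
  define Ps where "Ps s t = hd' s * T t - \<theta> t * k s - (1 - \<theta> t) * k (- s)" for s t
  define Pt where "Pt s t = hd s * T' t - \<theta>' t * K s + \<theta>' t * (K \<delta> - K (- s))" for s t
  \<comment> \<open>32 and 24 come from the bounds \<open>8\<close> for \<open>Q\<close> and
    \<open>6 * Mh * BK\<close> for the term with \<open>\<theta>'\<close>, multiplied by 4 since the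
    defect is at least 1/4 where the branches are glued. \<open>Mh / \<delta>\<close> pays for the
    truncation \<open>T'\<close> beyond 3, where the defect is 1.\<close>
  define C where "C = 32 * (Mh / \<delta>\<^sup>2) + Mh / \<delta> + 24 * Mh * BK"
  have C: "C \<ge> 32 * (Mh / \<delta>\<^sup>2)" "C \<ge> Mh / \<delta> + 24 * Mh * BK" "C \<ge> 0" "Mh / \<delta> \<ge> 0" "24 * Mh * BK \<ge> 0"
    using Mh(1) \<delta>(1) BK(1) by (auto simp: C_def)
  have K_neg: "((\<lambda>s. K (- s)) has_real_derivative - k (- s)) (at s)" for s
  proof -
    have "((\<lambda>s. K (- s)) has_real_derivative k (- s) * - 1) (at s)"
      by (rule DERIV_chain2[OF K(1)]) (auto intro!: derivative_eq_intros)
    then show ?thesis by simp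
  qed
  have D: "((\<lambda>(s, t). P s t) has_derivative (\<lambda>(a, b). Ps (fst p) (snd p) * a + Pt (fst p) (snd p) * b)) (at p)" for p
  proof -
    have c1: "((\<lambda>p. g (fst p)) has_derivative (\<lambda>w. g' * fst w)) (at p)"
      if "(g has_real_derivative g') (at (fst p))" for g g'
      by (rule has_derivative_compose_real[where f = fst, OF that]) (auto intro!: derivative_eq_intros)
    have c2: "((\<lambda>p. g (snd p)) has_derivative (\<lambda>w. g' * snd w)) (at p)"
      if "(g has_real_derivative g') (at (snd p))" for g g'
      by (rule has_derivative_compose_real[where f = snd, OF that]) (auto intro!: derivative_eq_intros)
    have "((\<lambda>p. P (fst p) (snd p)) has_derivative (\<lambda>w. Ps (fst p) (snd p) * fst w + Pt (fst p) (snd p) * snd w)) (at p)"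
      unfolding P_def Ps_def Pt_def
      by (rule derivative_eq_intros c1[OF hd] c1[OF K(1)] c1[OF K_neg] c2[OF T(1)] c2[OF \<theta>] refl)+
        (simp add: algebra_simps)
    then show ?thesis by (simp add: case_prod_unfold)
  qed
  have cPs: "continuous_on UNIV (\<lambda>p. Ps (fst p) (snd p))" and cPt: "continuous_on UNIV (\<lambda>p. Pt (fst p) (snd p))"
    unfolding Ps_def Pt_def
    by (intro continuous_intros continuous_on_compose2[OF cont(1)] continuous_on_compose2[OF cont(2)]
        continuous_on_compose2[OF T_cont] continuous_on_compose2[OF T'_cont] continuous_on_compose2[OF \<theta>_cont(1)]
        continuous_on_compose2[OF \<theta>_cont(2)] continuous_on_compose2[OF k_cont] continuous_on_compose2[OF K_cont]; simp)+
  have sm: "\<bar>s\<bar> * N \<xi> \<le> 1 / 4" if "\<bar>s\<bar> < \<delta>" for s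
    using mult_right_mono[of "\<bar>s\<bar>" \<delta> "N \<xi>"] dN that by simp
  have neg: "N ((- s) *\<^sub>R \<xi> + (- t) *\<^sub>R z) = N (s *\<^sub>R \<xi> + t *\<^sub>R z)" for s t
    using N_minus[of "s *\<^sub>R \<xi> + t *\<^sub>R z"] by (simp add: algebra_simps)
  have mid: "1 / 4 \<le> defect (s *\<^sub>R \<xi> + t *\<^sub>R z)" if "\<bar>s\<bar> < \<delta>" "\<bar>t\<bar> \<le> 1 / 2" for s t
    using N_graph_bounds[OF z(1) sm[OF that(1)], of t] that(2) unfolding defect_def by linarith
  have far: "defect (s *\<^sub>R \<xi> + t *\<^sub>R z) = 1" if "\<bar>s\<bar> < \<delta>" "\<bar>t\<bar> > 3" for s t
    using N_graph_bounds[OF z(1) sm[OF that(1)], of t] that(2) unfolding defect_def by linarith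
  have Ps_bound: "\<bar>Ps s t\<bar> \<le> C * defect (s *\<^sub>R \<xi> + t *\<^sub>R z)" for s t
  proof (cases "\<bar>s\<bar> \<ge> \<delta>")
    case True
    then show ?thesis using hd_out(2)[of s] k_out[of s] k_out[of "- s"] C(3) defect_bounds by (simp add: Ps_def)
  next
    case False
    then have s: "\<bar>s\<bar> < \<delta>" by simp
    \<comment> \<open>The deviation from the circle: for
      \<open>1 / 2 < \<bar>t\<bar> \<le> 3\<close> it is \<open>t - f s\<close> on the upper branch
      and \<open>t + f (- s)\<close> on the lower one.\<close>
    define Q where "Q = T t - \<theta> t * f s + (1 - \<theta> t) * f (- s)"
    have Ps: "Ps s t = hd' s * Q" by (simp add: Ps_def Q_def k_def hd_sym algebra_simps)
    have "\<theta> t * f s \<le> 1 * (5 / 4)" "(1 - \<theta> t) * f (- s) \<le> 1 * (5 / 4)"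
      using \<theta>_range[of t] f(2)[of s] f(3)[of s] f(2)[of "- s"] f(3)[of "- s"] by (intro mult_mono; simp)+
    moreover have "0 \<le> \<theta> t * f s" "0 \<le> (1 - \<theta> t) * f (- s)"
      using \<theta>_range[of t] f(2)[of s] f(2)[of "- s"] by (intro mult_nonneg_nonneg; simp)+
    ultimately have Q8: "\<bar>Q\<bar> \<le> 8" using T_bound[of t] unfolding Q_def by linarith
    have "\<bar>Q\<bar> \<le> 32 * defect (s *\<^sub>R \<xi> + t *\<^sub>R z)"
    proof -
      consider "\<bar>t\<bar> \<le> 1 / 2" | "\<bar>t\<bar> > 3" | "1 / 2 < t" "t \<le> 3" | "t < - (1 / 2)" "- 3 \<le> t" by linarith
      then show ?thesis
      proof cases
        case 1 then show ?thesis using mid[OF s 1] Q8 by linarith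
      next
        case 2 then show ?thesis using far[OF s 2] Q8 by simp
      next
        case 3
        then have "Q = t - f s" using T_id[of t] \<theta>1[of t] by (simp add: Q_def)
        moreover have "\<bar>t - f s\<bar> \<le> 2 * \<bar>1 - N (s *\<^sub>R \<xi> + t *\<^sub>R z)\<bar>" using f(4)[of s t] s 3 by simp
        ultimately show ?thesis using Q8 unfolding defect_def by linarith
      next
        case 4
        then have "Q = - ((- t) - f (- s))" using T_id[of t] \<theta>0[of t] by (simp add: Q_def)
        moreover have "\<bar>(- t) - f (- s)\<bar> \<le> 2 * \<bar>1 - N (s *\<^sub>R \<xi> + t *\<^sub>R z)\<bar>"
          using f(4)[of "- s" "- t"] s 4 unfolding neg by simp
        ultimately show ?thesis using Q8 unfolding defect_def by linarith
      qed
    qed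
    then have "\<bar>Ps s t\<bar> \<le> Mh / \<delta>\<^sup>2 * (32 * defect (s *\<^sub>R \<xi> + t *\<^sub>R z))"
      unfolding Ps abs_mult using hd_bound(2)[of s] Mh(1) by (intro mult_mono) auto
    also have "\<dots> \<le> C * defect (s *\<^sub>R \<xi> + t *\<^sub>R z)"
      using mult_right_mono[OF C(1) defect_bounds(1), of "s *\<^sub>R \<xi> + t *\<^sub>R z"] by (simp add: mult.commute mult.left_commute)
    finally show ?thesis .
  qed
  have Pt_bound: "\<bar>Pt s t - hd s\<bar> \<le> C * defect (s *\<^sub>R \<xi> + t *\<^sub>R z)" for s t
  proof (cases "\<bar>s\<bar> \<ge> \<delta>")
    case True
    then have "K s = K \<delta> - K (- s)"
      using K_left[of s] K_right[of "- s"] K_right[of s] K_left[of "- s"] by (cases "s \<ge> 0") auto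
    then show ?thesis using hd_out(1)[of s] True C(3) defect_bounds by (simp add: Pt_def)
  next
    case False
    then have s: "\<bar>s\<bar> < \<delta>" by simp
    let ?E = "defect (s *\<^sub>R \<xi> + t *\<^sub>R z)"
    have a: "\<bar>hd s * (T' t - 1)\<bar> \<le> Mh / \<delta> * ?E"
    proof (cases "\<bar>t\<bar> > 3")
      case True
      have "\<bar>hd s\<bar> * \<bar>T' t - 1\<bar> \<le> Mh / \<delta> * 1"
        using hd_bound(1)[of s] C(4) by (intro mult_mono) (auto simp: T'_def)
      then show ?thesis using far[OF s True] by (simp add: abs_mult)
    next
      case False
      then have "T' t = 1" by (auto simp: T'_def)
      then show ?thesis using mult_nonneg_nonneg[OF C(4) defect_bounds(1)] by simp
    qed
    have b: "\<bar>\<theta>' t * (K s - (K \<delta> - K (- s)))\<bar> \<le> 24 * Mh * BK * ?E"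
    proof (cases "\<bar>t\<bar> \<ge> 1 / 2")
      case True
      then show ?thesis using \<theta>'_out[of t] mult_nonneg_nonneg[OF C(5) defect_bounds(1)] by simp
    next
      case False
      have "\<bar>K s - (K \<delta> - K (- s))\<bar> \<le> 3 * BK" using BK(2)[of s] BK(2)[of \<delta>] BK(2)[of "- s"] by linarith
      then have "\<bar>\<theta>' t\<bar> * \<bar>K s - (K \<delta> - K (- s))\<bar> \<le> (2 * Mh) * (3 * BK)"
        using \<theta>'_bound[of t] Mh(1) by (intro mult_mono) auto
      also have "\<dots> = 24 * Mh * BK * (1 / 4)" by simp
      also have "\<dots> \<le> 24 * Mh * BK * ?E" using mid[OF s, of t] False C(5) by (intro mult_left_mono) auto
      finally show ?thesis by (simp add: abs_mult)
    qed
    have "Pt s t - hd s = hd s * (T' t - 1) - \<theta>' t * (K s - (K \<delta> - K (- s)))"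
      by (simp add: Pt_def algebra_simps)
    then have "\<bar>Pt s t - hd s\<bar> \<le> (Mh / \<delta> + 24 * Mh * BK) * ?E" using a b by (simp add: distrib_right)
    also have "\<dots> \<le> C * ?E" using C(2) defect_bounds by (intro mult_right_mono) auto
    finally show ?thesis .
  qed
  have P_small: "\<bar>P s t\<bar> \<le> \<eta>" if n: "N (s *\<^sub>R \<xi> + t *\<^sub>R z) = 1" for s t
  proof -
    have Mw: "0 \<le> Mh * \<omega>" using Mh(1) \<omega>(1) by simp
    consider "s \<le> - \<delta>" | "s \<ge> \<delta>" | "\<bar>s\<bar> < \<delta>" by linarith
    then show ?thesis
    proof cases
      case 1
      then have "P s t = 0"
        using hd_out(1)[of s] K_left[of s] K_right[of "- s"] \<delta>(1) by (simp add: P_def)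
      then show ?thesis using \<eta> by simp
    next
      case 2
      then have "P s t = - K \<delta>"
        using hd_out(1)[of s] K_right[of s] K_left[of "- s"] \<delta>(1) by (simp add: P_def algebra_simps)
      then show ?thesis using Kd \<omega>(2) Mw by (simp add: algebra_simps)
    next
      case 3
      have nb: "\<bar>1 - \<bar>t\<bar>\<bar> \<le> 1 / 4" using N_graph_bounds[OF z(1) sm[OF 3], of t] n by simp
      show ?thesis
      proof (cases "t \<ge> 0")
        case True
        then have t: "3 / 4 \<le> t" "t \<le> 5 / 4" using nb by linarith+
        have "t = f s" using f(4)[of s t] 3 True n by simp
        then have "P s t = hd s * f s - K s" using T_id[of t] \<theta>1[of t] t by (simp add: P_def)
        moreover have "- \<delta> \<le> s" "s \<le> \<delta>" using 3 by linarith+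
        ultimately show ?thesis using hfK[of s] \<omega>(2) Mw by linarith
      next
        case False
        then have t: "t \<le> - (3 / 4)" "- (5 / 4) \<le> t" using nb by linarith+
        have "f (- s) = - t" using f(4)[of "- s" "- t"] 3 False n unfolding neg by simp
        then have "P s t = - (hd (- s) * f (- s) - K (- s)) - K \<delta>"
          using T_id[of t] \<theta>0[of t] t by (simp add: P_def hd_sym algebra_simps)
        moreover have "- \<delta> \<le> - s" "- s \<le> \<delta>" using 3 by linarith+
        ultimately show ?thesis using hfK[of "- s"] Kd \<omega>(2) Mw by linarith
      qed
    qed
  qed
  show ?thesis
    using \<delta>(1,2) C(3) D cPs cPt Ps_bound Pt_bound P_small unfolding hd_def by blast
qed

end

section \<open>The kinetic equation\<close>

text \<open>The divergence written in the skew basis \<open>\<i> * \<nu>\<close>, \<open>z\<close>: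
  its dual basis is \<open>\<i> * z\<close>, \<open>\<nu>\<close> when
  \<open>\<nu> \<bullet> z = 1\<close>, and \<open>a\<close>, \<open>b\<close> are the two partial
  derivatives of the field.\<close>

lemma div_identity:
  "(\<i> * z) \<bullet> (Re (\<i> * \<nu>) *\<^sub>R a + Im (\<i> * \<nu>) *\<^sub>R b) + \<nu> \<bullet> (Re z *\<^sub>R a + Im z *\<^sub>R b) = (\<nu> \<bullet> z) * (Re a + Im b)"
  by (simp add: inner_complex_def algebra_simps)

lemma set_integrable_continuous_compact:
  fixes f :: "complex \<Rightarrow> real"
  assumes "compact K" "continuous_on UNIV f"
  shows "set_integrable lborel K f"
  unfolding set_integrable_def
  using assms(1) by (rule borel_integrable_compact) (rule continuous_on_subset[OF assms(2) subset_UNIV])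

lemma set_integral_mono_AE:
  fixes f g :: "complex \<Rightarrow> real"
  assumes "set_integrable lborel K f" "set_integrable lborel K g"
    and "AE x in lborel. x \<in> K \<longrightarrow> f x \<le> g x"
  shows "(\<integral>x\<in>K. f x \<partial>lborel) \<le> (\<integral>x\<in>K. g x \<partial>lborel)"
  unfolding set_lebesgue_integral_def
  using assms unfolding set_integrable_def
  by (intro integral_mono_AE) (auto simp: indicator_def elim!: eventually_mono)

lemma set_integral_compact_const:
  assumes "compact K"
  shows "set_integrable lborel K (\<lambda>x::complex. c::real)" "(\<integral>x\<in>K. c \<partial>lborel) = c * measure lborel K"
proof -
  show "set_integrable lborel K (\<lambda>x::complex. c)"
    using assms by (intro set_integrable_continuous_compact) auto
  have "emeasure lborel K < \<infinity>" using assms by (intro emeasure_compact_finite)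
  then show "(\<integral>x\<in>K. c \<partial>lborel) = c * measure lborel K"
    using borel_compact[OF assms] by (simp add: set_lebesgue_integral_def mult.commute)
qed

context plane_norm
begin

text \<open>Exactly what the entropy computation extracts from the sequence: C^1 fields,
  divergence-free on the given compact set, close to \<open>m\<close> in L1. The energy enters only
  through the product of gradient and defect.\<close>

definition approximable :: "complex set \<Rightarrow> (complex \<Rightarrow> complex) \<Rightarrow> bool" where
  "approximable \<Omega> m \<longleftrightarrow> (\<forall>K e. compact K \<and> K \<subseteq> \<Omega> \<and> (0::real) < e \<longrightarrow>
     (\<exists>u u1 u2. (\<forall>x. (u has_derivative (\<lambda>w. Re w *\<^sub>R u1 x + Im w *\<^sub>R u2 x)) (at x)) \<and>
       continuous_on UNIV u1 \<and> continuous_on UNIV u2 \<and> (\<forall>x\<in>K. Re (u1 x) + Im (u2 x) = 0) \<and>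
       (\<integral>x\<in>K. norm (u x - m x) \<partial>lborel) < e \<and>
       (\<integral>x\<in>K. (norm (u1 x) + norm (u2 x)) * defect (u x) \<partial>lborel) < e))"

end

context norm_step
begin

text \<open>For divergence-free \<open>u\<close> the entropy field built from \<open>u\<close> has divergence bounded by
  \<open>defect u * \<bar>\<nabla>u\<bar>\<close>, which is small by \<open>approximable\<close>; its \<open>z\<close>-component is at most \<open>\<eta>\<close> on the circle.\<close>

lemma kinetic_weak:
  assumes app: "approximable \<Omega> m" and m: "integrable lborel m"
    and Nm: "AE x in lborel. x \<in> \<Omega> \<longrightarrow> N (m x) = 1"
    and z: "N z = 1" "(N has_derivative (\<lambda>w. \<nu> \<bullet> w)) (at z)" "\<nu> \<bullet> z = 1"
    and K: "compact K" "K \<subseteq> \<Omega>" "\<And>x t. x \<in> cball q r \<Longrightarrow> 0 \<le> t \<Longrightarrow> t \<le> l \<Longrightarrow> x + t *\<^sub>R (\<i> * \<nu>) \<in> K" and l: "l \<ge> 0"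
    and \<eta>: "\<eta> > 0"
  shows "\<exists>\<delta>. 0 < \<delta> \<and> \<delta> < \<eta> \<and> (\<forall>\<psi> \<psi>d M. C1_along z \<psi> \<psi>d \<and> (\<forall>x. x \<notin> cball q r \<longrightarrow> \<psi> x = 0 \<and> \<psi>d x = 0) \<and>
      (\<forall>x. \<bar>\<psi> x\<bar> \<le> M \<and> \<bar>\<psi>d x\<bar> \<le> M) \<longrightarrow>
     \<bar>\<integral>x. (H ((\<i> * z) \<bullet> m (x + l *\<^sub>R (\<i> * \<nu>)) / \<delta>) - H ((\<i> * z) \<bullet> m x / \<delta>)) * \<psi> x \<partial>lborel\<bar>
       \<le> l * M * (\<eta> * measure lborel K))"
proof -
  let ?\<xi> = "\<i> * \<nu>"
  have [measurable]: "m \<in> borel_measurable borel" using m by auto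
  obtain \<delta> P Ps Pt C where \<delta>: "0 < \<delta>" "\<delta> < \<eta>" and C: "0 \<le> C"
    and DP: "\<And>p. ((\<lambda>(s, t). P s t) has_derivative (\<lambda>(a, b). Ps (fst p) (snd p) * a + Pt (fst p) (snd p) * b)) (at p)"
    and cP: "continuous_on UNIV (\<lambda>p. Ps (fst p) (snd p))" "continuous_on UNIV (\<lambda>p. Pt (fst p) (snd p))"
    and Ps: "\<And>s t. \<bar>Ps s t\<bar> \<le> C * defect (s *\<^sub>R ?\<xi> + t *\<^sub>R z)"
    and Pt: "\<And>s t. \<bar>Pt s t - h (s / \<delta>) / \<delta>\<bar> \<le> C * defect (s *\<^sub>R ?\<xi> + t *\<^sub>R z)"
    and Psm: "\<And>s t. N (s *\<^sub>R ?\<xi> + t *\<^sub>R z) = 1 \<Longrightarrow> \<bar>P s t\<bar> \<le> \<eta>"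
    using ex_entropy_coords[OF z(1,2) \<eta>] by blast
  define s t where "s v = (\<i> * z) \<bullet> v" and "t v = \<nu> \<bullet> v" for v
  have coord: "s v *\<^sub>R ?\<xi> + t v *\<^sub>R z = v" for v using coordinates[OF z(3), of v] by (simp add: s_def t_def)
  define L where "L = norm z + norm \<nu>"
  have L: "L \<ge> 0" by (simp add: L_def)
  have sb: "\<bar>s v\<bar> \<le> L * norm v" "\<bar>t v\<bar> \<le> L * norm v" for v
  proof -
    have "\<bar>s v\<bar> \<le> norm z * norm v" "\<bar>t v\<bar> \<le> norm \<nu> * norm v"
      using Cauchy_Schwarz_ineq2[of "\<i> * z" v] Cauchy_Schwarz_ineq2[of \<nu> v] by (auto simp: s_def t_def norm_mult)
    then show "\<bar>s v\<bar> \<le> L * norm v" "\<bar>t v\<bar> \<le> L * norm v" by (auto simp: L_def distrib_right add_increasing add_increasing2)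
  qed
  have slin: "s (a - b) = s a - s b" "t (a - b) = t a - t b" for a b by (auto simp: s_def t_def inner_diff_right)
  define Q where "Q v = P (s v) (t v)" for v
  define A B where "A v = Ps (s v) (t v)" and "B v = Pt (s v) (t v)" for v
  have AC: "\<bar>A v\<bar> \<le> C * defect v" "\<bar>B v - h (s v / \<delta>) / \<delta>\<bar> \<le> C * defect v" for v
    using Ps[of "s v" "t v"] Pt[of "s v" "t v"] by (auto simp: A_def B_def coord)
  have DQ: "(Q has_derivative (\<lambda>w. A v * s w + B v * t w)) (at v)" for v
  proof -
    have "((\<lambda>v. (s v, t v)) has_derivative (\<lambda>w. (s w, t w))) (at v)"
      unfolding s_def t_def by (auto intro!: derivative_eq_intros)
    from has_derivative_compose[OF this DP] show ?thesis
      by (simp add: Q_def[abs_def] A_def B_def)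
  qed
  have cAB: "continuous_on UNIV A" "continuous_on UNIV B"
  proof -
    have c: "continuous_on UNIV (\<lambda>v. (s v, t v))"
      unfolding s_def t_def by (intro continuous_intros)
    show "continuous_on UNIV A" "continuous_on UNIV B"
      using continuous_on_compose2[OF cP(1) c] continuous_on_compose2[OF cP(2) c]
      by (simp_all add: A_def[abs_def] B_def[abs_def])
  qed
  have Qsmall: "\<bar>Q v\<bar> \<le> \<eta>" if "N v = 1" for v using Psm[of "s v" "t v"] that by (simp add: Q_def coord)
  define LQ where "LQ = (2 * C + Mh / \<delta>) * L"
  have MC: "0 \<le> Mh / \<delta>" using Mh(1) \<delta>(1) by simp
  have LQ: "\<bar>Q v - Q w\<bar> \<le> LQ * norm (v - w)" for v w
  proof -
    have "norm (Q v - Q w) \<le> LQ * norm (v - w)"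
    proof (rule differentiable_bound[of UNIV])
      fix v
      show "onorm (\<lambda>w. A v * s w + B v * t w) \<le> LQ"
      proof (rule onorm_bound)
        fix w
        have d: "C * defect v \<le> C" using C defect_bounds by (simp add: mult_left_le)
        have "\<bar>h (s v / \<delta>) / \<delta>\<bar> \<le> Mh / \<delta>" using Mh(2) \<delta>(1) by (simp add: divide_right_mono)
        then have "\<bar>A v\<bar> \<le> C" "\<bar>B v\<bar> \<le> C + Mh / \<delta>" using AC[of v] d by linarith+
        then have "\<bar>A v * s w\<bar> \<le> C * (L * norm w)" "\<bar>B v * t w\<bar> \<le> (C + Mh / \<delta>) * (L * norm w)"
          unfolding abs_mult using sb[of w] C MC by (intro mult_mono; simp)+
        then show "norm (A v * s w + B v * t w) \<le> LQ * norm w" by (simp add: LQ_def algebra_simps)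
      qed (use C MC L in \<open>simp add: LQ_def\<close>)
    qed (use DQ in auto)
    then show ?thesis by simp
  qed
  define S where "S v = H (s v / \<delta>)" for v
  have DS: "(S has_derivative (\<lambda>w. h (s v / \<delta>) * (s w / \<delta>))) (at v)" for v
    unfolding S_def[abs_def]
    by (rule has_derivative_compose_real[OF H_deriv]) (use \<delta>(1) in \<open>auto simp: s_def intro!: derivative_eq_intros\<close>)
  define LS where "LS = Mh / \<delta> * L"
  have LS: "\<bar>S v - S w\<bar> \<le> LS * norm (v - w)" for v w
  proof -
    have "norm (S v - S w) \<le> LS * norm (v - w)"
    proof (rule differentiable_bound[of UNIV])
      fix v
      show "onorm (\<lambda>w. h (s v / \<delta>) * (s w / \<delta>)) \<le> LS"
      proof (rule onorm_bound)
        fix w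
        have "\<bar>h (s v / \<delta>)\<bar> * (\<bar>s w\<bar> / \<delta>) \<le> Mh * (L * norm w / \<delta>)"
          using Mh(1,2) sb[of w] \<delta>(1) by (intro mult_mono divide_right_mono) auto
        then show "norm (h (s v / \<delta>) * (s w / \<delta>)) \<le> LS * norm w"
          using \<delta>(1) by (simp add: LS_def abs_mult algebra_simps)
      qed (use mult_nonneg_nonneg[OF MC L] in \<open>simp add: LS_def\<close>)
    qed (use DS in auto)
    then show ?thesis by simp
  qed
  have S_meas [measurable]: "S \<in> borel_measurable borel"
    using DS by (intro borel_measurable_continuous_onI continuous_at_imp_continuous_on ballI has_derivative_continuous)
  have Sm_bound: "\<bar>S v\<bar> \<le> 1" for v using H_range[of "s v / \<delta>"] by (simp add: S_def)
  have main: "\<bar>\<integral>x. (S (m (x + l *\<^sub>R ?\<xi>)) - S (m x)) * \<psi> x \<partial>lborel\<bar> \<le> l * M * (\<eta> * measure lborel K)"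
    if \<psi>: "C1_along z \<psi> \<psi>d" "\<And>x. x \<notin> cball q r \<Longrightarrow> \<psi> x = 0" "\<And>x. x \<notin> cball q r \<Longrightarrow> \<psi>d x = 0"
      "\<And>x. \<bar>\<psi> x\<bar> \<le> M" "\<And>x. \<bar>\<psi>d x\<bar> \<le> M" for \<psi> \<psi>d M
  proof (rule field_le_epsilon)
    have M0: "0 \<le> M" using \<psi>(4)[of 0] by linarith
    \<comment> \<open>Collects the coefficients of \<open>e\<close> in three errors: the divergence
      of the entropy field, the change from \<open>u\<close> to \<open>m\<close> in its component
      along \<open>z\<close>, and the same change inside the step. The final 1 keeps it
      positive.\<close>
    define CC where "CC = l * M * (2 * C * L * norm z + LQ) + 2 * M * LS + 1"
    have LQ0: "0 \<le> LQ" and LS0: "0 \<le> LS"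
      unfolding LQ_def LS_def using C MC L by (intro mult_nonneg_nonneg add_nonneg_nonneg; simp)+
    have "0 \<le> l * M * (2 * C * L * norm z + LQ)" "0 \<le> 2 * M * LS"
      using l M0 C L LQ0 LS0 by simp_all
    then have CC: "CC > 0" unfolding CC_def by linarith
    fix e0 :: real assume e0: "e0 > 0"
    define e where "e = e0 / CC"
    have e: "e > 0" using e0 CC by (simp add: e_def)
    obtain u u1 u2 where Du: "\<And>x. (u has_derivative (\<lambda>w. Re w *\<^sub>R u1 x + Im w *\<^sub>R u2 x)) (at x)"
      and cu: "continuous_on UNIV u1" "continuous_on UNIV u2"
      and div: "\<And>x. x \<in> K \<Longrightarrow> Re (u1 x) + Im (u2 x) = 0"
      and um: "(\<integral>x\<in>K. norm (u x - m x) \<partial>lborel) < e"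
      and ue: "(\<integral>x\<in>K. (norm (u1 x) + norm (u2 x)) * defect (u x) \<partial>lborel) < e"
      using app[unfolded approximable_def, rule_format, OF conjI[OF K(1) conjI[OF K(2) e]]]
      by (elim exE conjE, intro that, simp_all)
    have u_cont: "continuous_on UNIV u"
      using Du by (intro continuous_at_imp_continuous_on ballI has_derivative_continuous)
    have [measurable]: "u \<in> borel_measurable borel" using u_cont by (rule borel_measurable_continuous_onI)
    define Dd where "Dd w x = Re w *\<^sub>R u1 x + Im w *\<^sub>R u2 x" for w x
    have Dd_cont: "continuous_on UNIV (Dd w)" for w unfolding Dd_def[abs_def] by (intro continuous_intros cu)
    have st_cont: "continuous_on UNIV s" "continuous_on UNIV t"
      unfolding s_def[abs_def] t_def[abs_def] by (intro continuous_intros)+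
    define F Fd where "F x = S (u x)" and "Fd x = h (s (u x) / \<delta>) * (s (Dd ?\<xi> x) / \<delta>)" for x
    define G Gd where "G x = Q (u x)" and "Gd x = A (u x) * s (Dd z x) + B (u x) * t (Dd z x)" for x
    have hu_cont: "continuous_on UNIV (\<lambda>x. h (s (u x) / \<delta>))"
      using \<delta>(1) by (intro continuous_on_compose2[OF continuous_h] continuous_intros continuous_on_compose2[OF st_cont(1) u_cont]) auto
    have F1: "C1_along ?\<xi> F Fd"
    proof (rule C1_alongI[where f' = "\<lambda>x w. h (s (u x) / \<delta>) * (s (Dd w x) / \<delta>)"])
      show "(F has_derivative (\<lambda>w. h (s (u x) / \<delta>) * (s (Dd w x) / \<delta>))) (at x)" for x
        unfolding F_def[abs_def] Dd_def by (rule has_derivative_compose[OF Du DS])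
      show "continuous_on UNIV Fd"
        unfolding Fd_def[abs_def] using \<delta>(1)
        by (intro continuous_intros hu_cont continuous_on_compose2[OF st_cont(1) Dd_cont]) auto
    qed (simp add: Fd_def)
    have G1: "C1_along z G Gd"
    proof (rule C1_alongI[where f' = "\<lambda>x w. A (u x) * s (Dd w x) + B (u x) * t (Dd w x)"])
      show "(G has_derivative (\<lambda>w. A (u x) * s (Dd w x) + B (u x) * t (Dd w x))) (at x)" for x
        unfolding G_def[abs_def] Dd_def by (rule has_derivative_compose[OF Du DQ])
      show "continuous_on UNIV Gd"
        unfolding Gd_def[abs_def]
        by (intro continuous_intros continuous_on_compose2[OF cAB(1) u_cont] continuous_on_compose2[OF cAB(2) u_cont]
            continuous_on_compose2[OF st_cont(1) Dd_cont] continuous_on_compose2[OF st_cont(2) Dd_cont]) auto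
    qed (simp add: Gd_def)
    have "\<bar>\<integral>x. (F (x + l *\<^sub>R ?\<xi>) - F x) * \<psi> x \<partial>lborel\<bar>
      \<le> l * M * ((\<integral>x\<in>K. \<bar>Fd x + Gd x\<bar> \<partial>lborel) + (\<integral>x\<in>K. \<bar>G x\<bar> \<partial>lborel))"
      by (rule transport_estimate[OF F1 G1 \<psi>(1) \<psi>(2) \<psi>(3) \<psi>(4) \<psi>(5) K(1) K(3) l])
    moreover have "(\<integral>x\<in>K. \<bar>Fd x + Gd x\<bar> \<partial>lborel) \<le> 2 * C * L * norm z * e"
    proof -
      have pt: "\<bar>Fd x + Gd x\<bar> \<le> 2 * C * L * norm z * ((norm (u1 x) + norm (u2 x)) * defect (u x))" if x: "x \<in> K" for x
      proof -
        \<comment> \<open>Vanishing divergence in skew coordinates. It cancels the common diagonal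
          part of the Jacobian of the entropy; what remains are the entries bounded by the
          defect.\<close>
        have "s (Dd ?\<xi> x) = - t (Dd z x)"
          using div_identity[of z \<nu> "u1 x" "u2 x"] div[OF x] by (simp add: s_def t_def Dd_def)
        then have eq: "Fd x + Gd x = A (u x) * s (Dd z x) + (B (u x) - h (s (u x) / \<delta>) / \<delta>) * t (Dd z x)"
          by (simp add: Fd_def Gd_def algebra_simps)
        have "norm (Dd z x) \<le> \<bar>Re z\<bar> * norm (u1 x) + \<bar>Im z\<bar> * norm (u2 x)"
          unfolding Dd_def using norm_triangle_ineq[of "Re z *\<^sub>R u1 x" "Im z *\<^sub>R u2 x"] by simp
        also have "\<dots> \<le> norm z * norm (u1 x) + norm z * norm (u2 x)"
          by (intro add_mono mult_right_mono abs_Re_le_cmod abs_Im_le_cmod) auto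
        finally have nD: "norm (Dd z x) \<le> norm z * (norm (u1 x) + norm (u2 x))" by (simp add: distrib_left)
        have Cd: "0 \<le> C * defect (u x)" using C defect_bounds by simp
        have "\<bar>A (u x) * s (Dd z x)\<bar> \<le> (C * defect (u x)) * (L * norm (Dd z x))"
          "\<bar>(B (u x) - h (s (u x) / \<delta>) / \<delta>) * t (Dd z x)\<bar> \<le> (C * defect (u x)) * (L * norm (Dd z x))"
          unfolding abs_mult using AC[of "u x"] sb[of "Dd z x"] Cd by (intro mult_mono; simp)+
        then have "\<bar>Fd x + Gd x\<bar> \<le> 2 * (C * defect (u x) * (L * norm (Dd z x)))" unfolding eq by linarith
        also have "\<dots> \<le> 2 * (C * defect (u x) * (L * (norm z * (norm (u1 x) + norm (u2 x)))))"
          using nD L Cd by (intro mult_left_mono) auto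
        finally show ?thesis by (simp add: algebra_simps)
      qed
      have "(\<integral>x\<in>K. \<bar>Fd x + Gd x\<bar> \<partial>lborel) \<le> (\<integral>x\<in>K. 2 * C * L * norm z * ((norm (u1 x) + norm (u2 x)) * defect (u x)) \<partial>lborel)"
        using C1_alongD(2)[OF F1] C1_alongD(2)[OF G1] pt
        by (intro set_integral_mono_AE set_integrable_continuous_compact K(1) continuous_intros cu
            continuous_on_compose2[OF continuous_defect[of UNIV] u_cont]) auto
      also have "\<dots> = 2 * C * L * norm z * (\<integral>x\<in>K. (norm (u1 x) + norm (u2 x)) * defect (u x) \<partial>lborel)"
        by (rule set_integral_mult_right)
      also have "\<dots> \<le> 2 * C * L * norm z * e" using ue C L by (intro mult_left_mono) auto
      finally show ?thesis .
    qed
    moreover have iu: "set_integrable lborel K (\<lambda>x. norm (u x - m x))"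
    proof -
      have "integrable lborel (\<lambda>x. indicator K x *\<^sub>R u x - indicator K x *\<^sub>R m x)"
        using m borel_compact[OF K(1)]
        by (intro Bochner_Integration.integrable_diff borel_integrable_compact[OF K(1)]
            integrable_mult_indicator continuous_on_subset[OF u_cont]) auto
      from integrable_norm[OF this] show ?thesis
        unfolding set_integrable_def by (simp flip: scaleR_diff_right)
    qed
    \<comment> \<open>\<open>u\<close> need not have norm 1, so \<open>Q\<close> is compared with
      its value at \<open>m x\<close>, at the price of its Lipschitz constant.\<close>
    moreover have "(\<integral>x\<in>K. \<bar>G x\<bar> \<partial>lborel) \<le> \<eta> * measure lborel K + LQ * e"
    proof -
      have "(\<integral>x\<in>K. \<bar>G x\<bar> \<partial>lborel) \<le> (\<integral>x\<in>K. \<eta> + LQ * norm (u x - m x) \<partial>lborel)"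
      proof (rule set_integral_mono_AE)
        show "set_integrable lborel K (\<lambda>x. \<bar>G x\<bar>)"
          using C1_alongD(1)[OF G1] by (intro set_integrable_continuous_compact K(1) continuous_intros)
        show "set_integrable lborel K (\<lambda>x. \<eta> + LQ * norm (u x - m x))"
          using iu set_integral_compact_const(1)[OF K(1)] by (intro set_integral_add) auto
        show "AE x in lborel. x \<in> K \<longrightarrow> \<bar>G x\<bar> \<le> \<eta> + LQ * norm (u x - m x)"
          using Nm
        proof eventually_elim
          case (elim x)
          show ?case
          proof
            assume "x \<in> K"
            then have "N (m x) = 1" using elim K(2) by auto
            then show "\<bar>G x\<bar> \<le> \<eta> + LQ * norm (u x - m x)"
              using Qsmall[of "m x"] LQ[of "u x" "m x"] unfolding G_def by linarith
          qed
        qed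
      qed
      also have "\<dots> = \<eta> * measure lborel K + LQ * (\<integral>x\<in>K. norm (u x - m x) \<partial>lborel)"
        using iu set_integral_compact_const[OF K(1)] by (subst set_integral_add) auto
      also have "\<dots> \<le> \<eta> * measure lborel K + LQ * e" using um LQ0 by (intro add_left_mono mult_left_mono) auto
      finally show ?thesis .
    qed
    ultimately have "\<bar>\<integral>x. (F (x + l *\<^sub>R ?\<xi>) - F x) * \<psi> x \<partial>lborel\<bar>
      \<le> l * M * (2 * C * L * norm z * e + (\<eta> * measure lborel K + LQ * e))"
      using l M0 by (smt (verit) mult_left_mono mult_nonneg_nonneg)
    moreover have "\<bar>(\<integral>x. (S (m (x + l *\<^sub>R ?\<xi>)) - S (m x)) * \<psi> x \<partial>lborel) - (\<integral>x. (F (x + l *\<^sub>R ?\<xi>) - F x) * \<psi> x \<partial>lborel)\<bar>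
        \<le> 2 * M * LS * e"
    proof -
      have \<psi>c: "continuous_on UNIV \<psi>" using C1_alongD(1)[OF \<psi>(1)] .
      have \<psi>m: "\<psi> \<in> borel_measurable borel" using \<psi>c by (rule borel_measurable_continuous_onI)
      have \<psi>i: "integrable lborel \<psi>" using \<psi>c \<psi>(2) by (intro integrable_lborel_compact_support[of _ "cball q r"]) auto
      have int: "integrable lborel (\<lambda>x. (S (a (x + l *\<^sub>R ?\<xi>)) - S (a x)) * \<psi> x)"
        if [measurable]: "a \<in> borel_measurable borel" for a :: "complex \<Rightarrow> complex"
      proof -
        have "\<bar>S (a (x + l *\<^sub>R ?\<xi>)) - S (a x)\<bar> \<le> 2" for x
          using Sm_bound[of "a x"] Sm_bound[of "a (x + l *\<^sub>R ?\<xi>)"] by linarith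
        then show ?thesis
          using integrable_bounded_scaleR[OF \<psi>i, of "\<lambda>x. S (a (x + l *\<^sub>R ?\<xi>)) - S (a x)" 2] by simp
      qed
      define W where "W x = indicator K x * norm (u x - m x)" for x
      have iW: "integrable lborel W" using iu by (simp add: set_integrable_def W_def[abs_def])
      have We: "(\<integral>x. W x \<partial>lborel) < e" using um by (simp add: set_lebesgue_integral_def W_def[abs_def])
      have eqI: "(\<integral>x. (S (m (x + l *\<^sub>R ?\<xi>)) - S (m x)) * \<psi> x \<partial>lborel) - (\<integral>x. (F (x + l *\<^sub>R ?\<xi>) - F x) * \<psi> x \<partial>lborel)
        = (\<integral>x. (S (m (x + l *\<^sub>R ?\<xi>)) - S (m x)) * \<psi> x - (S (u (x + l *\<^sub>R ?\<xi>)) - S (u x)) * \<psi> x \<partial>lborel)"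
        unfolding F_def by (rule Bochner_Integration.integral_diff[symmetric]) (intro int; measurable)+
      have "norm (\<integral>x. (S (m (x + l *\<^sub>R ?\<xi>)) - S (m x)) * \<psi> x - (S (u (x + l *\<^sub>R ?\<xi>)) - S (u x)) * \<psi> x \<partial>lborel)
        \<le> (\<integral>x. norm ((S (m (x + l *\<^sub>R ?\<xi>)) - S (m x)) * \<psi> x - (S (u (x + l *\<^sub>R ?\<xi>)) - S (u x)) * \<psi> x) \<partial>lborel)"
        by (rule integral_norm_bound)
      also have "\<dots> \<le> (\<integral>x. M * LS * (W (x + l *\<^sub>R ?\<xi>) + W x) \<partial>lborel)"
      proof (rule integral_mono')
        show "integrable lborel (\<lambda>x. M * LS * (W (x + l *\<^sub>R ?\<xi>) + W x))"
          using integrable_translate(1)[OF iW] iW by (intro integrable_mult_right Bochner_Integration.integrable_add) auto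
        fix x
        show "0 \<le> M * LS * (W (x + l *\<^sub>R ?\<xi>) + W x)" using M0 LS0 by (simp add: W_def)
        let ?y = "x + l *\<^sub>R ?\<xi>"
        show "norm ((S (m ?y) - S (m x)) * \<psi> x - (S (u ?y) - S (u x)) * \<psi> x) \<le> M * LS * (W ?y + W x)"
        proof (cases "x \<in> cball q r")
          case True
          then have "?y \<in> K" "x \<in> K" using K(3)[of x l] K(3)[of x 0] l by auto
          have "\<bar>(S (m ?y) - S (m x)) - (S (u ?y) - S (u x))\<bar> \<le> LS * (norm (u ?y - m ?y) + norm (u x - m x))"
            using LS[of "u ?y" "m ?y"] LS[of "u x" "m x"] unfolding distrib_left by linarith
          then have "\<bar>(S (m ?y) - S (m x)) - (S (u ?y) - S (u x))\<bar> * \<bar>\<psi> x\<bar> \<le> (LS * (norm (u ?y - m ?y) + norm (u x - m x))) * M"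
            using \<psi>(4)[of x] LS0 by (intro mult_mono) auto
          moreover have "(S (m ?y) - S (m x)) * \<psi> x - (S (u ?y) - S (u x)) * \<psi> x
              = ((S (m ?y) - S (m x)) - (S (u ?y) - S (u x))) * \<psi> x"
            by (rule left_diff_distrib[symmetric])
          moreover have "(LS * (norm (u ?y - m ?y) + norm (u x - m x))) * M = M * LS * (W ?y + W x)"
            using \<open>?y \<in> K\<close> \<open>x \<in> K\<close> by (simp add: W_def)
          ultimately show ?thesis by (simp only: real_norm_def abs_mult)
        next
          case False
          then show ?thesis using \<psi>(2) M0 LS0 by (simp add: W_def)
        qed
      qed
      also have "\<dots> = M * LS * (2 * (\<integral>x. W x \<partial>lborel))"
        using integrable_translate[OF iW, of "l *\<^sub>R ?\<xi>"] iW by simp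
      also have "\<dots> \<le> M * LS * (2 * e)" using We M0 LS0 by (intro mult_left_mono) auto
      finally show ?thesis unfolding eqI real_norm_def by argo
    qed
    ultimately have "\<bar>\<integral>x. (S (m (x + l *\<^sub>R ?\<xi>)) - S (m x)) * \<psi> x \<partial>lborel\<bar>
      \<le> l * M * (2 * C * L * norm z * e + (\<eta> * measure lborel K + LQ * e)) + 2 * M * LS * e" by linarith
    also have "\<dots> = l * M * (\<eta> * measure lborel K) + (CC - 1) * e" by (simp add: CC_def algebra_simps)
    also have "\<dots> \<le> l * M * (\<eta> * measure lborel K) + CC * e" using e by (simp add: algebra_simps)
    also have "CC * e = e0" using CC by (simp add: e_def)
    finally show "\<bar>\<integral>x. (S (m (x + l *\<^sub>R ?\<xi>)) - S (m x)) * \<psi> x \<partial>lborel\<bar> \<le> l * M * (\<eta> * measure lborel K) + e0" .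
  qed
  show ?thesis using \<delta> main unfolding S_def s_def by blast
qed

end

context norm_step
begin

lemma step_scaled_limit:
  assumes \<delta>: "\<And>n. 0 < \<delta> n" "\<delta> \<longlonglongrightarrow> 0"
  shows "(\<lambda>n. H (v / \<delta> n)) \<longlonglongrightarrow> (1 + sgn v) / 2"
proof -
  consider "v > 0" | "v < 0" | "v = 0" by linarith
  then show ?thesis
  proof cases
    case 1
    have "eventually (\<lambda>n. \<delta> n < v) sequentially" using \<delta>(2) 1 by (rule order_tendstoD)
    then have "eventually (\<lambda>n. H (v / \<delta> n) = (1 + sgn v) / 2) sequentially"
      by eventually_elim (use \<delta>(1) 1 H_right in \<open>simp add: less_imp_le\<close>)
    then show ?thesis by (rule tendsto_eventually)
  next
    case 2
    have "eventually (\<lambda>n. \<delta> n < - v) sequentially" using \<delta>(2) 2 by (intro order_tendstoD) auto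
    then have "eventually (\<lambda>n. H (v / \<delta> n) = (1 + sgn v) / 2) sequentially"
    proof eventually_elim
      case (elim n)
      then have "v / \<delta> n \<le> - 1" using \<delta>(1)[of n] by (simp add: field_simps)
      then show ?case using 2 H_left by simp
    qed
    then show ?thesis by (rule tendsto_eventually)
  next
    case 3
    then show ?thesis by (simp add: H_0)
  qed
qed

text \<open>With \<eta> and hence the width of the step tending to 0, steps become signs, and the
  difference \<open>g\<close> of the signs integrates to 0 against every mollifier centred in
  \<open>ball q r\<close>. The radius \<open>2 * r\<close> in the hypothesis leaves room for the
  supports of these mollifiers.\<close>

lemma kinetic_AE:
  assumes app: "approximable \<Omega> m" and m: "integrable lborel m"
    and Nm: "AE x in lborel. x \<in> \<Omega> \<longrightarrow> N (m x) = 1"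
    and z: "N z = 1" "(N has_derivative (\<lambda>w. \<nu> \<bullet> w)) (at z)" "\<nu> \<bullet> z = 1"
    and K: "compact K" "K \<subseteq> \<Omega>"
      "\<And>x t. x \<in> cball q (2 * r) \<Longrightarrow> 0 \<le> t \<Longrightarrow> t \<le> l \<Longrightarrow> x + t *\<^sub>R (\<i> * \<nu>) \<in> K"
    and l: "l \<ge> 0" and r: "r > 0"
  shows "AE x in lborel. x \<in> ball q r \<longrightarrow>
     sgn ((\<i> * z) \<bullet> m (x + l *\<^sub>R (\<i> * \<nu>))) = sgn ((\<i> * z) \<bullet> m x)"
proof -
  let ?\<xi> = "l *\<^sub>R (\<i> * \<nu>)"
  have [measurable]: "m \<in> borel_measurable borel" using m by auto
  have [measurable]: "H \<in> borel_measurable borel" using continuous_H by (rule borel_measurable_continuous_onI)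
  define s where "s v = (\<i> * z) \<bullet> v" for v
  have [measurable]: "s \<in> borel_measurable borel"
    unfolding s_def[abs_def] by (intro borel_measurable_continuous_onI continuous_intros)
  define g where "g x = (sgn (s (m (x + ?\<xi>))) - sgn (s (m x))) / 2" for x
  have [measurable]: "g \<in> borel_measurable borel" unfolding g_def[abs_def] by measurable
  have g1: "\<bar>g x\<bar> \<le> 1" for x by (auto simp: g_def sgn_if)
  have test: "(\<integral>x. g x * \<psi> x \<partial>lborel) = 0"
    if \<psi>: "C1_along z \<psi> \<psi>d" "\<And>x. x \<notin> cball q (2 * r) \<Longrightarrow> \<psi> x = 0" "\<And>x. x \<notin> cball q (2 * r) \<Longrightarrow> \<psi>d x = 0"
      "\<And>x. \<bar>\<psi> x\<bar> \<le> M" "\<And>x. \<bar>\<psi>d x\<bar> \<le> M" for \<psi> \<psi>d M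
  proof -
    have ex: "\<forall>n. \<exists>\<delta>. 0 < \<delta> \<and> \<delta> < inverse (real (Suc n)) \<and>
      \<bar>\<integral>x. (H (s (m (x + ?\<xi>)) / \<delta>) - H (s (m x) / \<delta>)) * \<psi> x \<partial>lborel\<bar> \<le> l * M * (inverse (real (Suc n)) * measure lborel K)"
      (is "\<forall>n. ?Q n")
    proof (rule allI)
      fix n
      have "inverse (real (Suc n)) > 0" by simp
      note kw = kinetic_weak[where q = q and r = "2 * r", OF app m Nm z K l this]
      obtain \<delta> where "0 < \<delta>" "\<delta> < inverse (real (Suc n))" and
        *: "\<And>\<psi> \<psi>d M. C1_along z \<psi> \<psi>d \<and> (\<forall>x. x \<notin> cball q (2 * r) \<longrightarrow> \<psi> x = 0 \<and> \<psi>d x = 0) \<and>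
          (\<forall>x. \<bar>\<psi> x\<bar> \<le> M \<and> \<bar>\<psi>d x\<bar> \<le> M) \<Longrightarrow>
          \<bar>\<integral>x. (H ((\<i> * z) \<bullet> m (x + ?\<xi>) / \<delta>) - H ((\<i> * z) \<bullet> m x / \<delta>)) * \<psi> x \<partial>lborel\<bar>
            \<le> l * M * (inverse (real (Suc n)) * measure lborel K)"
        by (rule exE, rule kw, assumption, assumption, assumption, elim conjE, rule that, assumption, assumption,
            erule allE, erule allE, erule allE, erule impE, assumption, assumption)
      have "\<bar>\<integral>x. (H ((\<i> * z) \<bullet> m (x + ?\<xi>) / \<delta>) - H ((\<i> * z) \<bullet> m x / \<delta>)) * \<psi> x \<partial>lborel\<bar>
            \<le> l * M * (inverse (real (Suc n)) * measure lborel K)"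
        using \<psi> by (intro *[of \<psi> \<psi>d M]) auto
      then show "?Q n" unfolding s_def using \<open>0 < \<delta>\<close> \<open>\<delta> < inverse (real (Suc n))\<close> by (intro exI[of _ \<delta>] conjI)
    qed
    obtain \<delta> where \<delta>_all: "\<forall>n. 0 < \<delta> n \<and> \<delta> n < inverse (real (Suc n)) \<and>
      \<bar>\<integral>x. (H (s (m (x + ?\<xi>)) / \<delta> n) - H (s (m x) / \<delta> n)) * \<psi> x \<partial>lborel\<bar> \<le> l * M * (inverse (real (Suc n)) * measure lborel K)"
      using choice[OF ex] by (elim exE) (rule that)
    have \<delta>: "0 < \<delta> n" "\<delta> n < inverse (real (Suc n))"
      "\<bar>\<integral>x. (H (s (m (x + ?\<xi>)) / \<delta> n) - H (s (m x) / \<delta> n)) * \<psi> x \<partial>lborel\<bar> \<le> l * M * (inverse (real (Suc n)) * measure lborel K)" for n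
      using spec[OF \<delta>_all, of n] by simp_all
    have \<delta>0: "\<delta> \<longlonglongrightarrow> 0"
      by (rule tendsto_sandwich[OF _ _ tendsto_const LIMSEQ_inverse_real_of_nat])
        (use \<delta> in \<open>auto intro!: always_eventually less_imp_le\<close>)
    have \<psi>c: "continuous_on UNIV \<psi>" using C1_alongD(1)[OF \<psi>(1)] .
    have [measurable]: "\<psi> \<in> borel_measurable borel" using \<psi>c by (rule borel_measurable_continuous_onI)
    have \<psi>i: "integrable lborel \<psi>" using \<psi>c \<psi>(2) by (intro integrable_lborel_compact_support[of _ "cball q (2 * r)"]) auto
    have "(\<lambda>n. \<integral>x. (H (s (m (x + ?\<xi>)) / \<delta> n) - H (s (m x) / \<delta> n)) * \<psi> x \<partial>lborel) \<longlonglongrightarrow> (\<integral>x. g x * \<psi> x \<partial>lborel)"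
    proof (rule integral_dominated_convergence[where w = "\<lambda>x. 2 * \<bar>\<psi> x\<bar>"])
      show "AE x in lborel. (\<lambda>n. (H (s (m (x + ?\<xi>)) / \<delta> n) - H (s (m x) / \<delta> n)) * \<psi> x) \<longlonglongrightarrow> g x * \<psi> x"
      proof (intro AE_I2 tendsto_mult tendsto_const)
        fix x
        have "(\<lambda>n. H (s (m (x + ?\<xi>)) / \<delta> n) - H (s (m x) / \<delta> n)) \<longlonglongrightarrow> (1 + sgn (s (m (x + ?\<xi>)))) / 2 - (1 + sgn (s (m x))) / 2"
          by (intro tendsto_diff step_scaled_limit \<delta>(1) \<delta>0)
        then show "(\<lambda>n. H (s (m (x + ?\<xi>)) / \<delta> n) - H (s (m x) / \<delta> n)) \<longlonglongrightarrow> g x"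
          by (simp add: g_def diff_divide_distrib add_divide_distrib)
      qed
      show "AE x in lborel. norm ((H (s (m (x + ?\<xi>)) / \<delta> n) - H (s (m x) / \<delta> n)) * \<psi> x) \<le> 2 * \<bar>\<psi> x\<bar>" for n
      proof (intro AE_I2)
        fix x
        have "\<bar>H (s (m (x + ?\<xi>)) / \<delta> n) - H (s (m x) / \<delta> n)\<bar> \<le> 2"
          using H_range[of "s (m (x + ?\<xi>)) / \<delta> n"] H_range[of "s (m x) / \<delta> n"] by linarith
        then show "norm ((H (s (m (x + ?\<xi>)) / \<delta> n) - H (s (m x) / \<delta> n)) * \<psi> x) \<le> 2 * \<bar>\<psi> x\<bar>"
          unfolding real_norm_def abs_mult by (rule mult_right_mono) simp
      qed
    qed (use \<psi>i in auto)
    moreover have "(\<lambda>n. \<integral>x. (H (s (m (x + ?\<xi>)) / \<delta> n) - H (s (m x) / \<delta> n)) * \<psi> x \<partial>lborel) \<longlonglongrightarrow> 0"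
    proof (rule Lim_null_comparison)
      show "eventually (\<lambda>n. norm (\<integral>x. (H (s (m (x + ?\<xi>)) / \<delta> n) - H (s (m x) / \<delta> n)) * \<psi> x \<partial>lborel)
          \<le> l * M * (inverse (real (Suc n)) * measure lborel K)) sequentially"
        using \<delta>(3) by (intro always_eventually allI) simp
      have "(\<lambda>n. l * M * (inverse (real (Suc n)) * measure lborel K)) \<longlonglongrightarrow> l * M * (0 * measure lborel K)"
        by (intro tendsto_intros LIMSEQ_inverse_real_of_nat)
      then show "(\<lambda>n. l * M * (inverse (real (Suc n)) * measure lborel K)) \<longlonglongrightarrow> 0" by simp
    qed
    ultimately show ?thesis using LIMSEQ_unique by blast
  qed
  \<comment> \<open>\<open>smear\<close> acts on complex functions. The cutoff makes
    \<open>g\<close> integrable and is not seen by mollifiers centred in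
    \<open>ball q r\<close>.\<close>
  define gc where "gc x = complex_of_real (indicator (cball q (2 * r)) x * g x)" for x
  have gci: "integrable lborel gc"
  proof -
    have "integrable lborel (\<lambda>x. indicator (cball q (2 * r)) x :: real)"
      by (intro integrable_real_indicator emeasure_compact_finite) auto
    from integrable_bounded_scaleR[OF this, of g 1] g1
    have "integrable lborel (\<lambda>x. indicator (cball q (2 * r)) x * g x)" by (simp add: mult.commute)
    then show ?thesis unfolding gc_def[abs_def] by (rule integrable_of_real)
  qed
  have small: "(\<integral>x\<in>ball q r. norm (gc x) \<partial>lborel) \<le> e" if e: "e > 0" for e
  proof -
    obtain d where d: "d > 0" "\<And>h. norm h < d \<Longrightarrow> (\<integral>x. norm (gc (x + h) - gc x) \<partial>lborel) < e"
      using L1_translation_continuous[OF gci e] by blast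
    define k where "k = min d r"
    have k: "k > 0" "k \<le> d" "k \<le> r" using d r by (auto simp: k_def)
    obtain B \<rho> \<rho>1 \<rho>2 where "mollifier k B \<rho> \<rho>1 \<rho>2" using ex_mollifier[OF k(1)] by blast
    then interpret mollifier k B \<rho> \<rho>1 \<rho>2 .
    have zero: "smear \<rho> gc x = 0" if x: "x \<in> ball q r" for x
    proof -
      have out: "norm (y - x) \<ge> k" if "y \<notin> cball q (2 * r)" for y
      proof (rule ccontr)
        assume "\<not> ?thesis"
        then have "dist x y < r" using k(3) by (simp add: dist_norm norm_minus_commute)
        then have "dist q y < r + r" using x dist_triangle[of q y x] by simp
        then show False using that by simp
      qed
      have "(\<integral>y. g y * \<rho> (y - x) \<partial>lborel) = 0"
      proof (rule test[where \<psi>d = "\<lambda>y. Re z * \<rho>1 (y - x) + Im z * \<rho>2 (y - x)" and M = "B + (\<bar>Re z\<bar> + \<bar>Im z\<bar>) * B"])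
        show "C1_along z (\<lambda>y. \<rho> (y - x)) (\<lambda>y. Re z * \<rho>1 (y - x) + Im z * \<rho>2 (y - x))"
        proof (rule C1_alongI[where f' = "\<lambda>y h. Re h * \<rho>1 (y - x) + Im h * \<rho>2 (y - x)"])
          show "((\<lambda>y. \<rho> (y - x)) has_derivative (\<lambda>h. Re h * \<rho>1 (y - x) + Im h * \<rho>2 (y - x))) (at y)" for y
            by (rule rho_shift_has_derivative)
          show "continuous_on UNIV (\<lambda>y. Re z * \<rho>1 (y - x) + Im z * \<rho>2 (y - x))"
            by (intro continuous_intros continuous_on_compose2[OF cont(1)] continuous_on_compose2[OF cont(2)]) auto
        qed simp
        fix y
        show "\<bar>\<rho> (y - x)\<bar> \<le> B + (\<bar>Re z\<bar> + \<bar>Im z\<bar>) * B" using bound(1)[of "y - x"] B_pos by (simp add: add_increasing2)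
        have "\<bar>Re z * \<rho>1 (y - x) + Im z * \<rho>2 (y - x)\<bar> \<le> \<bar>Re z\<bar> * B + \<bar>Im z\<bar> * B"
          using bound(2,3)[of "y - x"]
          by (intro order_trans[OF abs_triangle_ineq] add_mono) (auto simp: abs_mult intro: mult_left_mono)
        then show "\<bar>Re z * \<rho>1 (y - x) + Im z * \<rho>2 (y - x)\<bar> \<le> B + (\<bar>Re z\<bar> + \<bar>Im z\<bar>) * B"
          using B_pos by (simp add: distrib_right)
      next
        fix y assume "y \<notin> cball q (2 * r)"
        from out[OF this] show "\<rho> (y - x) = 0" "Re z * \<rho>1 (y - x) + Im z * \<rho>2 (y - x) = 0"
          by (simp_all add: support)
      qed
      moreover have "\<rho> (y - x) *\<^sub>R gc y = complex_of_real (g y * \<rho> (y - x))" for y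
      proof (cases "y \<in> cball q (2 * r)")
        case True
        then show ?thesis by (simp add: gc_def scaleR_conv_of_real)
      next
        case False
        then show ?thesis using out[OF False] by (simp add: gc_def support)
      qed
      ultimately show ?thesis by (simp add: smear_def del: of_real_mult)
    qed
    have "(\<integral>x. norm (gc (x + h) - gc x) \<partial>lborel) \<le> e" if "norm h < k" for h
      using d(2)[of h] that k(2) by simp
    note sm = smear_L1[OF gci this less_imp_le[OF e]]
    have "(\<integral>x\<in>ball q r. norm (gc x) \<partial>lborel) \<le> (\<integral>x. norm (smear \<rho> gc x - gc x) \<partial>lborel)"
      unfolding set_lebesgue_integral_def
      by (rule integral_mono') (use sm(1) zero in \<open>auto simp: indicator_def\<close>)
    then show ?thesis using sm(2) by linarith
  qed
  have iB: "set_integrable lborel (ball q r) (\<lambda>x. norm (gc x))"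
    unfolding set_integrable_def using gci by (intro integrable_mult_indicator) auto
  have "(\<integral>x\<in>ball q r. norm (gc x) \<partial>lborel) \<le> 0"
    using field_le_epsilon[of "\<integral>x\<in>ball q r. norm (gc x) \<partial>lborel" 0] small by simp
  moreover have "0 \<le> (\<integral>x\<in>ball q r. norm (gc x) \<partial>lborel)"
    unfolding set_lebesgue_integral_def by (intro Bochner_Integration.integral_nonneg) auto
  ultimately have "(\<integral>x. indicator (ball q r) x *\<^sub>R norm (gc x) \<partial>lborel) = 0"
    unfolding set_lebesgue_integral_def by linarith
  then have "AE x in lborel. indicator (ball q r) x *\<^sub>R norm (gc x) = 0"
    using integral_nonneg_eq_0_iff_AE[OF iB[unfolded set_integrable_def]] by auto
  then show ?thesis
  proof eventually_elim
    case (elim x)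
    show ?case
    proof
      assume x: "x \<in> ball q r"
      then have "x \<in> cball q (2 * r)" using r by auto
      then show "sgn ((\<i> * z) \<bullet> m (x + ?\<xi>)) = sgn ((\<i> * z) \<bullet> m x)"
        using elim x by (simp add: gc_def g_def s_def)
    qed
  qed
qed

end

section \<open>Approximation by smooth divergence-free fields\<close>

lemma smooth2_continuous:
  assumes "smooth2 f"
  shows "continuous_on UNIV f" "continuous_on UNIV (\<lambda>x. frechet_derivative f (at x) 1)"
    "continuous_on UNIV (\<lambda>x. frechet_derivative f (at x) \<i>)" "f differentiable (at x)"
proof -
  have c: "continuous_on UNIV g" if "smooth2 g" for g
    using that by (cases rule: smooth2.cases)
      (auto intro!: continuous_at_imp_continuous_on differentiable_imp_continuous_within)
  show "continuous_on UNIV f" using c assms by blast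
  show "continuous_on UNIV (\<lambda>x. frechet_derivative f (at x) 1)"
    "continuous_on UNIV (\<lambda>x. frechet_derivative f (at x) \<i>)" "f differentiable (at x)"
    using assms by (cases rule: smooth2.cases; use c in blast)+
qed

text \<open>A Borel function on the whole plane replaces a Lebesgue measurable one on \<Omega>;
  translations, Tonelli and mollification then take place in \<open>lborel\<close>, without
  completion and without restriction to \<Omega>.\<close>

definition Borel_rep :: "complex set \<Rightarrow> (complex \<Rightarrow> 'a::real_normed_vector) \<Rightarrow> (complex \<Rightarrow> 'a) \<Rightarrow> bool" where
  "Borel_rep \<Omega> f g \<longleftrightarrow> g \<in> borel_measurable borel \<and> (AE x in lborel. indicator \<Omega> x *\<^sub>R f x = g x) \<and> (\<forall>x. x \<notin> \<Omega> \<longrightarrow> g x = 0)"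

lemma ex_Borel_rep:
  fixes f :: "complex \<Rightarrow> complex"
  assumes "set_borel_measurable lebesgue \<Omega> f" "open \<Omega>"
  shows "\<exists>g. Borel_rep \<Omega> f g"
proof -
  have f: "(\<lambda>x. indicator \<Omega> x *\<^sub>R f x) \<in> borel_measurable lebesgue"
    using assms(1) by (simp add: set_borel_measurable_def)
  have "(\<lambda>x. Re (indicator \<Omega> x *\<^sub>R f x)) \<in> borel_measurable lebesgue"
    "(\<lambda>x. Im (indicator \<Omega> x *\<^sub>R f x)) \<in> borel_measurable lebesgue"
    by (rule measurable_compose[OF f borel_measurable_Re] measurable_compose[OF f borel_measurable_Im])+
  from this[THEN completion_ex_borel_measurable_real]
  obtain a b where ab: "a \<in> borel_measurable lborel" "b \<in> borel_measurable lborel"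
    "AE x in lborel. Re (indicator \<Omega> x *\<^sub>R f x) = a x" "AE x in lborel. Im (indicator \<Omega> x *\<^sub>R f x) = b x"
    by (elim bexE) (rule that)
  have [measurable]: "a \<in> borel_measurable borel" "b \<in> borel_measurable borel" "\<Omega> \<in> sets borel"
    using ab(1,2) assms(2) by auto
  define g where "g x = indicator \<Omega> x *\<^sub>R Complex (a x) (b x)" for x
  have "g = (\<lambda>x. indicator \<Omega> x *\<^sub>R (complex_of_real (a x) + \<i> * complex_of_real (b x)))"
    by (simp add: g_def fun_eq_iff complex_eq_iff)
  moreover have "(\<lambda>x. indicator \<Omega> x *\<^sub>R (complex_of_real (a x) + \<i> * complex_of_real (b x))) \<in> borel_measurable borel"
    by measurable
  ultimately have "g \<in> borel_measurable borel" by simp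
  moreover have "AE x in lborel. indicator \<Omega> x *\<^sub>R f x = g x"
    using ab(3,4) by eventually_elim (auto simp: g_def complex_eq_iff indicator_def split: if_splits)
  moreover have "\<forall>x. x \<notin> \<Omega> \<longrightarrow> g x = 0" by (simp add: g_def)
  ultimately show ?thesis unfolding Borel_rep_def by blast
qed

text \<open>General in the integrand and in the type of values: it serves products with test
  functions, pairings with their gradients and, with pairs as values, distances between two
  functions. \<open>F x 0 = 0\<close> takes care of the complement of \<Omega>.\<close>

lemma Borel_rep_set_integral:
  fixes f g :: "complex \<Rightarrow> 'c::{real_normed_vector, second_countable_topology}"
    and F :: "complex \<Rightarrow> 'c \<Rightarrow> 'b::{banach, second_countable_topology}"
  assumes f: "set_borel_measurable lebesgue \<Omega> f" and fg: "Borel_rep \<Omega> f g"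
    and F: "(\<lambda>(x, v). F x v) \<in> borel_measurable (borel \<Otimes>\<^sub>M borel)" "\<And>x. F x 0 = 0"
  shows "(\<integral>x\<in>\<Omega>. F x (f x) \<partial>lebesgue) = (\<integral>x. F x (g x) \<partial>lborel)"
proof -
  have g [measurable]: "g \<in> borel_measurable borel" using fg by (simp add: Borel_rep_def)
  have f': "(\<lambda>x. indicator \<Omega> x *\<^sub>R f x) \<in> borel_measurable lebesgue"
    using f by (simp add: set_borel_measurable_def)
  have eq: "indicator \<Omega> x *\<^sub>R F x (f x) = F x (indicator \<Omega> x *\<^sub>R f x)" for x
    using F(2) by (simp add: indicator_def)
  have id: "(\<lambda>x. x) \<in> measurable lebesgue borel"
    by (intro measurable_completion) auto
  have m1: "(\<lambda>x. F x (indicator \<Omega> x *\<^sub>R f x)) \<in> borel_measurable lebesgue"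
    using measurable_compose[OF measurable_Pair[OF id f'] F(1)] by simp
  have m2: "(\<lambda>x. F x (g x)) \<in> borel_measurable lborel"
    using measurable_compose[OF measurable_Pair[of "\<lambda>x. x" lborel borel g borel] F(1)] by simp
  have m2': "(\<lambda>x. F x (g x)) \<in> borel_measurable lebesgue" using m2 by (rule measurable_completion)
  have "(\<integral>x\<in>\<Omega>. F x (f x) \<partial>lebesgue) = (\<integral>x. F x (indicator \<Omega> x *\<^sub>R f x) \<partial>lebesgue)"
    unfolding set_lebesgue_integral_def eq ..
  also have "\<dots> = (\<integral>x. F x (g x) \<partial>lebesgue)"
  proof (rule integral_cong_AE[OF m1 m2'])
    show "AE x in lebesgue. F x (indicator \<Omega> x *\<^sub>R f x) = F x (g x)"
      using fg unfolding Borel_rep_def AE_completion_iff by (auto elim!: eventually_mono)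
  qed
  also have "\<dots> = (\<integral>x. F x (g x) \<partial>lborel)" by (rule integral_completion[OF m2])
  finally show ?thesis .
qed

lemma Borel_rep_set_integrable:
  fixes f g :: "complex \<Rightarrow> complex"
  assumes "L2_on \<Omega> f" and fg: "Borel_rep \<Omega> f g"
  shows "integrable lborel (\<lambda>x. (norm (g x))\<^sup>2)"
proof -
  have [measurable]: "g \<in> borel_measurable borel" using fg by (simp add: Borel_rep_def)
  have "integrable lebesgue (\<lambda>x. indicator \<Omega> x *\<^sub>R (norm (f x))\<^sup>2)"
    using assms(1) by (simp add: L2_on_def set_integrable_def)
  then have "(\<integral>\<^sup>+x. ennreal (indicator \<Omega> x *\<^sub>R (norm (f x))\<^sup>2) \<partial>lebesgue) < \<infinity>"
    by (simp add: integrable_iff_bounded)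
  moreover have "(\<integral>\<^sup>+x. ennreal (indicator \<Omega> x *\<^sub>R (norm (f x))\<^sup>2) \<partial>lebesgue) = (\<integral>\<^sup>+x. ennreal ((norm (g x))\<^sup>2) \<partial>lborel)"
    unfolding nn_integral_completion
    using fg unfolding Borel_rep_def
    by (intro nn_integral_cong_AE) (auto elim!: eventually_mono simp: indicator_def split: if_splits)
  ultimately show ?thesis by (simp add: integrable_iff_bounded)
qed

text \<open>A bounded set has finite measure, and
  \<open>norm (g x) \<le> 1 + (norm (g x))\<^sup>2\<close> on it.\<close>

lemma integrable_of_square_integrable:
  fixes g :: "complex \<Rightarrow> complex"
  assumes "bounded \<Omega>" "open \<Omega>" "\<And>x. x \<notin> \<Omega> \<Longrightarrow> g x = 0" "integrable lborel (\<lambda>x. (norm (g x))\<^sup>2)"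
    and [measurable]: "g \<in> borel_measurable borel"
  shows "integrable lborel g"
proof -
  have "emeasure lborel \<Omega> < \<infinity>" using assms(1) by (rule emeasure_bounded_finite)
  then have i: "integrable lborel (\<lambda>x. indicator \<Omega> x + (norm (g x))\<^sup>2)"
    using assms(2,4) by (intro Bochner_Integration.integrable_add integrable_real_indicator) auto
  show ?thesis
  proof (rule Bochner_Integration.integrable_bound[OF i])
    show "AE x in lborel. norm (g x) \<le> norm (indicator \<Omega> x + (norm (g x))\<^sup>2)"
    proof (intro AE_I2)
      fix x
      have "norm (g x) \<le> 1 + (norm (g x))\<^sup>2" using sum_squares_bound[of "norm (g x)" 1] norm_ge_zero[of "g x"] by (simp only: power_one mult_1_right)
      then show "norm (g x) \<le> norm (indicator \<Omega> x + (norm (g x))\<^sup>2)"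
        using assms(3)[of x] by (cases "x \<in> \<Omega>") auto
    qed
  qed auto
qed

context mollifier
begin

lemma rho_shift_frechet:
  "frechet_derivative (\<lambda>y. \<rho> (y - x)) (at y) = (\<lambda>h. Re h * \<rho>1 (y - x) + Im h * \<rho>2 (y - x))"
  using frechet_derivative_at[OF rho_shift_has_derivative] by simp

lemma test_fun_rho_shift:
  assumes "cball x k \<subseteq> \<Omega>"
  shows "test_fun \<Omega> (\<lambda>y. \<rho> (y - x))"
proof -
  have "{y. \<rho> (y - x) \<noteq> 0} \<subseteq> cball x k"
    using support(1) by (force simp: dist_norm norm_minus_commute)
  then have "closure {y. \<rho> (y - x) \<noteq> 0} \<subseteq> cball x k" by (intro closure_minimal) auto
  moreover have "compact (closure {y. \<rho> (y - x) \<noteq> 0})"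
    using calculation bounded_subset[OF bounded_cball] by (auto simp: compact_eq_bounded_closed)
  ultimately show ?thesis using smooth assms by (auto simp: test_fun_def)
qed

end

text \<open>Integrals run over the whole plane with respect to \<open>lborel\<close>: the functions are meant to be the
  Borel representatives above, which vanish outside \<open>\<Omega>\<close>.\<close>

definition W11_rep :: "complex set \<Rightarrow> (complex \<Rightarrow> complex) \<Rightarrow> (complex \<Rightarrow> complex) \<Rightarrow> (complex \<Rightarrow> complex) \<Rightarrow> bool" where
  "W11_rep \<Omega> f d1 d2 \<longleftrightarrow> integrable lborel f \<and> integrable lborel d1 \<and> integrable lborel d2 \<and>
    (\<forall>\<phi>. test_fun \<Omega> \<phi> \<longrightarrow>
      (\<integral>x. frechet_derivative \<phi> (at x) 1 *\<^sub>R f x \<partial>lborel) = - (\<integral>x. \<phi> x *\<^sub>R d1 x \<partial>lborel) \<and>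
      (\<integral>x. frechet_derivative \<phi> (at x) \<i> *\<^sub>R f x \<partial>lborel) = - (\<integral>x. \<phi> x *\<^sub>R d2 x \<partial>lborel) \<and>
      (\<integral>x. f x \<bullet> grad2 \<phi> x \<partial>lborel) = 0)"

context mollifier
begin

text \<open>The translates \<open>\<rho> (y - x)\<close> are admissible test functions as soon as
  \<open>cball x k\<close> lies in \<Omega>; inserted into the weak identities they give pointwise
  ones for the smeared field.\<close>

lemma smear_weak_derivative:
  assumes "W11_rep \<Omega> f d1 d2" "cball x k \<subseteq> \<Omega>"
  shows "- smear \<rho>1 f x = smear \<rho> d1 x" "- smear \<rho>2 f x = smear \<rho> d2 x"
    "Re (smear \<rho>1 f x) + Im (smear \<rho>2 f x) = 0"
proof -
  note t = assms(1)[unfolded W11_rep_def, THEN conjunct2, THEN conjunct2, THEN conjunct2, rule_format,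
      OF test_fun_rho_shift[OF assms(2)]]
  show "- smear \<rho>1 f x = smear \<rho> d1 x" "- smear \<rho>2 f x = smear \<rho> d2 x"
    using t unfolding rho_shift_frechet by (simp_all add: smear_def)
  have f: "integrable lborel f" using assms(1) by (simp add: W11_rep_def)
  have i: "integrable lborel (\<lambda>y. \<rho>1 (y - x) *\<^sub>R f y)" "integrable lborel (\<lambda>y. \<rho>2 (y - x) *\<^sub>R f y)"
    using f bound by (auto intro!: integrable_bounded_scaleR[of _ _ B])
  have "0 = (\<integral>y. f y \<bullet> grad2 (\<lambda>y. \<rho> (y - x)) y \<partial>lborel)" using t by simp
  also have "\<dots> = (\<integral>y. Re (\<rho>1 (y - x) *\<^sub>R f y) + Im (\<rho>2 (y - x) *\<^sub>R f y) \<partial>lborel)"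
    unfolding grad2_def rho_shift_frechet by (simp add: inner_complex_def mult.commute)
  also have "\<dots> = Re (smear \<rho>1 f x) + Im (smear \<rho>2 f x)"
    unfolding smear_def
    by (subst Bochner_Integration.integral_add[OF integrable_Re[OF i(1)] integrable_Im[OF i(2)]])
      (simp only: integral_Re[OF i(1)] integral_Im[OF i(2)])
  finally show "Re (smear \<rho>1 f x) + Im (smear \<rho>2 f x) = 0" by simp
qed

end

text \<open>One radius serves finitely many functions at once: the minimum of \<open>r\<close> and
  of their moduli of L1 continuity. This matters because field and derivatives must be smeared with
  the same kernel.\<close>

lemma ex_mollifier_sequence:
  fixes f :: "nat \<Rightarrow> complex \<Rightarrow> complex"
  assumes "r > 0" "finite F" "\<And>f. f \<in> F \<Longrightarrow> integrable lborel f"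
  shows "\<exists>k B \<rho> \<rho>1 \<rho>2. (\<forall>j. mollifier (k j) (B j) (\<rho> j) (\<rho>1 j) (\<rho>2 j)) \<and> (\<forall>j. k j \<le> r) \<and>
    (\<forall>f\<in>F. \<forall>j. integrable lborel (\<lambda>x. smear (\<rho> j) f x - f x)) \<and>
    (\<forall>f\<in>F. (\<lambda>j. \<integral>x. norm (smear (\<rho> j) f x - f x) \<partial>lborel) \<longlonglongrightarrow> 0)"
proof -
  define Q where "Q j k B \<rho> \<rho>1 \<rho>2 \<longleftrightarrow> mollifier k B \<rho> \<rho>1 \<rho>2 \<and> k \<le> r \<and>
    (\<forall>f\<in>F. integrable lborel (\<lambda>x. smear \<rho> f x - f x) \<and> (\<integral>x. norm (smear \<rho> f x - f x) \<partial>lborel) \<le> inverse (real (Suc j)))"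
    for j k B \<rho> \<rho>1 \<rho>2
  have "\<exists>k B \<rho> \<rho>1 \<rho>2. Q j k B \<rho> \<rho>1 \<rho>2" for j
  proof -
    have "\<forall>f\<in>F. \<exists>d>0. \<forall>h. norm h < d \<longrightarrow> (\<integral>x. norm (f (x + h) - f x) \<partial>lborel) < inverse (real (Suc j))"
      using assms(3) by (intro ballI L1_translation_continuous) auto
    then obtain d where d: "\<And>f. f \<in> F \<Longrightarrow> d f > 0"
      "\<And>f h. f \<in> F \<Longrightarrow> norm h < d f \<Longrightarrow> (\<integral>x. norm (f (x + h) - f x) \<partial>lborel) < inverse (real (Suc j))"
      by metis
    define k where "k = Min (insert r (d ` F))"
    have k: "k > 0" "k \<le> r" "\<And>f. f \<in> F \<Longrightarrow> k \<le> d f" using assms d(1) by (auto simp: k_def)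
    obtain B \<rho> \<rho>1 \<rho>2 where mol: "mollifier k B \<rho> \<rho>1 \<rho>2" using ex_mollifier[OF k(1)] by blast
    interpret mollifier k B \<rho> \<rho>1 \<rho>2 by fact
    have "integrable lborel (\<lambda>x. smear \<rho> f x - f x)" "(\<integral>x. norm (smear \<rho> f x - f x) \<partial>lborel) \<le> inverse (real (Suc j))"
      if f: "f \<in> F" for f
    proof -
      have e: "(\<integral>x. norm (f (x + h) - f x) \<partial>lborel) \<le> inverse (real (Suc j))" if "norm h < k" for h
        using d(2)[OF f, of h] k(3)[OF f] that by simp
      show "integrable lborel (\<lambda>x. smear \<rho> f x - f x)" "(\<integral>x. norm (smear \<rho> f x - f x) \<partial>lborel) \<le> inverse (real (Suc j))"
        using smear_L1[OF assms(3)[OF f] e] by simp_all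
    qed
    then show ?thesis unfolding Q_def using mol k(2) by blast
  qed
  then obtain k B \<rho> \<rho>1 \<rho>2 where "\<And>j. Q j (k j) (B j) (\<rho> j) (\<rho>1 j) (\<rho>2 j)"
    by metis
  then have *: "mollifier (k j) (B j) (\<rho> j) (\<rho>1 j) (\<rho>2 j)" "k j \<le> r"
    "f \<in> F \<Longrightarrow> integrable lborel (\<lambda>x. smear (\<rho> j) f x - f x)"
    "f \<in> F \<Longrightarrow> (\<integral>x. norm (smear (\<rho> j) f x - f x) \<partial>lborel) \<le> inverse (real (Suc j))" for j f
    unfolding Q_def by auto
  have "(\<lambda>j. \<integral>x. norm (smear (\<rho> j) f x - f x) \<partial>lborel) \<longlonglongrightarrow> 0" if "f \<in> F" for f
    by (rule tendsto_sandwich[OF _ _ tendsto_const LIMSEQ_inverse_real_of_nat])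
      (use *(4)[OF that] in \<open>auto intro!: always_eventually\<close>)
  then show ?thesis using *(1-3) by blast
qed

context plane_norm
begin

text \<open>The index \<open>n\<close> is fixed before the mollification radius, so no uniformity in
  \<open>n\<close> arises. As the defect is bounded and continuous, L1 convergence of the smeared
  derivatives and almost everywhere convergence of a subsequence of the smeared fields are enough
  for their product.\<close>

lemma approximableI:
  fixes f d1 d2 :: "nat \<Rightarrow> complex \<Rightarrow> complex"
  assumes \<Omega>: "open \<Omega>" and W: "\<And>n. W11_rep \<Omega> (f n) (d1 n) (d2 n)" and m: "integrable lborel m"
    and l1: "(\<lambda>n. \<integral>x. norm (f n x - m x) \<partial>lborel) \<longlonglongrightarrow> 0"
    and l2: "(\<lambda>n. \<integral>x. (norm (d1 n x) + norm (d2 n x)) * defect (f n x) \<partial>lborel) \<longlonglongrightarrow> 0"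
  shows "approximable \<Omega> m"
  unfolding approximable_def
proof (intro allI impI, elim conjE)
  fix K and e :: real assume K: "compact K" "K \<subseteq> \<Omega>" and e: "e > 0"
  have "eventually (\<lambda>n. (\<integral>x. norm (f n x - m x) \<partial>lborel) < e / 2) sequentially"
    "eventually (\<lambda>n. (\<integral>x. (norm (d1 n x) + norm (d2 n x)) * defect (f n x) \<partial>lborel) < e / 2) sequentially"
    using order_tendstoD(2)[OF l1, of "e / 2"] order_tendstoD(2)[OF l2, of "e / 2"] e by simp_all
  then have "eventually (\<lambda>n. (\<integral>x. norm (f n x - m x) \<partial>lborel) < e / 2 \<and>
      (\<integral>x. (norm (d1 n x) + norm (d2 n x)) * defect (f n x) \<partial>lborel) < e / 2) sequentially"
    by (rule eventually_conj)
  from eventually_happens'[OF sequentially_bot this] obtain n where n: "(\<integral>x. norm (f n x - m x) \<partial>lborel) < e / 2"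
      "(\<integral>x. (norm (d1 n x) + norm (d2 n x)) * defect (f n x) \<partial>lborel) < e / 2"
    by (elim exE conjE) (rule that)
  define g a b where "g = f n" and "a = d1 n" and "b = d2 n"
  have gab: "W11_rep \<Omega> g a b" unfolding g_def a_def b_def by (rule W)
  have i: "integrable lborel g" "integrable lborel a" "integrable lborel b"
    using gab by (auto simp: W11_rep_def)
  then have [measurable]: "g \<in> borel_measurable borel" "a \<in> borel_measurable borel" "b \<in> borel_measurable borel"
    by auto
  have [measurable]: "defect \<in> borel_measurable borel"
    by (intro borel_measurable_continuous_onI continuous_defect)
  obtain r where r: "r > 0" "(\<Union>x\<in>K. cball x r) \<subseteq> \<Omega>"
    using compact_subset_open_imp_cball_epsilon_subset[OF K(1) \<Omega> K(2)] by blast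
  have "\<exists>k B \<rho> \<rho>1 \<rho>2. (\<forall>j. mollifier (k j) (B j) (\<rho> j) (\<rho>1 j) (\<rho>2 j)) \<and> (\<forall>j. k j \<le> r) \<and>
    (\<forall>f\<in>{g, a, b}. \<forall>j. integrable lborel (\<lambda>x. smear (\<rho> j) f x - f x)) \<and>
    (\<forall>f\<in>{g, a, b}. (\<lambda>j. \<integral>x. norm (smear (\<rho> j) f x - f x) \<partial>lborel) \<longlonglongrightarrow> 0)"
    by (rule ex_mollifier_sequence[OF r(1)]) (use i in auto)
  then obtain k B \<rho> \<rho>1 \<rho>2 where mol_all: "\<forall>j. mollifier (k j) (B j) (\<rho> j) (\<rho>1 j) (\<rho>2 j)" "\<forall>j. k j \<le> r"
    and s_all: "\<forall>f\<in>{g, a, b}. \<forall>j. integrable lborel (\<lambda>x. smear (\<rho> j) f x - f x)"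
      "\<forall>f\<in>{g, a, b}. (\<lambda>j. \<integral>x. norm (smear (\<rho> j) f x - f x) \<partial>lborel) \<longlonglongrightarrow> 0"
    by (elim exE conjE) (rule that)
  have mol: "mollifier (k j) (B j) (\<rho> j) (\<rho>1 j) (\<rho>2 j)" "k j \<le> r" for j
    using mol_all by auto
  have si: "integrable lborel (\<lambda>x. smear (\<rho> j) h x - h x)" if "h \<in> {g, a, b}" for j h
    using s_all(1) that by blast
  have sl: "(\<lambda>j. \<integral>x. norm (smear (\<rho> j) h x - h x) \<partial>lborel) \<longlonglongrightarrow> 0" if "h \<in> {g, a, b}" for h
    using s_all(2) that by blast
  obtain \<sigma> where \<sigma>: "strict_mono (\<sigma> :: nat \<Rightarrow> nat)" "AE x in lborel. (\<lambda>j. smear (\<rho> (\<sigma> j)) g x - g x) \<longlonglongrightarrow> 0"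
    using tendsto_L1_AE_subseq[of lborel "\<lambda>j x. smear (\<rho> j) g x - g x"] si sl by auto
  have Kb [measurable]: "K \<in> sets borel" using borel_compact[OF K(1)] .
  have sm: "continuous_on UNIV (smear (\<rho> j) h)" if "h \<in> {g, a, b}" for j h
    using mollifier.continuous_smear[OF mol(1)] i that by auto
  have smm [measurable]: "smear (\<rho> j) g \<in> borel_measurable borel" for j
    using sm by (intro borel_measurable_continuous_onI) auto
  define E where "E x = norm (a x) + norm (b x)" for x
  have [measurable]: "E \<in> borel_measurable borel" unfolding E_def[abs_def] by measurable
  have Ei: "integrable lborel E" unfolding E_def[abs_def] using i by auto
  have E0: "0 \<le> E x" for x by (simp add: E_def)
  have lim: "(\<lambda>j. \<integral>x. E x * defect (smear (\<rho> (\<sigma> j)) g x) \<partial>lborel) \<longlonglongrightarrow> (\<integral>x. E x * defect (g x) \<partial>lborel)"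
  proof (rule integral_dominated_convergence[where w = E])
    show "AE x in lborel. (\<lambda>j. E x * defect (smear (\<rho> (\<sigma> j)) g x)) \<longlonglongrightarrow> E x * defect (g x)"
      using \<sigma>(2)
    proof eventually_elim
      case (elim x)
      then have "(\<lambda>j. smear (\<rho> (\<sigma> j)) g x) \<longlonglongrightarrow> g x" by (rule LIM_zero_cancel)
      then show ?case
        by (intro tendsto_mult tendsto_const continuous_on_tendsto_compose[OF continuous_defect[of UNIV]]) auto
    qed
    show "AE x in lborel. norm (E x * defect (smear (\<rho> (\<sigma> j)) g x)) \<le> E x" for j
      using E0 defect_bounds by (auto simp: abs_mult intro!: mult_left_le)
  qed (use Ei in auto)
  have "eventually (\<lambda>j. (\<integral>x. norm (smear (\<rho> (\<sigma> j)) g x - g x) \<partial>lborel) < e / 8 \<and>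
      (\<integral>x. norm (smear (\<rho> (\<sigma> j)) a x - a x) \<partial>lborel) < e / 8 \<and>
      (\<integral>x. norm (smear (\<rho> (\<sigma> j)) b x - b x) \<partial>lborel) < e / 8 \<and>
      (\<integral>x. E x * defect (smear (\<rho> (\<sigma> j)) g x) \<partial>lborel) < e / 2) sequentially"
  proof -
    have ev: "eventually (\<lambda>j. (\<integral>x. norm (smear (\<rho> (\<sigma> j)) h x - h x) \<partial>lborel) < e / 8) sequentially"
      if "h \<in> {g, a, b}" for h
      using order_tendstoD(2)[OF LIMSEQ_subseq_LIMSEQ[OF sl[OF that] \<sigma>(1)], of "e / 8"] e by (simp add: o_def)
    have "eventually (\<lambda>j. (\<integral>x. E x * defect (smear (\<rho> (\<sigma> j)) g x) \<partial>lborel) < e / 2) sequentially"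
      using order_tendstoD(2)[OF lim, of "e / 2"] n(2) by (simp add: E_def g_def a_def b_def)
    then show ?thesis using ev[of g] ev[of a] ev[of b] by (intro eventually_conj) simp_all
  qed
  from eventually_happens'[OF sequentially_bot this] obtain j0 where j0: "(\<integral>x. norm (smear (\<rho> (\<sigma> j0)) g x - g x) \<partial>lborel) < e / 8"
      "(\<integral>x. norm (smear (\<rho> (\<sigma> j0)) a x - a x) \<partial>lborel) < e / 8"
      "(\<integral>x. norm (smear (\<rho> (\<sigma> j0)) b x - b x) \<partial>lborel) < e / 8"
      "(\<integral>x. E x * defect (smear (\<rho> (\<sigma> j0)) g x) \<partial>lborel) < e / 2"
    by (elim exE conjE) (rule that)
  define j where "j = \<sigma> j0"
  note j0' = j0[folded j_def]
  interpret mollifier "k j" "B j" "\<rho> j" "\<rho>1 j" "\<rho>2 j" by (rule mol)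
  define u u1 u2 where "u = smear (\<rho> j) g" and "u1 x = - smear (\<rho>1 j) g x" and "u2 x = - smear (\<rho>2 j) g x" for x
  have cb: "cball x (k j) \<subseteq> \<Omega>" if "x \<in> K" for x
  proof -
    have "cball x (k j) \<subseteq> cball x r" using mol(2)[of j] by auto
    then show ?thesis using r(2) that by blast
  qed
  have u12: "u1 x = smear (\<rho> j) a x" "u2 x = smear (\<rho> j) b x" "Re (u1 x) + Im (u2 x) = 0" if "x \<in> K" for x
  proof -
    note w = smear_weak_derivative[OF gab cb[OF that]]
    show "u1 x = smear (\<rho> j) a x" "u2 x = smear (\<rho> j) b x" using w(1,2) by (simp_all add: u1_def u2_def)
    have "Re (u1 x) + Im (u2 x) = - (Re (smear (\<rho>1 j) g x) + Im (smear (\<rho>2 j) g x))"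
      by (simp add: u1_def u2_def)
    then show "Re (u1 x) + Im (u2 x) = 0" using w(3) by simp
  qed
  have cu: "continuous_on UNIV u1" "continuous_on UNIV u2"
    unfolding u1_def[abs_def] u2_def[abs_def] using continuous_smear_deriv[OF i(1)] by (auto intro!: continuous_intros)
  have uc: "continuous_on UNIV u" unfolding u_def by (rule continuous_smear[OF i(1)])
  have [measurable]: "u \<in> borel_measurable borel" using uc by (rule borel_measurable_continuous_onI)
  have im: "integrable lborel (\<lambda>x. u x - g x)" "integrable lborel (\<lambda>x. smear (\<rho> j) a x - a x)"
    "integrable lborel (\<lambda>x. smear (\<rho> j) b x - b x)"
    unfolding u_def using si by auto
  have "(\<integral>x\<in>K. norm (u x - m x) \<partial>lborel) \<le> (\<integral>x. norm (u x - g x) + norm (g x - m x) \<partial>lborel)"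
    unfolding set_lebesgue_integral_def
  proof (rule integral_mono')
    show "integrable lborel (\<lambda>x. norm (u x - g x) + norm (g x - m x))"
      using im i m by auto
    show "indicator K x *\<^sub>R norm (u x - m x) \<le> norm (u x - g x) + norm (g x - m x)" for x
      using norm_triangle_ineq[of "u x - g x" "g x - m x"] by (auto simp: indicator_def)
  qed auto
  also have "\<dots> < e"
    using im i m n(1) j0'(1) e by (subst Bochner_Integration.integral_add) (auto simp: u_def g_def)
  finally have 1: "(\<integral>x\<in>K. norm (u x - m x) \<partial>lborel) < e" .
  have iE: "integrable lborel (\<lambda>x. E x * defect (u x))"
    by (rule Bochner_Integration.integrable_bound[OF Ei])
      (use E0 defect_bounds in \<open>auto simp: abs_mult intro!: mult_left_le\<close>)
  have "(\<integral>x\<in>K. (norm (u1 x) + norm (u2 x)) * defect (u x) \<partial>lborel)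
     \<le> (\<integral>x. norm (smear (\<rho> j) a x - a x) + norm (smear (\<rho> j) b x - b x) + E x * defect (u x) \<partial>lborel)"
    unfolding set_lebesgue_integral_def
  proof (rule integral_mono')
    show "integrable lborel (\<lambda>x. norm (smear (\<rho> j) a x - a x) + norm (smear (\<rho> j) b x - b x) + E x * defect (u x))"
      using im iE by auto
    fix x
    have nn: "0 \<le> E x * defect (u x)" using E0 defect_bounds by simp
    then show "0 \<le> norm (smear (\<rho> j) a x - a x) + norm (smear (\<rho> j) b x - b x) + E x * defect (u x)" by simp
    show "indicator K x *\<^sub>R ((norm (u1 x) + norm (u2 x)) * defect (u x))
        \<le> norm (smear (\<rho> j) a x - a x) + norm (smear (\<rho> j) b x - b x) + E x * defect (u x)"
    proof (cases "x \<in> K")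
      case True
      define A where "A = norm (smear (\<rho> j) a x - a x) + norm (smear (\<rho> j) b x - b x)"
      have "norm (u1 x) + norm (u2 x) \<le> A + E x"
        using norm_triangle_sub[of "smear (\<rho> j) a x" "a x"] norm_triangle_sub[of "smear (\<rho> j) b x" "b x"]
        unfolding u12(1,2)[OF True] A_def E_def by linarith
      then have "(norm (u1 x) + norm (u2 x)) * defect (u x) \<le> (A + E x) * defect (u x)"
        using defect_bounds by (intro mult_right_mono) auto
      also have "\<dots> \<le> A + E x * defect (u x)"
        using mult_left_le[of "defect (u x)" A] defect_bounds by (simp add: distrib_right A_def)
      finally show ?thesis using True by (simp add: A_def)
    next
      case False
      then show ?thesis using nn by simp
    qed
  qed
  also have "\<dots> < e" using im iE j0' e by (simp add: u_def)
  finally have 2: "(\<integral>x\<in>K. (norm (u1 x) + norm (u2 x)) * defect (u x) \<partial>lborel) < e" .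
  have D: "(u has_derivative (\<lambda>w. Re w *\<^sub>R u1 x + Im w *\<^sub>R u2 x)) (at x)" for x
    unfolding u_def u1_def u2_def by (rule smear_has_derivative[OF i(1)])
  show "\<exists>u u1 u2. (\<forall>x. (u has_derivative (\<lambda>w. Re w *\<^sub>R u1 x + Im w *\<^sub>R u2 x)) (at x)) \<and>
       continuous_on UNIV u1 \<and> continuous_on UNIV u2 \<and> (\<forall>x\<in>K. Re (u1 x) + Im (u2 x) = 0) \<and>
       (\<integral>x\<in>K. norm (u x - m x) \<partial>lborel) < e \<and>
       (\<integral>x\<in>K. (norm (u1 x) + norm (u2 x)) * defect (u x) \<partial>lborel) < e"
    using D cu u12(3) 1 2 by (intro exI[of _ u] exI[of _ u1] exI[of _ u2]) simp
qed

end

section \<open>Essential cluster values\<close>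

text \<open>Insensitive to changes of \<open>m\<close> on null sets. A single radius for both
  position and value is enough, because the sets shrink in both respects with
  \<open>r\<close>.\<close>

definition ess_cluster :: "(complex \<Rightarrow> complex) \<Rightarrow> complex \<Rightarrow> complex set" where
  "ess_cluster m q = {a. \<forall>r>0. {x \<in> ball q r. dist (m x) a < r} \<notin> null_sets lborel}"

lemma ball_not_null:
  assumes "r > 0"
  shows "ball (q::complex) r \<notin> null_sets lborel"
proof
  assume "ball q r \<in> null_sets lborel"
  then have "negligible (ball q r)" by (simp add: negligible_iff_null_sets null_sets_completionI)
  then show False using open_not_negligible[of "ball q r"] assms by simp
qed

context
  fixes m :: "complex \<Rightarrow> complex"
  assumes m [measurable]: "m \<in> borel_measurable borel"
begin

lemma near_set_measurable [measurable]: "{x \<in> ball q r. dist (m x) a < s} \<in> sets borel"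
proof -
  have "{x \<in> ball q r. dist (m x) a < s} = ball q r \<inter> (m -` ball a s \<inter> space borel)"
    by (auto simp: dist_commute)
  also have "\<dots> \<in> sets borel" using measurable_sets[OF m, of "ball a s"] by auto
  finally show ?thesis .
qed

lemma near_set_null_mono:
  assumes "{x \<in> ball q r. dist (m x) a < r} \<in> null_sets lborel" "dist q q' + s \<le> r" "dist a a' + s \<le> r"
  shows "{x \<in> ball q' s. dist (m x) a' < s} \<in> null_sets lborel"
proof (rule null_sets_subset[OF assms(1)])
  show "{x \<in> ball q' s. dist (m x) a' < s} \<subseteq> {x \<in> ball q r. dist (m x) a < r}"
  proof safe
    fix x assume x: "x \<in> ball q' s" "dist (m x) a' < s"
    show "x \<in> ball q r" using x(1) assms(2) dist_triangle[of q x q'] by simp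
    show "dist (m x) a < r" using x(2) assms(3) dist_triangle[of "m x" a a'] by (simp add: dist_commute)
  qed
qed simp

text \<open>The whole graph is closed, not just each set of values: this moves values along
  converging points and yields continuity where the value is unique.\<close>

lemma closed_ess_cluster: "closed {p. snd p \<in> ess_cluster m (fst p)}"
proof -
  have "open (- {p. snd p \<in> ess_cluster m (fst p)})"
    unfolding open_dist
  proof
    fix p assume "p \<in> - {p. snd p \<in> ess_cluster m (fst p)}"
    then obtain r where r: "r > 0" "{x \<in> ball (fst p) r. dist (m x) (snd p) < r} \<in> null_sets lborel"
      by (auto simp: ess_cluster_def)
    have "p' \<in> - {p. snd p \<in> ess_cluster m (fst p)}" if "dist p' p < r / 2" for p'
    proof -
      have "dist (fst p) (fst p') \<le> dist p' p" "dist (snd p) (snd p') \<le> dist p' p"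
        using dist_fst_le[of p' p] dist_snd_le[of p' p] by (simp_all add: dist_commute)
      then have "{x \<in> ball (fst p') (r / 2). dist (m x) (snd p') < r / 2} \<in> null_sets lborel"
        using that by (intro near_set_null_mono[OF r(2)]) auto
      then show ?thesis using r(1) by (auto simp: ess_cluster_def intro!: exI[of _ "r / 2"])
    qed
    then show "\<exists>e>0. \<forall>y. dist y p < e \<longrightarrow> y \<in> - {p. snd p \<in> ess_cluster m (fst p)}"
      using r(1) by (intro exI[of _ "r / 2"]) auto
  qed
  then show ?thesis by (simp add: closed_def)
qed

text \<open>Every exceptional \<open>x\<close> lies in one of countably many null sets: centre and
  value of its null neighbourhood are replaced by elements of a countable dense set and the radius
  by some \<open>s n\<close>.\<close>

lemma AE_mem_ess_cluster: "AE x in lborel. m x \<in> ess_cluster m x"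
proof -
  obtain D :: "complex set" where D: "countable D" "\<And>X. open X \<Longrightarrow> X \<noteq> {} \<Longrightarrow> \<exists>d\<in>D. d \<in> X"
    using countable_dense_exists by blast
  define s where "s n = inverse (real (Suc n))" for n
  define E where "E = (\<lambda>(p, c, n). {x \<in> ball p (s n). dist (m x) c < s n})"
  define I where "I = {i \<in> D \<times> D \<times> UNIV. E i \<in> null_sets lborel}"
  have "countable (D \<times> D \<times> (UNIV :: nat set))" using D(1) by (intro countable_SIGMA) auto
  then have "countable I" unfolding I_def by (rule countable_subset[rotated]) auto
  then have N: "(\<Union>i\<in>I. E i) \<in> null_sets lborel"
    by (intro null_sets_UN') (auto simp: I_def)
  show ?thesis
  proof (rule AE_I'[OF N])
    show "{x \<in> space lborel. m x \<notin> ess_cluster m x} \<subseteq> (\<Union>i\<in>I. E i)"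
    proof
      fix x assume "x \<in> {x \<in> space lborel. m x \<notin> ess_cluster m x}"
      then obtain r where r: "r > 0" "{y \<in> ball x r. dist (m y) (m x) < r} \<in> null_sets lborel"
        by (auto simp: ess_cluster_def)
      obtain n where n: "s n < r / 2" using reals_Archimedean[of "r / 2"] r(1) by (auto simp: s_def)
      have s0: "s n > 0" by (simp add: s_def)
      obtain p where p: "p \<in> D" "p \<in> ball x (s n)" using D(2)[of "ball x (s n)"] s0 by auto
      obtain c where c: "c \<in> D" "c \<in> ball (m x) (s n)" using D(2)[of "ball (m x) (s n)"] s0 by auto
      have "{y \<in> ball p (s n). dist (m y) c < s n} \<in> null_sets lborel"
        using p(2) c(2) n by (intro near_set_null_mono[OF r(2)]) auto
      then have "(p, c, n) \<in> I" using p c by (simp add: I_def E_def)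
      moreover have "x \<in> E (p, c, n)" using p(2) c(2) by (simp add: E_def dist_commute)
      ultimately show "x \<in> (\<Union>i\<in>I. E i)" by blast
    qed
  qed
qed

text \<open>Otherwise finitely many value balls, each attained only on a null set near
  \<open>q\<close>, would cover the compact \<open>T\<close>, and a small ball around
  \<open>q\<close> would be null.\<close>

lemma ess_cluster_nonempty:
  assumes "compact T" "r0 > 0" "AE x in lborel. x \<in> ball q r0 \<longrightarrow> m x \<in> T"
  shows "ess_cluster m q \<noteq> {}"
proof
  assume e: "ess_cluster m q = {}"
  have "\<forall>a. \<exists>r>0. {x \<in> ball q r. dist (m x) a < r} \<in> null_sets lborel"
    using e by (auto simp: ess_cluster_def set_eq_iff)
  then obtain r where r: "\<And>a. r a > 0" "\<And>a. {x \<in> ball q (r a). dist (m x) a < r a} \<in> null_sets lborel"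
    by metis
  have "T \<subseteq> (\<Union>a\<in>T. ball a (r a))" using r(1) by auto
  then obtain A where A: "A \<subseteq> T" "finite A" "T \<subseteq> (\<Union>a\<in>A. ball a (r a))"
    using compactE_image[OF assms(1), of T "\<lambda>a. ball a (r a)"] by auto
  define s where "s = Min (insert r0 (r ` A))"
  have s: "s > 0" "s \<le> r0" "\<And>a. a \<in> A \<Longrightarrow> s \<le> r a" using A(2) r(1) assms(2) by (auto simp: s_def)
  have "AE x in lborel. \<forall>a\<in>A. x \<notin> {x \<in> ball q (r a). dist (m x) a < r a}"
    using A(2) r(2) by (intro AE_finite_allI AE_not_in) auto
  with assms(3) have "AE x in lborel. x \<notin> ball q s"
  proof eventually_elim
    case (elim x)
    show ?case
    proof
      assume x: "x \<in> ball q s"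
      then have "m x \<in> T" using elim(1) s(2) by auto
      then obtain a where a: "a \<in> A" "dist a (m x) < r a" using A(3) by auto
      then show False using elim(2) x s(3)[of a] by (auto simp: dist_commute)
    qed
  qed
  then have "ball q s \<in> null_sets lborel" by (subst (asm) AE_iff_null_sets[symmetric]) auto
  then show False using ball_not_null[OF s(1)] by blast
qed

lemma ess_cluster_closed_property:
  assumes "open \<Omega>" "q \<in> \<Omega>" "a \<in> ess_cluster m q" "closed T" "AE x in lborel. x \<in> \<Omega> \<longrightarrow> m x \<in> T"
  shows "a \<in> T"
proof (rule ccontr)
  assume "a \<notin> T"
  then obtain e where e: "e > 0" "ball a e \<subseteq> - T" using assms(4) by (metis ComplI open_Compl open_contains_ball)
  obtain d where d: "d > 0" "ball q d \<subseteq> \<Omega>" using assms(1,2) open_contains_ball by blast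
  define r where "r = min e d"
  have r: "r > 0" "r \<le> e" "r \<le> d" using e d by (auto simp: r_def)
  have "AE x in lborel. x \<notin> {x \<in> ball q r. dist (m x) a < r}"
    using assms(5)
  proof eventually_elim
    case (elim x)
    show ?case
    proof
      assume x: "x \<in> {x \<in> ball q r. dist (m x) a < r}"
      then have "x \<in> ball q d" using r(3) by auto
      then have "m x \<in> T" using elim d(2) by auto
      moreover have "m x \<in> ball a e" using x r(2) by (auto simp: dist_commute)
      ultimately show False using e(2) by auto
    qed
  qed
  then have "{x \<in> ball q r. dist (m x) a < r} \<in> null_sets lborel" by (subst (asm) AE_iff_null_sets[symmetric]) auto
  then show False using assms(3) r(1) by (auto simp: ess_cluster_def)
qed

end

text \<open>By Tonelli the measure of the intersection of \<open>A\<close> with the shifted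
  \<open>B\<close>, integrated over all shifts, is the product of the two measures.\<close>

lemma ex_shift_not_null:
  fixes A B :: "complex set"
  assumes [measurable]: "A \<in> sets borel" "B \<in> sets borel" and "A \<notin> null_sets lborel" "B \<notin> null_sets lborel"
  shows "\<exists>h. {x \<in> A. x + h \<in> B} \<notin> null_sets lborel"
proof (rule ccontr)
  assume "\<not> ?thesis"
  then have null: "{x \<in> A. x + h \<in> B} \<in> null_sets lborel" for h by blast
  have pm: "(\<lambda>(x, h). indicator A x * indicator B (x + h) :: ennreal) \<in> borel_measurable (lborel \<Otimes>\<^sub>M lborel)"
    by measurable
  have "(\<integral>\<^sup>+x. indicator A x * emeasure lborel B \<partial>lborel) = (\<integral>\<^sup>+x. (\<integral>\<^sup>+h. indicator A x * indicator B (x + h) \<partial>lborel) \<partial>lborel)"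
  proof (rule nn_integral_cong)
    fix x :: complex
    have "(\<integral>\<^sup>+h. indicator B (x + h) \<partial>lborel) = emeasure lborel B"
      using nn_integral_translate[of "indicator B" x] by (simp add: add.commute)
    then show "indicator A x * emeasure lborel B = (\<integral>\<^sup>+h. indicator A x * indicator B (x + h) \<partial>lborel)"
      by (subst nn_integral_cmult) auto
  qed
  also have "\<dots> = (\<integral>\<^sup>+h. (\<integral>\<^sup>+x. indicator A x * indicator B (x + h) \<partial>lborel) \<partial>lborel)"
    using lborel_pair.Fubini'[OF pm] by simp
  also have "\<dots> = (\<integral>\<^sup>+h. 0 \<partial>(lborel :: complex measure))"
  proof (rule nn_integral_cong)
    fix h :: complex
    have "(\<integral>\<^sup>+x. indicator A x * indicator B (x + h) \<partial>lborel) = (\<integral>\<^sup>+x. indicator {x \<in> A. x + h \<in> B} x \<partial>lborel)"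
      by (intro nn_integral_cong) (auto simp: indicator_def)
    also have "\<dots> = 0" using null[of h] by (subst nn_integral_indicator) auto
    finally show "(\<integral>\<^sup>+x. indicator A x * indicator B (x + h) \<partial>lborel) = 0" .
  qed
  finally have "emeasure lborel A * emeasure lborel B = 0"
    by (simp add: nn_integral_multc)
  then show False using assms by (auto simp: null_sets_def)
qed

context smooth_convex_norm
begin

text \<open>A strict violation persists for nearby directions and values.
  \<open>ex_shift_not_null\<close> provides a shift \<open>h\<close> close to \<open>q' - q\<close>
  that moves a set of positive measure with values near \<open>a\<close> into points with values
  near \<open>b\<close>; this contradicts \<open>kinetic_AE\<close> in the direction of
  \<open>h\<close>.\<close>

lemma ess_cluster_same_side:
  assumes \<Omega>: "open \<Omega>" and app: "approximable \<Omega> m" and m: "integrable lborel m"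
    and Nm: "AE x in lborel. x \<in> \<Omega> \<longrightarrow> N (m x) = 1"
    and q: "q \<noteq> q'" "closed_segment q q' \<subseteq> \<Omega>" "a \<in> ess_cluster m q" "b \<in> ess_cluster m q'"
  shows "0 \<le> cross (V (\<i> * (q' - q))) a * cross (V (\<i> * (q' - q))) b"
proof (rule ccontr)
  have [measurable]: "m \<in> borel_measurable borel" using m by auto
  assume neg: "\<not> 0 \<le> cross (V (\<i> * (q' - q))) a * cross (V (\<i> * (q' - q))) b"
  define f where "f p = cross (V (\<i> * fst p)) (fst (snd p)) * cross (V (\<i> * fst p)) (snd (snd p))"
    for p :: "complex \<times> complex \<times> complex"
  define p0 where "p0 = (q' - q, a, b)"
  have f0: "f p0 < 0" using neg by (simp add: f_def p0_def)
  have "(f \<longlongrightarrow> f p0) (nhds p0)"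
    unfolding f_def
    by (intro tendsto_mult tendsto_cross tendsto_V tendsto_fst tendsto_snd tendsto_const filterlim_ident)
      (use q(1) in \<open>auto simp: p0_def\<close>)
  then have "eventually (\<lambda>p. f p < 0) (nhds p0)" using f0 by (rule order_tendstoD)
  then obtain \<rho> where \<rho>: "\<rho> > 0" "\<And>p. dist p p0 < \<rho> \<Longrightarrow> f p < 0" unfolding eventually_nhds_metric by blast
  obtain r1 where r1: "r1 > 0" "(\<Union>x\<in>closed_segment q q'. cball x r1) \<subseteq> \<Omega>"
    using compact_subset_open_imp_cball_epsilon_subset[OF compact_segment \<Omega> q(2)] by blast
  \<comment> \<open>\<open>4 * r \<le> \<rho>\<close>: the shift is off by less than
    \<open>2 * r\<close> and each value by less than \<open>r\<close>.
    \<open>4 * r \<le> r1\<close>: a start in \<open>cball q (2 * r)\<close> and the error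
    \<open>2 * r\<close> of the shift stay in the tube around the segment.
    \<open>2 * r \<le> norm (q' - q)\<close> keeps \<open>h\<close> away from 0.\<close>
  define r where "r = min (\<rho> / 4) (min (norm (q' - q) / 2) (r1 / 4))"
  have r: "r > 0" "4 * r \<le> \<rho>" "2 * r \<le> norm (q' - q)" "4 * r \<le> r1" using \<rho>(1) r1(1) q(1) by (auto simp: r_def)
  define A B where "A = {x \<in> ball q r. dist (m x) a < r}" and "B = {x \<in> ball q' r. dist (m x) b < r}"
  have AB [measurable]: "A \<in> sets borel" "B \<in> sets borel" unfolding A_def B_def by simp_all
  have "A \<notin> null_sets lborel" "B \<notin> null_sets lborel"
    using q(3,4) r(1) by (auto simp: A_def B_def ess_cluster_def)
  then obtain h where h: "{x \<in> A. x + h \<in> B} \<notin> null_sets lborel" using ex_shift_not_null[OF AB] by blast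
  then obtain x0 where x0: "x0 \<in> A" "x0 + h \<in> B" by (metis (no_types, lifting) Collect_empty_eq null_sets.empty_sets)
  have hd: "norm (h - (q' - q)) < 2 * r"
  proof -
    have "h - (q' - q) = ((x0 + h) - q') + (q - x0)" by simp
    then have "norm (h - (q' - q)) \<le> norm ((x0 + h) - q') + norm (q - x0)" by (metis norm_triangle_ineq)
    also have "\<dots> < r + r" using x0 by (intro add_strict_mono) (auto simp: A_def B_def dist_norm norm_minus_commute)
    finally show ?thesis by simp
  qed
  then have h0: "h \<noteq> 0" using r(3) by (auto simp: norm_minus_commute)
  \<comment> \<open>Rotating \<open>h\<close> back makes it a multiple of a gradient:
    \<open>G_V\<close> yields \<open>h = l *\<^sub>R (\<i> * G z)\<close>, so the lines that belong
    to \<open>z\<close> run along \<open>h\<close>. Now \<open>V (\<i> * h)\<close> is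
    \<open>- z\<close> instead of \<open>z\<close>; the sign cancels in the product
    \<open>f\<close>.\<close>
  define w where "w = - (\<i> * h)"
  have w0: "w \<noteq> 0" using h0 by (simp add: w_def)
  define z where "z = V w"
  define \<nu> where "\<nu> = G z"
  define l where "l = V w \<bullet> w"
  have z1: "N z = 1" using w0 by (simp add: z_def)
  have z0: "z \<noteq> 0" using z1 by auto
  have l0: "l > 0" using dual_pos[OF w0] by (simp add: l_def)
  have "l *\<^sub>R \<nu> = w" using G_V[OF w0] by (simp add: l_def \<nu>_def z_def)
  then have lh: "l *\<^sub>R (\<i> * \<nu>) = h" by (metis w_def complex_i_mult_minus minus_mult_right mult_scaleR_right minus_minus)
  define K where "K = (\<lambda>(x, t). x + t *\<^sub>R h) ` (cball q (2 * r) \<times> {0..1})"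
  have K: "compact K" unfolding K_def
    by (intro compact_continuous_image compact_Times) (auto intro!: continuous_intros simp: case_prod_unfold)
  have K\<Omega>: "K \<subseteq> \<Omega>"
  proof
    fix y assume "y \<in> K"
    then obtain x t where y: "y = x + t *\<^sub>R h" "x \<in> cball q (2 * r)" "0 \<le> t" "t \<le> 1" by (auto simp: K_def)
    define p where "p = q + t *\<^sub>R (q' - q)"
    have "p = (1 - t) *\<^sub>R q + t *\<^sub>R q'" by (simp add: p_def algebra_simps)
    then have "p \<in> closed_segment q q'" using y(3,4) unfolding closed_segment_def by blast
    moreover have "dist p y \<le> r1"
    proof -
      have "p - y = (q - x) - t *\<^sub>R (h - (q' - q))" by (simp add: p_def y(1) algebra_simps)
      then have "norm (p - y) \<le> norm (q - x) + norm (t *\<^sub>R (h - (q' - q)))" by (metis norm_triangle_ineq4)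
      also have "\<dots> \<le> 2 * r + 1 * (2 * r)"
        unfolding norm_scaleR using y hd r(1) by (intro add_mono mult_mono) (auto simp: dist_norm)
      finally show ?thesis using r(4) by (simp add: dist_norm)
    qed
    ultimately have "y \<in> (\<Union>x\<in>closed_segment q q'. cball x r1)" by (intro UN_I[of p]) auto
    then show "y \<in> \<Omega>" using r1(2) by (rule rev_subsetD)
  qed
  have K3: "x + t *\<^sub>R (\<i> * \<nu>) \<in> K" if "x \<in> cball q (2 * r)" "0 \<le> t" "t \<le> l" for x t
  proof -
    have "t *\<^sub>R (\<i> * \<nu>) = (t / l) *\<^sub>R h" using l0 lh[symmetric] by simp
    then show ?thesis unfolding K_def using that l0 by (intro image_eqI[of _ _ "(x, t / l)"]) auto
  qed
  obtain H h' h'' Mh where st: "smooth_step H h' h'' Mh" using ex_smooth_step by blast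
  interpret smooth_step H h' h'' Mh by fact
  interpret norm_step N H h' h'' Mh by unfold_locales
  have kin: "AE x in lborel. x \<in> ball q r \<longrightarrow> sgn ((\<i> * z) \<bullet> m (x + l *\<^sub>R (\<i> * \<nu>))) = sgn ((\<i> * z) \<bullet> m x)"
    using N_has_derivative[OF z0] V_G(1)[OF z1] K3 l0 r(1) unfolding \<nu>_def
    by (intro kinetic_AE[OF app m Nm z1 _ _ K K\<Omega>]) auto
  have "AE x in lborel. x \<notin> {x \<in> A. x + h \<in> B}"
    using kin
  proof eventually_elim
    case (elim x)
    show ?case
    proof
      assume "x \<in> {x \<in> A. x + h \<in> B}"
      then have x: "x \<in> A" "x + h \<in> B" by auto
      have "sgn (cross z (m (x + h))) = sgn (cross z (m x))"
        using elim x(1) unfolding lh by (simp add: A_def cross_eq_inner)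
      then have "0 \<le> cross z (m x) * cross z (m (x + h))"
        by (metis linorder_le_cases mult_nonneg_nonneg mult_nonpos_nonpos sgn_0_0 sgn_greater sgn_less
            less_eq_real_def not_less)
      moreover have "V (\<i> * h) = - z"
        using V_minus[OF w0] by (simp add: z_def w_def)
      ultimately have "0 \<le> f (h, m x, m (x + h))" by (simp add: f_def)
      moreover have "f (h, m x, m (x + h)) < 0"
      proof (rule \<rho>(2))
        have "dist (h, m x, m (x + h)) p0 \<le> dist h (q' - q) + dist (m x, m (x + h)) (a, b)"
          unfolding p0_def by (subst dist_Pair_Pair) (rule sqrt_sum_squares_le_sum; simp)
        also have "dist (m x, m (x + h)) (a, b) \<le> dist (m x) a + dist (m (x + h)) b"
          by (subst dist_Pair_Pair) (rule sqrt_sum_squares_le_sum; simp)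
        also have "dist h (q' - q) + (dist (m x) a + dist (m (x + h)) b) < 2 * r + (r + r)"
          using hd x by (intro add_strict_mono) (auto simp: A_def B_def dist_norm)
        finally show "dist (h, m x, m (x + h)) p0 < \<rho>" using r(2) by simp
      qed
      ultimately show False by simp
    qed
  qed
  then have "{x \<in> A. x + h \<in> B} \<in> null_sets lborel"
    by (subst (asm) AE_iff_null_sets[symmetric]) measurable
  then show False using h by blast
qed

end

section \<open>Structure of zero-energy states\<close>

lemma null_if_locally_finite:
  assumes "locally_finite_in S \<Omega>" "S \<subseteq> \<Omega>"
  shows "negligible S"
proof (rule locally_negligible_alt[THEN iffD2], rule ballI)
  fix x assume "x \<in> S"
  then obtain U where U: "open U" "x \<in> U" "finite (S \<inter> U)"
    using assms unfolding locally_finite_in_def by blast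
  then show "\<exists>U. openin (top_of_set S) U \<and> x \<in> U \<and> negligible U"
    using \<open>x \<in> S\<close> by (intro exI[of _ "S \<inter> U"]) (auto intro: negligible_finite)
qed

lemma AE_lebesgue_not_mem: "negligible S \<Longrightarrow> AE x in lebesgue. x \<notin> (S :: complex set)"
  by (simp add: negligible_iff_null_sets AE_not_in)

context smooth_convex_norm
begin

theorem zero_energy_structure:
  assumes \<Omega>: "open \<Omega>" and app: "approximable \<Omega> m" and m: "integrable lborel m"
    and Nm: "AE x in lborel. x \<in> \<Omega> \<longrightarrow> N (m x) = 1"
  shows "\<exists>S \<subseteq> \<Omega>. locally_finite_in S \<Omega>
    \<and> (\<exists>m'. (AE x in lebesgue. x \<in> \<Omega> \<longrightarrow> m' x = m x) \<and> continuous_on (\<Omega> - S) m')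
    \<and> (\<forall>x0\<in>S. \<exists>\<beta>::real. \<beta> \<in> {-1, 1} \<and>
         (\<forall>U. convex U \<and> x0 \<in> interior U \<and> U \<subseteq> \<Omega> \<longrightarrow>
            (AE x in lebesgue. x \<in> U \<longrightarrow> m x = \<beta> *\<^sub>R vortex N (\<i> * (x - x0)))))"
proof -
  have mb: "m \<in> borel_measurable borel" using m by auto
  let ?C = "ess_cluster m"
  note cl = closed_ess_cluster[OF mb]
  have Cs: "N a = 1" if "q \<in> \<Omega>" "a \<in> ?C q" for q a
    using ess_cluster_closed_property[OF mb \<Omega> that, of "{v. N v = 1}"] Nm compact_imp_closed[OF compact_N_sphere] by auto
  have Cn: "?C q \<noteq> {}" if q: "q \<in> \<Omega>" for q
  proof -
    obtain d where d: "d > 0" "ball q d \<subseteq> \<Omega>" using \<Omega> q open_contains_ball by blast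
    have "AE x in lborel. x \<in> ball q d \<longrightarrow> m x \<in> {v. N v = 1}"
      using Nm by eventually_elim (use d(2) in auto)
    then show ?thesis by (rule ess_cluster_nonempty[OF mb compact_N_sphere d(1)])
  qed
  interpret direction_field N \<Omega> ?C
  proof
    show "a \<in> ?C q" if "q \<in> \<Omega>" "x \<longlonglongrightarrow> q" "\<And>n::nat. a \<in> ?C (x n)" for q a x
    proof -
      have "(\<lambda>n. (x n, a)) \<longlonglongrightarrow> (q, a)" using that(2) by (intro tendsto_intros)
      from closed_sequentially[OF cl _ this] that(3) show ?thesis by simp
    qed
    show "0 \<le> cross (V (\<i> * (q' - q))) a * cross (V (\<i> * (q' - q))) b"
      if "q \<noteq> q'" "closed_segment q q' \<subseteq> \<Omega>" "a \<in> ?C q" "b \<in> ?C q'" for q q' a b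
      by (rule ess_cluster_same_side[OF \<Omega> app m Nm that])
  qed (use Cs Cn in auto)
  define S where "S = {q \<in> \<Omega>. \<exists>a\<in>?C q. \<exists>b\<in>?C q. a \<noteq> b}"
  define m' where "m' q = (SOME a. a \<in> ?C q)" for q
  have m'_mem: "m' q \<in> ?C q" if "q \<in> \<Omega>" for q
  proof -
    have "\<exists>a. a \<in> ?C q" using Cn[OF \<open>q \<in> \<Omega>\<close>] by blast
    then obtain a where "a \<in> ?C q" ..
    then show ?thesis unfolding m'_def by (rule someI)
  qed
  have m'_eq: "a = m' q" if "q \<in> \<Omega> - S" "a \<in> ?C q" for q a
    using that m'_mem[of q] unfolding S_def by blast
  have vort: "\<exists>\<beta>\<in>{-1, 1::real}. \<forall>w\<in>D - {q}. ?C w = {\<beta> *\<^sub>R V (\<i> * (w - q))}"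
    if "convex D" "open D" "D \<subseteq> \<Omega>" "q \<in> D" "q \<in> S" for D q
    using multivalued_imp_vortex[OF that(1-4)] that(5) unfolding S_def by blast
  have lf: "locally_finite_in S \<Omega>"
    unfolding locally_finite_in_def
  proof
    fix x assume "x \<in> \<Omega>"
    then obtain d where d: "d > 0" "ball x d \<subseteq> \<Omega>" using \<Omega> open_contains_ball by blast
    \<comment> \<open>Around a singular point all other points of a ball inside \<Omega> have a
      single value, so the ball contains no second singular point.\<close>
    have "q' = q" if qq: "q \<in> S \<inter> ball x d" "q' \<in> S \<inter> ball x d" for q q'
    proof (rule ccontr)
      assume ne: "q' \<noteq> q"
      obtain \<beta> where "\<And>w. w \<in> ball x d - {q} \<Longrightarrow> ?C w = {\<beta> *\<^sub>R V (\<i> * (w - q))}"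
        using vort[OF convex_ball open_ball d(2), of q] qq by blast
      then have "?C q' = {\<beta> *\<^sub>R V (\<i> * (q' - q))}" using ne qq by blast
      then show False using qq(2) unfolding S_def by auto
    qed
    then have "\<exists>q. S \<inter> ball x d \<subseteq> {q}" by blast
    then have "finite (S \<inter> ball x d)" by (auto intro: finite_subset)
    then show "\<exists>U. open U \<and> x \<in> U \<and> finite (S \<inter> U)" using d(1) by (intro exI[of _ "ball x d"]) auto
  qed
  have S\<Omega>: "S \<subseteq> \<Omega>" by (auto simp: S_def)
  have memC: "AE x in lebesgue. m x \<in> ?C x" using AE_mem_ess_cluster[OF mb] by (rule AE_completion)
  have ae: "AE x in lebesgue. x \<in> \<Omega> \<longrightarrow> m' x = m x"
    using memC AE_lebesgue_not_mem[OF null_if_locally_finite[OF lf S\<Omega>]]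
    by eventually_elim (use m'_eq in auto)
  have cont: "continuous_on (\<Omega> - S) m'"
  proof -
    let ?T = "{v. N v = 1}"
    have "(\<lambda>x. (x, m' x)) ` (\<Omega> - S) = ((\<Omega> - S) \<times> ?T) \<inter> {p. snd p \<in> ?C (fst p)}"
      using m'_mem m'_eq Cs by force
    then have "closedin (top_of_set ((\<Omega> - S) \<times> ?T)) ((\<lambda>x. (x, m' x)) ` (\<Omega> - S))"
      using cl by (auto simp: closedin_closed)
    moreover have "m' \<in> (\<Omega> - S) \<rightarrow> ?T" using m'_mem Cs by auto
    ultimately show ?thesis using continuous_closed_graph_eq[OF compact_N_sphere] by blast
  qed
  have main: "\<exists>\<beta>::real. \<beta> \<in> {-1, 1} \<and> (\<forall>U. convex U \<and> x0 \<in> interior U \<and> U \<subseteq> \<Omega> \<longrightarrow>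
            (AE x in lebesgue. x \<in> U \<longrightarrow> m x = \<beta> *\<^sub>R vortex N (\<i> * (x - x0))))" if x0: "x0 \<in> S" for x0
  proof -
    obtain d where d: "d > 0" "ball x0 d \<subseteq> \<Omega>" using \<Omega> open_contains_ball x0 S\<Omega> by blast
    obtain \<beta> where \<beta>: "\<beta> \<in> {-1, 1::real}" "\<And>w. w \<in> ball x0 d - {x0} \<Longrightarrow> ?C w = {\<beta> *\<^sub>R V (\<i> * (w - x0))}"
      using vort[OF convex_ball open_ball d(2) centre_in_ball[THEN iffD2, OF d(1)] x0]
      by (elim bexE) (rule that, assumption, erule bspec, assumption)
    have "AE x in lebesgue. x \<in> U \<longrightarrow> m x = \<beta> *\<^sub>R vortex N (\<i> * (x - x0))"
      if U: "convex U" "x0 \<in> interior U" "U \<subseteq> \<Omega>" for U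
    proof -
      have "interior U \<subseteq> \<Omega>" using U(3) interior_subset by blast
      obtain \<gamma> where \<gamma>: "\<gamma> \<in> {-1, 1::real}" "\<And>w. w \<in> interior U - {x0} \<Longrightarrow> ?C w = {\<gamma> *\<^sub>R V (\<i> * (w - x0))}"
        using vort[OF convex_interior[OF U(1)] open_interior \<open>interior U \<subseteq> \<Omega>\<close> U(2) x0]
        by (elim bexE) (rule that, assumption, erule bspec, assumption)
      \<comment> \<open>The sign obtained on \<open>U\<close> must not depend on \<open>U\<close>;
        it is matched at a common point \<open>w\<close> with the sign on a ball fixed
        beforehand.\<close>
      have "open (interior U \<inter> ball x0 d)" "x0 \<in> interior U \<inter> ball x0 d" using U(2) d(1) by auto
      then obtain t where t: "t > 0" "\<And>s. \<bar>s\<bar> \<le> t \<Longrightarrow> x0 + s *\<^sub>R 1 \<in> interior U \<inter> ball x0 d"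
        by (rule small_steps[where d = 1]) auto
      define w where "w = x0 + t *\<^sub>R 1"
      have w: "w \<in> interior U - {x0}" "w \<in> ball x0 d - {x0}" using t(2)[of t] t(1) by (auto simp: w_def)
      have "\<beta> *\<^sub>R V (\<i> * (w - x0)) = \<gamma> *\<^sub>R V (\<i> * (w - x0))" using \<beta>(2)[OF w(2)] \<gamma>(2)[OF w(1)]
        by (metis singleton_inject)
      moreover have "N (V (\<i> * (w - x0))) = 1" using w by (intro N_V) auto
      then have "V (\<i> * (w - x0)) \<noteq> 0" by (metis N_zero zero_neq_one)
      ultimately have "\<beta> = \<gamma>" by simp
      have "negligible (U - interior U)"
        by (rule negligible_subset[OF negligible_convex_frontier[OF U(1)]])
          (use closure_subset in \<open>auto simp: frontier_def\<close>)
      then have "negligible (insert x0 (U - interior U))" by simp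
      from AE_lebesgue_not_mem[OF this] memC show ?thesis
      proof eventually_elim
        case (elim x)
        show ?case
        proof
          assume "x \<in> U"
          then have "x \<in> interior U - {x0}" using elim(1) by auto
          then have "m x = \<beta> *\<^sub>R V (\<i> * (x - x0))" "\<i> * (x - x0) \<noteq> 0"
            using \<gamma>(2)[of x] elim(2) \<open>\<beta> = \<gamma>\<close> by auto
          then show "m x = \<beta> *\<^sub>R vortex N (\<i> * (x - x0))" using vortex_eq_V by simp
        qed
      qed
    qed
    then show ?thesis using \<beta>(1) by blast
  qed
  show ?thesis using S\<Omega> lf ae cont main by (intro exI[of _ S] conjI ballI exI[of _ m']) auto
qed

end

text \<open>Near every point the cluster set is one and the same singleton, so the pointwise choice
  of a cluster value is automatically locally constant and no gluing of neighbourhoods is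
  required.\<close>

lemma locally_constant_representative:
  fixes m :: "complex \<Rightarrow> complex"
  assumes \<Omega>: "open \<Omega>" and m: "m \<in> borel_measurable borel"
    and lc: "\<And>q. q \<in> \<Omega> \<Longrightarrow> \<exists>r>0. \<exists>c. AE x in lborel. x \<in> ball q r \<longrightarrow> m x = c"
  shows "\<exists>m'. (AE x in lebesgue. x \<in> \<Omega> \<longrightarrow> m' x = m x) \<and> continuous_on \<Omega> m'"
proof -
  let ?C = "ess_cluster m"
  define m' where "m' q = (SOME a. a \<in> ?C q)" for q
  have loc: "\<exists>r>0. \<exists>c. \<forall>x\<in>ball q r. ?C x = {c} \<and> m' x = c" if q: "q \<in> \<Omega>" for q
  proof -
    obtain r c where rc: "r > 0" "AE x in lborel. x \<in> ball q r \<longrightarrow> m x = c" using lc[OF q] by blast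
    have "?C x = {c}" if x: "x \<in> ball q r" for x
    proof -
      have sub: "?C x \<subseteq> {c}"
        using ess_cluster_closed_property[OF m open_ball x, of _ "{c}"] rc(2) by auto
      obtain s where s: "s > 0" "ball x s \<subseteq> ball q r" using x open_ball open_contains_ball by blast
      have "AE y in lborel. y \<in> ball x s \<longrightarrow> m y \<in> {c}"
        using rc(2) by eventually_elim (use s(2) in auto)
      from ess_cluster_nonempty[OF m _ s(1) this] sub show ?thesis by auto
    qed
    then show ?thesis using rc(1) by (intro exI[of _ r] exI[of _ c]) (auto simp: m'_def)
  qed
  have "AE x in lebesgue. m x \<in> ?C x" using AE_mem_ess_cluster[OF m] by (rule AE_completion)
  then have "AE x in lebesgue. x \<in> \<Omega> \<longrightarrow> m' x = m x"
  proof eventually_elim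
    case (elim x)
    show ?case
    proof
      assume "x \<in> \<Omega>"
      from loc[OF this] obtain r c where "r > 0" "\<forall>y\<in>ball x r. ?C y = {c} \<and> m' y = c" by blast
      then show "m' x = m x" using elim by auto
    qed
  qed
  moreover have "continuous_on \<Omega> m'"
  proof (intro continuous_at_imp_continuous_on ballI)
    fix x assume "x \<in> \<Omega>"
    from loc[OF this] obtain r c where rc: "r > 0" "\<forall>y\<in>ball x r. ?C y = {c} \<and> m' y = c" by blast
    have "eventually (\<lambda>y. y \<in> ball x r) (nhds x)" using rc(1) by (intro eventually_nhds_in_open) auto
    then have "eventually (\<lambda>y. m' y = c) (nhds x)" by eventually_elim (use rc(2) in auto)
    then show "isCont m' x" by (simp add: isCont_cong)
  qed
  ultimately show ?thesis by blast
qed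

text \<open>Integrates the pointwise bound
  \<open>norm (g n x) \<le> a + (norm (g n x))\<^sup>2 / a\<close> over the finite measure set
  \<Omega>; first \<open>a\<close> is taken small, then \<open>n\<close> large.\<close>

lemma L2_null_imp_L1_null:
  fixes g :: "nat \<Rightarrow> complex \<Rightarrow> complex"
  assumes \<Omega>: "bounded \<Omega>" "open \<Omega>" and out: "\<And>n x. x \<notin> \<Omega> \<Longrightarrow> g n x = 0"
    and sq: "\<And>n. integrable lborel (\<lambda>x. (norm (g n x))\<^sup>2)" and [measurable]: "\<And>n. g n \<in> borel_measurable borel"
    and lim: "(\<lambda>n. \<integral>x. (norm (g n x))\<^sup>2 \<partial>lborel) \<longlonglongrightarrow> 0"
  shows "(\<lambda>n. \<integral>x. norm (g n x) \<partial>lborel) \<longlonglongrightarrow> 0"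
proof -
  have fin: "emeasure lborel \<Omega> < \<infinity>" using \<Omega>(1) by (rule emeasure_bounded_finite)
  have i\<Omega>: "integrable lborel (\<lambda>x. indicator \<Omega> x :: real)"
    using fin \<Omega>(2) by (intro integrable_real_indicator) auto
  have gi: "integrable lborel (g n)" for n
    by (rule integrable_of_square_integrable[OF \<Omega>(1,2) out sq]) auto
  define c where "c = measure lborel \<Omega>"
  have c: "c \<ge> 0" by (simp add: c_def)
  show ?thesis
  proof (rule LIMSEQ_I)
    fix e :: real assume e: "e > 0"
    define a where "a = e / (2 * (c + 1))"
    have a: "a > 0" using e c by (simp add: a_def)
    have ac: "a * c < e / 2"
    proof -
      have "a * c < a * (c + 1)" using a by simp
      also have "\<dots> = e / 2" using c by (simp add: a_def field_simps)
      finally show ?thesis .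
    qed
    obtain n0 where n0: "\<And>n. n \<ge> n0 \<Longrightarrow> (\<integral>x. (norm (g n x))\<^sup>2 \<partial>lborel) < a * (e / 2)"
      using order_tendstoD(2)[OF lim, of "a * (e / 2)"] a e by (auto simp: eventually_sequentially)
    have "norm ((\<integral>x. norm (g n x) \<partial>lborel) - 0) < e" if "n \<ge> n0" for n
    proof -
      have "(\<integral>x. norm (g n x) \<partial>lborel) \<le> (\<integral>x. a * indicator \<Omega> x + (norm (g n x))\<^sup>2 / a \<partial>lborel)"
      proof (rule integral_mono')
        show "integrable lborel (\<lambda>x. a * indicator \<Omega> x + (norm (g n x))\<^sup>2 / a)" using i\<Omega> sq by auto
        show "0 \<le> a * indicator \<Omega> x + (norm (g n x))\<^sup>2 / a" for x using a by simp
        show "norm (g n x) \<le> a * indicator \<Omega> x + (norm (g n x))\<^sup>2 / a" for x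
        proof (cases "x \<in> \<Omega>")
          case True
          have "2 * a * norm (g n x) \<le> a\<^sup>2 + (norm (g n x))\<^sup>2" by (rule sum_squares_bound)
          moreover have "0 \<le> a * norm (g n x)" using a by simp
          ultimately have "a * norm (g n x) \<le> a * a + (norm (g n x))\<^sup>2" by (simp add: power2_eq_square)
          then have "norm (g n x) \<le> (a * a + (norm (g n x))\<^sup>2) / a" using a by (simp add: pos_le_divide_eq mult.commute)
          then show ?thesis using True a by (simp add: add_divide_distrib)
        qed (use out in simp)
      qed
      also have "\<dots> = a * c + (\<integral>x. (norm (g n x))\<^sup>2 \<partial>lborel) / a"
        using i\<Omega> sq \<Omega>(2) by (simp add: c_def)
      also have "\<dots> < e / 2 + e / 2"
        using ac n0[OF that] a by (intro add_strict_mono) (auto simp: pos_divide_less_eq mult.commute)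
      finally show ?thesis by (simp add: abs_of_nonneg)
    qed
    then show "\<exists>n0. \<forall>n\<ge>n0. norm ((\<integral>x. norm (g n x) \<partial>lborel) - 0) < e" by blast
  qed
qed

lemma norm_smear_le:
  assumes "integrable lborel f" "\<And>y. \<bar>g y\<bar> \<le> (B::real)" "g \<in> borel_measurable borel"
  shows "norm (smear g f x) \<le> B * (\<integral>y. norm (f y) \<partial>lborel)"
proof -
  have "norm (smear g f x) \<le> (\<integral>y. norm (g (y - x) *\<^sub>R f y) \<partial>lborel)"
    unfolding smear_def by (rule integral_norm_bound)
  also have "\<dots> \<le> (\<integral>y. B * norm (f y) \<partial>lborel)"
  proof (rule integral_mono')
    show "norm (g (y - x) *\<^sub>R f y) \<le> B * norm (f y)" for y using assms(2)[of "y - x"] by (auto intro: mult_right_mono)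
    have "0 \<le> B" using assms(2)[of 0] by linarith
    then show "0 \<le> B * norm (f y)" for y by simp
  qed (use assms in auto)
  finally show ?thesis by simp
qed

text \<open>For a fixed mollifier the derivatives of the smeared \<open>m\<close> are limits of
  smeared weak derivatives, which tend to 0. So every \<open>smear (\<rho> j) m\<close> is constant
  on the same ball, and \<open>m\<close> is almost everywhere a limit of such constants along a
  subsequence.\<close>

lemma vanishing_gradient_imp_locally_constant:
  fixes f d1 d2 :: "nat \<Rightarrow> complex \<Rightarrow> complex"
  assumes \<Omega>: "open \<Omega>" and W: "\<And>n. W11_rep \<Omega> (f n) (d1 n) (d2 n)" and m: "integrable lborel m"
    and l: "(\<lambda>n. \<integral>x. norm (f n x - m x) \<partial>lborel) \<longlonglongrightarrow> 0"
    and l1: "(\<lambda>n. \<integral>x. norm (d1 n x) \<partial>lborel) \<longlonglongrightarrow> 0" and l2: "(\<lambda>n. \<integral>x. norm (d2 n x) \<partial>lborel) \<longlonglongrightarrow> 0"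
    and q: "q \<in> \<Omega>"
  shows "\<exists>r>0. \<exists>c. AE x in lborel. x \<in> ball q r \<longrightarrow> m x = c"
proof -
  have i: "integrable lborel (f n)" "integrable lborel (d1 n)" "integrable lborel (d2 n)" for n
    using W by (auto simp: W11_rep_def)
  obtain R where R: "R > 0" "ball q R \<subseteq> \<Omega>" using \<Omega> q open_contains_ball by blast
  define r where "r = R / 3"
  have r: "r > 0" using R by (simp add: r_def)
  have "\<exists>k B \<rho> \<rho>1 \<rho>2. (\<forall>j. mollifier (k j) (B j) (\<rho> j) (\<rho>1 j) (\<rho>2 j)) \<and> (\<forall>j. k j \<le> r) \<and>
    (\<forall>f\<in>{m}. \<forall>j. integrable lborel (\<lambda>x. smear (\<rho> j) f x - f x)) \<and>
    (\<forall>f\<in>{m}. (\<lambda>j. \<integral>x. norm (smear (\<rho> j) f x - f x) \<partial>lborel) \<longlonglongrightarrow> 0)"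
    by (rule ex_mollifier_sequence[OF r]) (use m in auto)
  then obtain k B \<rho> \<rho>1 \<rho>2 where mol: "\<forall>j. mollifier (k j) (B j) (\<rho> j) (\<rho>1 j) (\<rho>2 j)" "\<forall>j. k j \<le> r"
    and s: "\<forall>f\<in>{m}. \<forall>j. integrable lborel (\<lambda>x. smear (\<rho> j) f x - f x)"
      "\<forall>f\<in>{m}. (\<lambda>j. \<integral>x. norm (smear (\<rho> j) f x - f x) \<partial>lborel) \<longlonglongrightarrow> 0"
    by (elim exE conjE) (rule that)
  have const: "smear (\<rho> j) m x = smear (\<rho> j) m q" if x: "x \<in> ball q r" for x j
  proof -
    interpret mollifier "k j" "B j" "\<rho> j" "\<rho>1 j" "\<rho>2 j" using mol(1) by blast
    have zero: "smear g m x = 0" if x: "x \<in> ball q r"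
      and g: "(g, d) \<in> {(\<rho>1 j, d1), (\<rho>2 j, d2)}" for x g d
    proof -
      have gB: "\<bar>g y\<bar> \<le> B j" "g \<in> borel_measurable borel" for y using g bound by auto
      have di: "integrable lborel (d n)" for n using g i by auto
      have dl: "(\<lambda>n. \<integral>x. norm (d n x) \<partial>lborel) \<longlonglongrightarrow> 0" using g l1 l2 by auto
      have "cball x (k j) \<subseteq> ball q R"
      proof
        fix y assume "y \<in> cball x (k j)"
        then have "dist x y \<le> r" using spec[OF mol(2), of j] by simp
        then show "y \<in> ball q R" using x r dist_triangle[of q y x] by (simp add: r_def)
      qed
      then have cb: "cball x (k j) \<subseteq> \<Omega>" using R(2) by blast
      have eq: "- smear g (f n) x = smear (\<rho> j) (d n) x" for n
        using smear_weak_derivative(1,2)[OF W cb, of n] g by auto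
      have le: "norm (- smear g (f n) x) \<le> B j * (\<integral>y. norm (d n y) \<partial>lborel)" for n
        unfolding eq by (rule norm_smear_le[OF di]) (use bound in auto)
      have lim: "(\<lambda>n. B j * (\<integral>y. norm (d n y) \<partial>lborel)) \<longlonglongrightarrow> 0"
        using tendsto_mult[OF tendsto_const dl, of "B j"] by simp
      have "(\<lambda>n. - smear g (f n) x) \<longlonglongrightarrow> 0"
        by (rule Lim_null_comparison[OF always_eventually[OF allI[OF le]] lim])
      then have L0: "(\<lambda>n. smear g (f n) x) \<longlonglongrightarrow> 0" using tendsto_minus_cancel[of "\<lambda>n. smear g (f n) x" 0] by simp
      have eq': "smear g (f n) x - smear g m x = smear g (\<lambda>x. f n x - m x) x" for n
        unfolding smear_def using integrable_bounded_scaleR[OF i(1)[of n], of "\<lambda>y. g (y - x)" "B j"]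
          integrable_bounded_scaleR[OF m, of "\<lambda>y. g (y - x)" "B j"] gB
        by (simp add: scaleR_right_diff_distrib)
      have le': "norm (smear g (f n) x - smear g m x) \<le> B j * (\<integral>y. norm (f n y - m y) \<partial>lborel)" for n
        unfolding eq' by (rule norm_smear_le) (use i m gB in auto)
      have lim': "(\<lambda>n. B j * (\<integral>y. norm (f n y - m y) \<partial>lborel)) \<longlonglongrightarrow> 0"
        using tendsto_mult[OF tendsto_const l, of "B j"] by simp
      have "(\<lambda>n. smear g (f n) x - smear g m x) \<longlonglongrightarrow> 0"
        by (rule Lim_null_comparison[OF always_eventually[OF allI[OF le']] lim'])
      then have "(\<lambda>n. smear g (f n) x) \<longlonglongrightarrow> smear g m x" by (rule LIM_zero_cancel)
      then show ?thesis using L0 LIMSEQ_unique by blast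
    qed
    have "(smear (\<rho> j) m has_derivative (\<lambda>h. 0)) (at x within ball q r)" if "x \<in> ball q r" for x
      using smear_has_derivative[OF m, of x] zero[OF that, of "\<rho>1 j" d1] zero[OF that, of "\<rho>2 j" d2]
      by (auto intro: has_derivative_at_withinI)
    from has_derivative_zero_constant[OF convex_ball this] show ?thesis using x r by (metis centre_in_ball)
  qed
  obtain \<sigma> where \<sigma>: "strict_mono (\<sigma> :: nat \<Rightarrow> nat)" "AE x in lborel. (\<lambda>j. smear (\<rho> (\<sigma> j)) m x - m x) \<longlonglongrightarrow> 0"
  proof -
    have "\<And>j. integrable lborel (\<lambda>x. smear (\<rho> j) m x - m x)"
      "(\<lambda>j. \<integral>x. norm (smear (\<rho> j) m x - m x) \<partial>lborel) \<longlonglongrightarrow> 0" using s by simp_all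
    from tendsto_L1_AE_subseq[OF this] show thesis by (elim exE conjE) (rule that)
  qed
  define good where "good x \<longleftrightarrow> (\<lambda>j. smear (\<rho> (\<sigma> j)) m x - m x) \<longlonglongrightarrow> 0" for x
  have good: "AE x in lborel. good x" using \<sigma>(2) unfolding good_def .
  have "\<exists>x1\<in>ball q r. good x1"
  proof (rule ccontr)
    assume no: "\<not> ?thesis"
    have "AE x in lborel. x \<notin> ball q r" using good by eventually_elim (use no in blast)
    then have "ball q r \<in> null_sets lborel" by (subst (asm) AE_iff_null_sets[symmetric]) auto
    then show False using ball_not_null[OF r] by blast
  qed
  then obtain x1 where x1': "x1 \<in> ball q r" "good x1" by blast
  have conv: "(\<lambda>j. smear (\<rho> (\<sigma> j)) m x) \<longlonglongrightarrow> m x" if "good x" for x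
    using that unfolding good_def by (rule LIM_zero_cancel)
  have "AE x in lborel. x \<in> ball q r \<longrightarrow> m x = m x1"
    using good
  proof eventually_elim
    case (elim x)
    show ?case
    proof
      assume x: "x \<in> ball q r"
      have "(\<lambda>j. smear (\<rho> (\<sigma> j)) m x) \<longlonglongrightarrow> m x1"
        using conv[OF x1'(2)] unfolding const[OF x] const[OF x1'(1)] .
      with conv[OF elim] show "m x = m x1" by (rule LIMSEQ_unique)
    qed
  qed
  then show ?thesis using r by blast
qed

section \<open>From the given Sobolev sequence to Borel representatives and energy bounds\<close>

lemma L2_onD: "L2_on \<Omega> f \<Longrightarrow> set_borel_measurable lebesgue \<Omega> f"
  by (simp add: L2_on_def)

lemma W11_rep_of_W12:
  assumes \<Omega>: "open \<Omega>" "bounded \<Omega>" and W: "W12 \<Omega> f D1 D2" and dv: "div_free \<Omega> f"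
    and rep: "Borel_rep \<Omega> f g" "Borel_rep \<Omega> D1 d1" "Borel_rep \<Omega> D2 d2"
  shows "W11_rep \<Omega> g d1 d2"
proof -
  have L2: "L2_on \<Omega> f" "L2_on \<Omega> D1" "L2_on \<Omega> D2" using W by (auto simp: W12_def)
  have int: "integrable lborel b" if "L2_on \<Omega> a" "Borel_rep \<Omega> a b" for a b
    using that by (intro integrable_of_square_integrable[OF \<Omega>(2,1) _ Borel_rep_set_integrable[OF that]])
      (auto simp: Borel_rep_def)
  have key: "(\<integral>x\<in>\<Omega>. c x *\<^sub>R a x \<partial>lebesgue) = (\<integral>x. c x *\<^sub>R b x \<partial>lborel)"
    if "L2_on \<Omega> a" "Borel_rep \<Omega> a b" "continuous_on UNIV c" for a b and c :: "complex \<Rightarrow> real"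
  proof (rule Borel_rep_set_integral[OF L2_onD[OF that(1)] that(2)])
    have [measurable]: "c \<in> borel_measurable borel" using that(3) by (rule borel_measurable_continuous_onI)
    show "(\<lambda>(x, v). c x *\<^sub>R v) \<in> borel_measurable (borel \<Otimes>\<^sub>M (borel :: complex measure))" by measurable
  qed simp
  have "(\<integral>x. frechet_derivative \<phi> (at x) 1 *\<^sub>R g x \<partial>lborel) = - (\<integral>x. \<phi> x *\<^sub>R d1 x \<partial>lborel) \<and>
      (\<integral>x. frechet_derivative \<phi> (at x) \<i> *\<^sub>R g x \<partial>lborel) = - (\<integral>x. \<phi> x *\<^sub>R d2 x \<partial>lborel) \<and>
      (\<integral>x. g x \<bullet> grad2 \<phi> x \<partial>lborel) = 0" if t: "test_fun \<Omega> \<phi>" for \<phi>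
  proof -
    have "smooth2 \<phi>" using t by (simp add: test_fun_def)
    note c = smooth2_continuous[OF this]
    have [measurable]: "(\<lambda>x. frechet_derivative \<phi> (at x) 1) \<in> borel_measurable borel"
      "(\<lambda>x. frechet_derivative \<phi> (at x) \<i>) \<in> borel_measurable borel"
      using c(2,3) by (auto intro: borel_measurable_continuous_onI)
    have "(\<integral>x\<in>\<Omega>. f x \<bullet> grad2 \<phi> x \<partial>lebesgue) = (\<integral>x. g x \<bullet> grad2 \<phi> x \<partial>lborel)"
    proof (rule Borel_rep_set_integral[OF L2_onD[OF L2(1)] rep(1)])
      show "(\<lambda>(x, v). v \<bullet> grad2 \<phi> x) \<in> borel_measurable (borel \<Otimes>\<^sub>M borel)"
        unfolding grad2_def inner_complex_def complex.sel by measurable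
    qed simp
    then show ?thesis
      using W dv t key[OF L2(1) rep(1) c(2)] key[OF L2(1) rep(1) c(3)] key[OF L2(2) rep(2) c(1)] key[OF L2(3) rep(3) c(1)]
      unfolding W12_def weak_deriv_def div_free_def by simp
  qed
  then show ?thesis unfolding W11_rep_def using int L2 rep by blast
qed

text \<open>The two functions are treated as one function with values in pairs, so that
  \<open>Borel_rep_set_integral\<close> applies.\<close>

lemma Borel_rep_L2_dist:
  fixes f m :: "complex \<Rightarrow> complex"
  assumes "L2_on \<Omega> f" "L2_on \<Omega> m" "Borel_rep \<Omega> f g" "Borel_rep \<Omega> m h"
  shows "(\<integral>x\<in>\<Omega>. (norm (f x - m x))\<^sup>2 \<partial>lebesgue) = (\<integral>x. (norm (g x - h x))\<^sup>2 \<partial>lborel)"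
proof -
  have a: "set_borel_measurable lebesgue \<Omega> (\<lambda>x. (f x, m x))"
    using assms(1,2) borel_measurable_Pair[of "\<lambda>x. indicator \<Omega> x *\<^sub>R f x" lebesgue "\<lambda>x. indicator \<Omega> x *\<^sub>R m x"]
    by (simp add: L2_on_def set_borel_measurable_def)
  have b: "Borel_rep \<Omega> (\<lambda>x. (f x, m x)) (\<lambda>x. (g x, h x))"
  proof -
    have "AE x in lborel. indicator \<Omega> x *\<^sub>R f x = g x" "AE x in lborel. indicator \<Omega> x *\<^sub>R m x = h x"
      using assms(3,4) by (auto simp: Borel_rep_def)
    then have "AE x in lborel. indicator \<Omega> x *\<^sub>R (f x, m x) = (g x, h x)" by eventually_elim simp
    then show ?thesis using assms(3,4) by (auto simp: Borel_rep_def zero_prod_def intro: borel_measurable_Pair)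
  qed
  have mF: "(\<lambda>(x, v). (norm (fst v - snd v))\<^sup>2) \<in> borel_measurable (borel \<Otimes>\<^sub>M (borel :: (complex \<times> complex) measure))"
    unfolding borel_prod[symmetric] by measurable
  show ?thesis
    using Borel_rep_set_integral[of \<Omega> "\<lambda>x. (f x, m x)" "\<lambda>x. (g x, h x)" "\<lambda>x v. (norm (fst v - snd v))\<^sup>2", OF a b] mF
    by simp
qed

lemma I_eps_Borel_rep:
  assumes rep: "Borel_rep \<Omega> f g" "Borel_rep \<Omega> D1 d1" "Borel_rep \<Omega> D2 d2"
  shows "I_eps N \<Omega> e f D1 D2 = (\<integral>\<^sup>+x. ennreal (e * ((norm (d1 x))\<^sup>2 + (norm (d2 x))\<^sup>2)
        + (1 - (N (g x))\<^sup>2)\<^sup>2 / e) * indicator \<Omega> x \<partial>lborel)"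
  unfolding I_eps_def nn_integral_completion
proof (rule nn_integral_cong_AE)
  have "AE x in lborel. indicator \<Omega> x *\<^sub>R f x = g x" "AE x in lborel. indicator \<Omega> x *\<^sub>R D1 x = d1 x"
    "AE x in lborel. indicator \<Omega> x *\<^sub>R D2 x = d2 x" using rep by (auto simp: Borel_rep_def)
  then show "AE x in lborel. ennreal (e * ((norm (D1 x))\<^sup>2 + (norm (D2 x))\<^sup>2) + (1 - (N (f x))\<^sup>2)\<^sup>2 / e) * indicator \<Omega> x
    = ennreal (e * ((norm (d1 x))\<^sup>2 + (norm (d2 x))\<^sup>2) + (1 - (N (g x))\<^sup>2)\<^sup>2 / e) * indicator \<Omega> x"
    by eventually_elim (auto simp: indicator_def)
qed

lemma tendsto_0_of_ennreal_le:
  fixes X :: "nat \<Rightarrow> real"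
  assumes "\<And>n. 0 \<le> X n" "eventually (\<lambda>n. ennreal (X n) \<le> I n) sequentially" "I \<longlonglongrightarrow> 0"
  shows "X \<longlonglongrightarrow> 0"
proof -
  have "(\<lambda>n. ennreal (X n)) \<longlonglongrightarrow> ennreal 0"
    by (rule tendsto_sandwich[OF _ assms(2) _ assms(3)[folded ennreal_0]]) auto
  then show ?thesis by (rule tendsto_ennrealD) (use assms(1) in auto)
qed

text \<open>The squares of \<open>e * (a + b) - c\<close> and of \<open>e * (a - b)\<close> add up
  to the arithmetic-geometric mean bound for both gradient components at once. Here
  \<open>c = \<bar>1 - n\<^sup>2\<bar>\<close> dominates \<open>\<bar>1 - n\<bar>\<close>, since the
  other factor is \<open>1 + n\<close>. The left side is free of \<open>e\<close>.\<close>

lemma energy_density_bound: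
  fixes a b n e :: real
  assumes "0 \<le> a" "0 \<le> b" "0 \<le> n" "0 < e"
  shows "(a + b) * min 1 \<bar>1 - n\<bar> \<le> e * (a\<^sup>2 + b\<^sup>2) + (1 - n\<^sup>2)\<^sup>2 / e"
proof -
  define c where "c = \<bar>1 - n\<^sup>2\<bar>"
  have "1 - n\<^sup>2 = (1 - n) * (1 + n)" by (simp add: power2_eq_square algebra_simps)
  then have "c = \<bar>1 - n\<bar> * (1 + n)" using assms(3) by (simp add: c_def abs_mult)
  then have "\<bar>1 - n\<bar> \<le> c" using assms(3) mult_left_mono[of 1 "1 + n" "\<bar>1 - n\<bar>"] by simp
  then have le: "(a + b) * min 1 \<bar>1 - n\<bar> \<le> (a + b) * c" using assms by (intro mult_left_mono) auto
  have "0 \<le> (e * (a + b) - c)\<^sup>2 + e\<^sup>2 * (a - b)\<^sup>2" by simp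
  also have "\<dots> = 2 * e\<^sup>2 * (a\<^sup>2 + b\<^sup>2) - 2 * e * ((a + b) * c) + c\<^sup>2"
    by (simp add: power2_eq_square algebra_simps)
  also have "\<dots> \<le> 2 * e\<^sup>2 * (a\<^sup>2 + b\<^sup>2) - 2 * e * ((a + b) * c) + 2 * c\<^sup>2" by simp
  finally have "((a + b) * c) * e \<le> e\<^sup>2 * (a\<^sup>2 + b\<^sup>2) + c\<^sup>2" by argo
  then have "(a + b) * c \<le> (e\<^sup>2 * (a\<^sup>2 + b\<^sup>2) + c\<^sup>2) / e" using assms(4) by (simp only: pos_le_divide_eq)
  also have "\<dots> = e * (a\<^sup>2 + b\<^sup>2) + c\<^sup>2 / e"
    using assms(4) by (simp add: add_divide_distrib power2_eq_square)
  finally have "(a + b) * c \<le> e * (a\<^sup>2 + b\<^sup>2) + c\<^sup>2 / e" .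
  then show ?thesis using le by (simp add: c_def)
qed

context plane_norm
begin

text \<open>Fatou's lemma along a subsequence that converges almost everywhere.\<close>

lemma vanishing_defect:
  assumes \<Omega>: "open \<Omega>" and f: "\<And>n. integrable lborel (f n)" and m: "integrable lborel m"
    and l: "(\<lambda>n. \<integral>x. norm (f n x - m x) \<partial>lborel) \<longlonglongrightarrow> 0"
    and J: "(\<lambda>n. \<integral>\<^sup>+x. ennreal ((1 - (N (f n x))\<^sup>2)\<^sup>2) * indicator \<Omega> x \<partial>lborel) \<longlonglongrightarrow> 0"
  shows "AE x in lborel. x \<in> \<Omega> \<longrightarrow> N (m x) = 1"
proof -
  have [measurable]: "f n \<in> borel_measurable borel" "m \<in> borel_measurable borel" "\<Omega> \<in> sets borel" for n
    using f m \<Omega> by auto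
  have "\<And>n. integrable lborel (\<lambda>x. f n x - m x)" using f m by auto
  from tendsto_L1_AE_subseq[OF this l]
  obtain r where r: "strict_mono r" "AE x in lborel. (\<lambda>n. f (r n) x - m x) \<longlonglongrightarrow> 0"
    by (elim exE conjE) (rule that)
  define u where "u n x = ennreal ((1 - (N (f (r n) x))\<^sup>2)\<^sup>2) * indicator \<Omega> x" for n x
  have [measurable]: "u n \<in> borel_measurable lborel" for n unfolding u_def[abs_def] by measurable
  have "(\<integral>\<^sup>+x. liminf (\<lambda>n. u n x) \<partial>lborel) \<le> liminf (\<lambda>n. \<integral>\<^sup>+x. u n x \<partial>lborel)"
    by (rule nn_integral_liminf) measurable
  also have "(\<lambda>n. \<integral>\<^sup>+x. u n x \<partial>lborel) \<longlonglongrightarrow> 0"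
    using LIMSEQ_subseq_LIMSEQ[OF J r(1)] by (simp add: u_def o_def)
  then have "liminf (\<lambda>n. \<integral>\<^sup>+x. u n x \<partial>lborel) = 0" by (intro lim_imp_Liminf) auto
  finally have "(\<integral>\<^sup>+x. liminf (\<lambda>n. u n x) \<partial>lborel) = 0" by simp
  then have "AE x in lborel. liminf (\<lambda>n. u n x) = 0"
    by (subst (asm) nn_integral_0_iff_AE) auto
  then show ?thesis using r(2)
  proof eventually_elim
    case (elim x)
    show ?case
    proof
      assume x: "x \<in> \<Omega>"
      have "(\<lambda>n. f (r n) x) \<longlonglongrightarrow> m x" using elim(2) by (rule LIM_zero_cancel)
      then have "(\<lambda>n. u n x) \<longlonglongrightarrow> ennreal ((1 - (N (m x))\<^sup>2)\<^sup>2)"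
        unfolding u_def using x by (auto intro!: tendsto_intros)
      then have "liminf (\<lambda>n. u n x) = ennreal ((1 - (N (m x))\<^sup>2)\<^sup>2)" by (intro lim_imp_Liminf) auto
      then have "(N (m x))\<^sup>2 = 1" using elim(1) by (simp add: ennreal_eq_0_iff)
      then show "N (m x) = 1" using N_nonneg[of "m x"] by (auto simp: power2_eq_1_iff)
    qed
  qed
qed

end

theorem theorem1p4:
  fixes \<Omega> :: "complex set" and N :: "complex \<Rightarrow> real"
    and m :: "complex \<Rightarrow> complex" and mn D1 D2 :: "nat \<Rightarrow> complex \<Rightarrow> complex"
    and \<epsilon> :: "nat \<Rightarrow> real"
  assumes "open \<Omega>" and "bounded \<Omega>"
    and "is_norm2 N" and "strictly_convex_norm N" and "C1_off_origin N"
    and "\<And>n. W12 \<Omega> (mn n) (D1 n) (D2 n)"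
    and "\<And>n. div_free \<Omega> (mn n)"
    and "\<And>n. \<epsilon> n > 0"
    and "(\<lambda>n. I_eps N \<Omega> (\<epsilon> n) (mn n) (D1 n) (D2 n)) \<longlonglongrightarrow> 0"
    and "L2_on \<Omega> m"
    and "(\<lambda>n. \<integral>x\<in>\<Omega>. (norm (mn n x - m x))\<^sup>2 \<partial>lebesgue) \<longlonglongrightarrow> 0"
  shows "\<exists>S \<subseteq> \<Omega>. locally_finite_in S \<Omega>
    \<and> (\<exists>m'. (AE x in lebesgue. x \<in> \<Omega> \<longrightarrow> m' x = m x) \<and> continuous_on (\<Omega> - S) m')
    \<and> (\<forall>x0\<in>S. \<exists>\<beta>::real. \<beta> \<in> {-1, 1} \<and>
         (\<forall>U. convex U \<and> x0 \<in> interior U \<and> U \<subseteq> \<Omega> \<longrightarrow>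
            (AE x in lebesgue. x \<in> U \<longrightarrow> m x = \<beta> *\<^sub>R vortex N (\<i> * (x - x0)))))"
proof -
  interpret smooth_convex_norm N by unfold_locales (use assms(3-5) in auto)
  note \<Omega> = assms(1,2) and \<epsilon> = assms(8)
  have L2: "L2_on \<Omega> (mn n)" "L2_on \<Omega> (D1 n)" "L2_on \<Omega> (D2 n)" for n
    using assms(6)[of n] by (auto simp: W12_def)
  have "\<forall>n. \<exists>g. Borel_rep \<Omega> (mn n) g" "\<forall>n. \<exists>g. Borel_rep \<Omega> (D1 n) g" "\<forall>n. \<exists>g. Borel_rep \<Omega> (D2 n) g"
    using ex_Borel_rep[OF L2_onD \<Omega>(1)] L2 by auto
  then obtain f d1 d2 where rep: "\<And>n. Borel_rep \<Omega> (mn n) (f n)" "\<And>n. Borel_rep \<Omega> (D1 n) (d1 n)" "\<And>n. Borel_rep \<Omega> (D2 n) (d2 n)"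
    by metis
  obtain h where h: "Borel_rep \<Omega> m h" using ex_Borel_rep[OF L2_onD[OF assms(10)] \<Omega>(1)] by blast
  have W: "W11_rep \<Omega> (f n) (d1 n) (d2 n)" for n by (rule W11_rep_of_W12[OF \<Omega> assms(6,7) rep])
  have [measurable]: "f n \<in> borel_measurable borel" "d1 n \<in> borel_measurable borel" "d2 n \<in> borel_measurable borel"
    "h \<in> borel_measurable borel" "\<Omega> \<in> sets borel" for n
    using rep h \<Omega>(1) by (auto simp: Borel_rep_def)
  have out: "f n x = 0" "d1 n x = 0" "d2 n x = 0" "h x = 0" if "x \<notin> \<Omega>" for n x
    using rep h that by (auto simp: Borel_rep_def)
  have sq: "integrable lborel (\<lambda>x. (norm (d1 n x))\<^sup>2)" "integrable lborel (\<lambda>x. (norm (d2 n x))\<^sup>2)" for n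
    using Borel_rep_set_integrable[OF L2(2) rep(2)] Borel_rep_set_integrable[OF L2(3) rep(3)] by auto
  have sqf: "integrable lborel (\<lambda>x. (norm (f n x))\<^sup>2)" "integrable lborel (\<lambda>x. (norm (h x))\<^sup>2)" for n
    using Borel_rep_set_integrable[OF L2(1) rep(1)] Borel_rep_set_integrable[OF assms(10) h] by auto
  have hi: "integrable lborel h"
    by (rule integrable_of_square_integrable[OF \<Omega>(2,1) out(4) sqf(2)]) auto
  have fi: "integrable lborel (f n)" and di: "integrable lborel (d1 n)" "integrable lborel (d2 n)" for n
    using W[of n] by (auto simp: W11_rep_def)
  define E where "E n x = \<epsilon> n * ((norm (d1 n x))\<^sup>2 + (norm (d2 n x))\<^sup>2) + (1 - (N (f n x))\<^sup>2)\<^sup>2 / \<epsilon> n" for n x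
  have E0: "0 \<le> E n x" for n x using \<epsilon>[of n] by (simp add: E_def)
  define I where "I n = (\<integral>\<^sup>+x. ennreal (E n x) * indicator \<Omega> x \<partial>lborel)" for n
  have I: "I \<longlonglongrightarrow> 0"
    using assms(9) unfolding I_def[abs_def] E_def I_eps_Borel_rep[OF rep] .
  have l1: "(\<lambda>n. \<integral>x. norm (f n x - h x) \<partial>lborel) \<longlonglongrightarrow> 0"
  proof (rule L2_null_imp_L1_null[OF \<Omega>(2,1)])
    show "integrable lborel (\<lambda>x. (norm (f n x - h x))\<^sup>2)" for n
    proof (rule Bochner_Integration.integrable_bound)
      show "integrable lborel (\<lambda>x. 2 * (norm (f n x))\<^sup>2 + 2 * (norm (h x))\<^sup>2)" using sqf by auto
      show "AE x in lborel. norm ((norm (f n x - h x))\<^sup>2) \<le> norm (2 * (norm (f n x))\<^sup>2 + 2 * (norm (h x))\<^sup>2)"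
      proof (intro AE_I2)
        fix x
        have "(norm (f n x - h x))\<^sup>2 \<le> (norm (f n x) + norm (h x))\<^sup>2"
          by (intro power_mono norm_triangle_ineq4) auto
        also have "\<dots> \<le> 2 * (norm (f n x))\<^sup>2 + 2 * (norm (h x))\<^sup>2"
          using sum_squares_bound[of "norm (f n x)" "norm (h x)"] by (simp add: power2_sum)
        finally show "norm ((norm (f n x - h x))\<^sup>2) \<le> norm (2 * (norm (f n x))\<^sup>2 + 2 * (norm (h x))\<^sup>2)" by simp
      qed
    qed auto
    show "(\<lambda>n. \<integral>x. (norm (f n x - h x))\<^sup>2 \<partial>lborel) \<longlonglongrightarrow> 0"
      using assms(11) unfolding Borel_rep_L2_dist[OF L2(1) assms(10) rep(1) h] .
  qed (use out in auto)
  have hm: "AE x in lebesgue. x \<in> \<Omega> \<longrightarrow> h x = m x"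
  proof (rule AE_completion)
    have "AE x in lborel. indicator \<Omega> x *\<^sub>R m x = h x" using h by (simp add: Borel_rep_def)
    then show "AE x in lborel. x \<in> \<Omega> \<longrightarrow> h x = m x" by eventually_elim auto
  qed
  text \<open>If \<open>\<epsilon>\<close> tends to infinity, the limit need not have values on the unit circle of \<open>N\<close>, but then
    the gradients tend to 0 and the limit is locally constant.\<close>
  show ?thesis
  proof (cases "\<exists>M. infinite {n. \<epsilon> n \<le> M}")
    case True
    then obtain M where "infinite {n. \<epsilon> n \<le> M}" by blast
    from infinite_enumerate[OF this]
    obtain s :: "nat \<Rightarrow> nat" where s: "strict_mono s" "\<forall>n. s n \<in> {n. \<epsilon> n \<le> M}" by (elim exE conjE) (rule that)
    have lim: "(\<lambda>n. ennreal M * I (s n)) \<longlonglongrightarrow> 0"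
      using ennreal_tendsto_cmult[OF ennreal_less_top LIMSEQ_subseq_LIMSEQ[OF I s(1)], of M] by (simp add: o_def)
    \<comment> \<open>Clearing the denominator in the potential term costs a factor
      \<open>\<epsilon> (s n) \<le> M\<close>; this is where the bound on the subsequence
      enters.\<close>
    have le: "(\<integral>\<^sup>+x. ennreal ((1 - (N (f (s n) x))\<^sup>2)\<^sup>2) * indicator \<Omega> x \<partial>lborel) \<le> ennreal M * I (s n)" for n
    proof -
      have "(1 - (N (f (s n) x))\<^sup>2)\<^sup>2 \<le> M * E (s n) x" for x
      proof -
        have "(1 - (N (f (s n) x))\<^sup>2)\<^sup>2 \<le> \<epsilon> (s n) * E (s n) x"
          using \<epsilon>[of "s n"] by (simp add: E_def distrib_left)
        also have "\<dots> \<le> M * E (s n) x" using s(2) E0 by (intro mult_right_mono) auto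
        finally show ?thesis .
      qed
      then have "ennreal ((1 - (N (f (s n) x))\<^sup>2)\<^sup>2) \<le> ennreal M * ennreal (E (s n) x)" for x
        using E0 by (subst ennreal_mult''[symmetric]) (auto intro: ennreal_leI)
      then have "(\<integral>\<^sup>+x. ennreal ((1 - (N (f (s n) x))\<^sup>2)\<^sup>2) * indicator \<Omega> x \<partial>lborel)
        \<le> (\<integral>\<^sup>+x. ennreal M * (ennreal (E (s n) x) * indicator \<Omega> x) \<partial>lborel)"
        by (intro nn_integral_mono) (auto simp: indicator_def)
      also have "\<dots> = ennreal M * I (s n)"
        unfolding I_def E_def by (rule nn_integral_cmult) measurable
      finally show ?thesis .
    qed
    have J: "(\<lambda>n. \<integral>\<^sup>+x. ennreal ((1 - (N (f (s n) x))\<^sup>2)\<^sup>2) * indicator \<Omega> x \<partial>lborel) \<longlonglongrightarrow> 0"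
      by (rule tendsto_sandwich[OF always_eventually[OF allI[OF zero_le]] always_eventually[OF allI[OF le]] tendsto_const lim])
    have "(\<lambda>n. \<integral>x. norm (f (s n) x - h x) \<partial>lborel) \<longlonglongrightarrow> 0"
      using LIMSEQ_subseq_LIMSEQ[OF l1 s(1)] by (simp add: o_def)
    from vanishing_defect[OF \<Omega>(1) fi hi this J]
    have Nh: "AE x in lborel. x \<in> \<Omega> \<longrightarrow> N (h x) = 1" .
    \<comment> \<open>Here the full sequence can be used: the product of gradient and defect is at
      most the energy density for every positive \<epsilon>.\<close>
    have "(\<lambda>n. \<integral>x. (norm (d1 n x) + norm (d2 n x)) * defect (f n x) \<partial>lborel) \<longlonglongrightarrow> 0"
    proof (rule tendsto_0_of_ennreal_le[OF _ always_eventually I], rule_tac [2] allI)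
      fix n
      have [measurable]: "defect \<in> borel_measurable borel"
        by (intro borel_measurable_continuous_onI continuous_defect)
      show "0 \<le> (\<integral>x. (norm (d1 n x) + norm (d2 n x)) * defect (f n x) \<partial>lborel)"
        using defect_bounds by (intro Bochner_Integration.integral_nonneg) auto
      have "integrable lborel (\<lambda>x. norm (d1 n x) + norm (d2 n x))" using di by auto
      then have "integrable lborel (\<lambda>x. (norm (d1 n x) + norm (d2 n x)) * defect (f n x))"
        by (rule Bochner_Integration.integrable_bound) (use defect_bounds in \<open>auto simp: abs_mult intro!: mult_left_le\<close>)
      then have "ennreal (\<integral>x. (norm (d1 n x) + norm (d2 n x)) * defect (f n x) \<partial>lborel)
        = (\<integral>\<^sup>+x. ennreal ((norm (d1 n x) + norm (d2 n x)) * defect (f n x)) \<partial>lborel)"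
        using defect_bounds by (intro nn_integral_eq_integral[symmetric]) auto
      also have "\<dots> \<le> I n"
        unfolding I_def
      proof (rule nn_integral_mono)
        fix x
        have le: "(norm (d1 n x) + norm (d2 n x)) * defect (f n x) \<le> E n x"
          unfolding E_def defect_def by (rule energy_density_bound) (use \<epsilon>[of n] in auto)
        show "ennreal ((norm (d1 n x) + norm (d2 n x)) * defect (f n x)) \<le> ennreal (E n x) * indicator \<Omega> x"
          using ennreal_leI[OF le] out(2,3)[of x n] by (cases "x \<in> \<Omega>") simp_all
      qed
      finally show "ennreal (\<integral>x. (norm (d1 n x) + norm (d2 n x)) * defect (f n x) \<partial>lborel) \<le> I n" .
    qed
    from zero_energy_structure[OF \<Omega>(1) approximableI[OF \<Omega>(1) W hi l1 this] hi Nh]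
    obtain S m' where S: "S \<subseteq> \<Omega>" "locally_finite_in S \<Omega>" "continuous_on (\<Omega> - S) m'"
      and m': "AE x in lebesgue. x \<in> \<Omega> \<longrightarrow> m' x = h x"
      and vort: "\<forall>x0\<in>S. \<exists>\<beta>::real. \<beta> \<in> {-1, 1} \<and> (\<forall>U. convex U \<and> x0 \<in> interior U \<and> U \<subseteq> \<Omega> \<longrightarrow>
            (AE x in lebesgue. x \<in> U \<longrightarrow> h x = \<beta> *\<^sub>R vortex N (\<i> * (x - x0))))"
      by (elim exE conjE) (rule that)
    have 1: "AE x in lebesgue. x \<in> \<Omega> \<longrightarrow> m' x = m x"
      using m' hm by eventually_elim auto
    have 2: "\<exists>\<beta>::real. \<beta> \<in> {-1, 1} \<and> (\<forall>U. convex U \<and> x0 \<in> interior U \<and> U \<subseteq> \<Omega> \<longrightarrow>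
            (AE x in lebesgue. x \<in> U \<longrightarrow> m x = \<beta> *\<^sub>R vortex N (\<i> * (x - x0))))" if x0: "x0 \<in> S" for x0
    proof -
      obtain \<beta> :: real where \<beta>: "\<beta> \<in> {-1, 1}" "\<And>U. convex U \<and> x0 \<in> interior U \<and> U \<subseteq> \<Omega> \<Longrightarrow>
            (AE x in lebesgue. x \<in> U \<longrightarrow> h x = \<beta> *\<^sub>R vortex N (\<i> * (x - x0)))"
        using bspec[OF vort x0] by (elim exE conjE) (rule that, simp, blast)
      have "AE x in lebesgue. x \<in> U \<longrightarrow> m x = \<beta> *\<^sub>R vortex N (\<i> * (x - x0))"
        if U: "convex U \<and> x0 \<in> interior U \<and> U \<subseteq> \<Omega>" for U
        using \<beta>(2)[OF U] hm by eventually_elim (use U in auto)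
      then show ?thesis using \<beta>(1) by blast
    qed
    show ?thesis using S 1 2 by (intro exI[of _ S] conjI ballI exI[of _ m']) auto
  next
    case False
    \<comment> \<open>Eventually the gradient term of the energy has a coefficient above 1, so the
      gradients tend to 0 in L2.\<close>
    then have "finite {n. \<epsilon> n \<le> 1}" by blast
    then have ev: "eventually (\<lambda>n. \<epsilon> n > 1) sequentially"
      using eventually_cofinite[of "\<lambda>n. \<epsilon> n > 1"] by (simp add: cofinite_eq_sequentially not_less)
    have L1d: "(\<lambda>n. \<integral>x. norm (d n x) \<partial>lborel) \<longlonglongrightarrow> 0" if d: "d \<in> {d1, d2}" for d
    proof (rule L2_null_imp_L1_null[OF \<Omega>(2,1)])
      show sqd: "integrable lborel (\<lambda>x. (norm (d n x))\<^sup>2)" for n using sq d by auto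
      show "(\<lambda>n. \<integral>x. (norm (d n x))\<^sup>2 \<partial>lborel) \<longlonglongrightarrow> 0"
      proof (rule tendsto_0_of_ennreal_le[OF _ _ I])
        show "eventually (\<lambda>n. ennreal (\<integral>x. (norm (d n x))\<^sup>2 \<partial>lborel) \<le> I n) sequentially"
          using ev
        proof eventually_elim
          case (elim n)
          have "ennreal (\<integral>x. (norm (d n x))\<^sup>2 \<partial>lborel) = (\<integral>\<^sup>+x. ennreal ((norm (d n x))\<^sup>2) \<partial>lborel)"
            using sqd by (intro nn_integral_eq_integral[symmetric]) auto
          also have "\<dots> \<le> I n"
            unfolding I_def
          proof (rule nn_integral_mono)
            fix x
            have "(norm (d n x))\<^sup>2 \<le> 1 * ((norm (d1 n x))\<^sup>2 + (norm (d2 n x))\<^sup>2)" using d by auto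
            also have "\<dots> \<le> \<epsilon> n * ((norm (d1 n x))\<^sup>2 + (norm (d2 n x))\<^sup>2)" using elim by (intro mult_right_mono) auto
            also have "\<dots> \<le> E n x" using \<epsilon>[of n] by (simp add: E_def)
            finally show "ennreal ((norm (d n x))\<^sup>2) \<le> ennreal (E n x) * indicator \<Omega> x"
              using out(2,3)[of x n] d by (cases "x \<in> \<Omega>") (auto intro: ennreal_leI)
          qed
          finally show ?case .
        qed
      qed simp
    qed (use out d in auto)
    have "\<exists>m'. (AE x in lebesgue. x \<in> \<Omega> \<longrightarrow> m' x = h x) \<and> continuous_on \<Omega> m'"
    proof (rule locally_constant_representative[OF \<Omega>(1)])
      show "\<exists>r>0. \<exists>c. AE x in lborel. x \<in> ball q r \<longrightarrow> h x = c" if "q \<in> \<Omega>" for q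
        by (rule vanishing_gradient_imp_locally_constant[OF \<Omega>(1) W hi l1 L1d L1d that]) simp_all
    qed simp
    then obtain m' where m': "AE x in lebesgue. x \<in> \<Omega> \<longrightarrow> m' x = h x" "continuous_on \<Omega> m'" by blast
    have "AE x in lebesgue. x \<in> \<Omega> \<longrightarrow> m' x = m x"
      using m'(1) hm by eventually_elim auto
    then show ?thesis using m'(2)
      by (intro exI[of _ "{}"] conjI exI[of _ m']) (auto simp: locally_finite_in_def)
  qed
qed

end
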